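(* Let $M^n$ be a smooth manifold of dimension $n$ and let $g$ and $\bar g$ be $C^2$-smooth Riemannian metrics on $M^n$. Let the functions $I_0,I_1,\dots,I_{n-1}:T^*M^n\to\mathbb{R}$ be those constructed from the pair $(g,\bar g)$ as in the context. If $g$ and $\bar g$ are geodesically equivalent, then the functions $I_k$, $k=0,\dots,n-1$, pairwise commute with respect to the Poisson bracket of the standard symplectic form on $T^*M^n$. In particular, they are integrals in involution of the geodesic flow of the metric $g$.
   Context: Two metrics $g,\bar g$ on the same manifold are geodesically equivalent if they have the same geodesics, considered as unparameterized curves. Let $G:TM^n\to TM^n$ be the fiberwise-linear mapping given by $G^i_j=g^{i\alpha}\bar g_{\alpha j}$, i.e. $g(G(\xi),\nu)=\bar g(\xi,\nu)$ for all $\xi,\nu\in T_xM^n$. Write $\det(G-\mu E)=c_0\mu^n+c_1\mu^{n-1}+\dots+c_n$, where $E$ is the identity; the coefficients $c_i$ are functions on $M^n$, and $c_0\equiv(-1)^n$. For $k=0,\dots,n-1$ define the fiberwise-linear mappings $S_k:TM^n\to TM^n$ by $$S_k=\left(\frac{\det(g)}{\det(\bar g)}\right)^{\frac{k+2}{n+1}}\sum_{i=0}^k c_i\,G^{k-i+1},$$ and define the functions $I_k:T^*M^n\to\mathbb{R}$ by $I_k(x,p)=g^{\alpha i}(S_k)^j_\alpha p_ip_j$ (summation over repeated indices). Equivalently, after identifying $T^*M^n$ with $TM^n$ by means of $g$, $I_k(x,\xi)=g(S_k(\xi),\xi)$. The geodesic flow of $g$ is the Hamiltonian system on $T^*M^n$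 (with its standard symplectic form) with Hamiltonian $H(\xi)=\frac12 g(\xi,\xi)$. *)

theory Defs
  imports "HOL-Analysis.Analysis" "HOL-Computational_Algebra.Polynomial"
begin

section \<open>Functions of class \<open>C\<^sup>k\<close> on open sets\<close>

fun Ck_on :: "nat \<Rightarrow> 'a::real_normed_vector set \<Rightarrow> ('a \<Rightarrow> 'b::real_normed_vector) \<Rightarrow> bool" where
  "Ck_on 0 S f \<longleftrightarrow> continuous_on S f"
| "Ck_on (Suc k) S f \<longleftrightarrow>
     (\<forall>x\<in>S. f differentiable (at x)) \<and> (\<forall>v. Ck_on k S (\<lambda>x. frechet_derivative f (at x) v))"

definition smooth_on :: "'a::real_normed_vector set \<Rightarrow> ('a \<Rightarrow> 'b::real_normed_vector) \<Rightarrow> bool" where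
  "smooth_on S f \<longleftrightarrow> (\<forall>k. Ck_on k S f)"


section \<open>Smooth manifolds\<close>

text \<open>
  A chart is a pair of its domain and a coordinate map (whose values outside the domain are
  irrelevant).  A manifold of dimension \<open>CARD('n)\<close> is a type \<open>'m\<close> carrying a Hausdorff second
  countable topology, together with a smooth atlas of charts into \<open>real ^ 'n\<close>; the atlas need not
  be maximal.
\<close>

type_synonym ('m, 'n) chart = "'m set \<times> ('m \<Rightarrow> real ^ 'n)"

abbreviation chart_dom :: "('m, 'n::finite) chart \<Rightarrow> 'm set" where
  "chart_dom \<equiv> fst"

abbreviation coord :: "('m, 'n::finite) chart \<Rightarrow> 'm \<Rightarrow> real ^ 'n" where
  "coord \<equiv> snd"

definition chart_im :: "('m, 'n::finite) chart \<Rightarrow> (real ^ 'n) set" where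
  "chart_im c = coord c ` chart_dom c"

definition chart_inv :: "('m, 'n::finite) chart \<Rightarrow> real ^ 'n \<Rightarrow> 'm" where
  "chart_inv c = inv_into (chart_dom c) (coord c)"

definition transition :: "('m, 'n::finite) chart \<Rightarrow> ('m, 'n) chart \<Rightarrow> real ^ 'n \<Rightarrow> real ^ 'n" where
  "transition c d = coord d \<circ> chart_inv c"

definition smooth_atlas :: "('m::{t2_space,second_countable_topology}, 'n::finite) chart set \<Rightarrow> bool" where
  "smooth_atlas A \<longleftrightarrow>
     (\<Union>c\<in>A. chart_dom c) = UNIV \<and>
     (\<forall>c\<in>A. open (chart_dom c) \<and> open (chart_im c) \<and>
            homeomorphism (chart_dom c) (chart_im c) (coord c) (chart_inv c)) \<and>
     (\<forall>c\<in>A. \<forall>d\<in>A. smooth_on (coord c ` (chart_dom c \<inter> chart_dom d)) (transition c d))"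

definition chart_at :: "('m, 'n::finite) chart set \<Rightarrow> 'm \<Rightarrow> ('m, 'n) chart" where
  "chart_at A m = (SOME c. c \<in> A \<and> m \<in> chart_dom c)"


section \<open>Riemannian metrics\<close>

text \<open>
  A metric is given by its matrix of components \<open>g c m $ i $ j\<close> in every chart \<open>c\<close> around
  \<open>m\<close>, subject to the transformation law of a covariant 2-tensor.
\<close>

type_synonym ('m, 'n) tensor2 = "('m, 'n) chart \<Rightarrow> 'm \<Rightarrow> real ^ 'n ^ 'n"

definition C2_riemannian_metric ::
  "('m::{t2_space,second_countable_topology}, 'n::finite) chart set \<Rightarrow> ('m, 'n) tensor2 \<Rightarrow> bool" where
  "C2_riemannian_metric A g \<longleftrightarrow>
     (\<forall>c\<in>A. Ck_on 2 (chart_im c) (\<lambda>x. g c (chart_inv c x))) \<and>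
     (\<forall>c\<in>A. \<forall>m\<in>chart_dom c.
        transpose (g c m) = g c m \<and> (\<forall>v. v \<noteq> 0 \<longrightarrow> v \<bullet> (g c m *v v) > 0)) \<and>
     (\<forall>c\<in>A. \<forall>d\<in>A. \<forall>m\<in>chart_dom c \<inter> chart_dom d.
        let J = jacobian (transition c d) (at (coord c m))
        in g c m = transpose J ** g d m ** J)"

definition partial_metric ::
  "('m, 'n) tensor2 \<Rightarrow> ('m, 'n::finite) chart \<Rightarrow> 'm \<Rightarrow> 'n \<Rightarrow> 'n \<Rightarrow> 'n \<Rightarrow> real" where
  "partial_metric g c m k i j =
     frechet_derivative (\<lambda>x. g c (chart_inv c x) $ i $ j) (at (coord c m)) (axis k 1)"

definition christoffel ::
  "('m, 'n) tensor2 \<Rightarrow> ('m, 'n::finite) chart \<Rightarrow> 'm \<Rightarrow> 'n \<Rightarrow> 'n \<Rightarrow> 'n \<Rightarrow> real" where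
  "christoffel g c m i j k =
     (1/2) * (\<Sum>l\<in>UNIV. matrix_inv (g c m) $ i $ l *
       (partial_metric g c m j l k + partial_metric g c m k l j - partial_metric g c m l j k))"


section \<open>Geodesics and geodesic equivalence\<close>

definition open_interval :: "real set \<Rightarrow> bool" where
  "open_interval T \<longleftrightarrow> open T \<and> is_interval T \<and> T \<noteq> {}"

text \<open>Affinely parameterized, non-constant geodesics; \<open>v\<close> is the velocity in the chart \<open>c\<close>.\<close>

definition geodesic ::
  "('m::{t2_space,second_countable_topology}, 'n::finite) chart set \<Rightarrow> ('m, 'n) tensor2 \<Rightarrow>
   real set \<Rightarrow> (real \<Rightarrow> 'm) \<Rightarrow> bool" where
  "geodesic A g T \<gamma> \<longleftrightarrow>
     open_interval T \<and> continuous_on T \<gamma> \<and>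
     (\<forall>c\<in>A. \<exists>v. \<forall>t\<in>T. \<gamma> t \<in> chart_dom c \<longrightarrow>
        v t \<noteq> 0 \<and>
        ((\<lambda>s. coord c (\<gamma> s)) has_vector_derivative v t) (at t) \<and>
        (v has_vector_derivative
           (\<chi> i. - (\<Sum>j\<in>UNIV. \<Sum>k\<in>UNIV. christoffel g c (\<gamma> t) i j k * v t $ j * v t $ k))) (at t))"

text \<open>
  Two parameterized curves represent the same unparameterized curve if they differ by a
  \<open>C\<^sup>2\<close>-diffeomorphism \<open>\<phi>\<close> of their parameter intervals (orientation may be reversed;
  injectivity of \<open>\<phi>\<close> follows from its derivative having no zero on an interval).
\<close>

definition same_unparameterized ::
  "real set \<Rightarrow> (real \<Rightarrow> 'm) \<Rightarrow> real set \<Rightarrow> (real \<Rightarrow> 'm) \<Rightarrow> bool" where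
  "same_unparameterized T \<gamma> T' \<gamma>' \<longleftrightarrow>
     (\<exists>\<phi>::real \<Rightarrow> real. Ck_on 2 T \<phi> \<and> (\<forall>t\<in>T. deriv \<phi> t \<noteq> 0) \<and> \<phi> ` T = T' \<and>
         (\<forall>t\<in>T. \<gamma> t = \<gamma>' (\<phi> t)))"

definition geodesically_equivalent ::
  "('m::{t2_space,second_countable_topology}, 'n::finite) chart set \<Rightarrow>
   ('m, 'n) tensor2 \<Rightarrow> ('m, 'n) tensor2 \<Rightarrow> bool" where
  "geodesically_equivalent A g gb \<longleftrightarrow>
     (\<forall>T \<gamma>. geodesic A g T \<gamma> \<longrightarrow> (\<exists>T' \<gamma>'. geodesic A gb T' \<gamma>' \<and> same_unparameterized T \<gamma> T' \<gamma>')) \<and>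
     (\<forall>T \<gamma>. geodesic A gb T \<gamma> \<longrightarrow> (\<exists>T' \<gamma>'. geodesic A g T' \<gamma>' \<and> same_unparameterized T \<gamma> T' \<gamma>'))"


section \<open>The cotangent bundle and its standard symplectic form\<close>

text \<open>
  A covector at \<open>m\<close> is the family of its components \<open>p c $ i\<close> in all charts \<open>c\<close> around \<open>m\<close>,
  related by the transformation law of covectors; the value \<open>0\<close> at the other charts only makes
  the representation unique.
\<close>

type_synonym ('m, 'n) covector = "('m, 'n) chart \<Rightarrow> real ^ 'n"

definition cotangent_space ::
  "('m, 'n::finite) chart set \<Rightarrow> 'm \<Rightarrow> ('m, 'n) covector set" where
  "cotangent_space A m =
     {p. (\<forall>c\<in>A. \<forall>d\<in>A. m \<in> chart_dom c \<inter> chart_dom d \<longrightarrow>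
            p c = p d v* jacobian (transition c d) (at (coord c m))) \<and>
         (\<forall>c. c \<notin> A \<or> m \<notin> chart_dom c \<longrightarrow> p c = 0)}"

definition cotangent_bundle ::
  "('m, 'n::finite) chart set \<Rightarrow> ('m \<times> ('m, 'n) covector) set" where
  "cotangent_bundle A = Sigma UNIV (cotangent_space A)"

text \<open>The canonical coordinates \<open>(x, p)\<close> on the cotangent bundle induced by a chart.\<close>

definition cotangent_coord ::
  "('m, 'n::finite) chart \<Rightarrow> 'm \<times> ('m, 'n) covector \<Rightarrow> (real ^ 'n) \<times> (real ^ 'n)" where
  "cotangent_coord c = (\<lambda>(m, p). (coord c m, p c))"

definition in_coords ::
  "('m, 'n::finite) chart set \<Rightarrow> ('m, 'n) chart \<Rightarrow> ('m \<times> ('m, 'n) covector \<Rightarrow> real) \<Rightarrow>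
   (real ^ 'n) \<times> (real ^ 'n) \<Rightarrow> real" where
  "in_coords A c F =
     F \<circ> inv_into {z \<in> cotangent_bundle A. fst z \<in> chart_dom c} (cotangent_coord c)"

text \<open>The standard symplectic form \<open>\<Sum>\<^sub>i dx\<^sub>i \<and> dp\<^sub>i\<close> in canonical coordinates.\<close>

definition symplectic_form ::
  "(real ^ 'n) \<times> (real ^ 'n) \<Rightarrow> (real ^ 'n::finite) \<times> (real ^ 'n) \<Rightarrow> real" where
  "symplectic_form X Y = fst X \<bullet> snd Y - snd X \<bullet> fst Y"

definition hamiltonian_field ::
  "((real ^ 'n) \<times> (real ^ 'n) \<Rightarrow> real) \<Rightarrow> (real ^ 'n) \<times> (real ^ 'n) \<Rightarrow>
   (real ^ 'n::finite) \<times> (real ^ 'n)" where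
  "hamiltonian_field F z = (THE X. \<forall>Y. symplectic_form X Y = frechet_derivative F (at z) Y)"

lemma hamiltonian_field_eq:
  fixes F :: "(real ^ 'n::finite) \<times> (real ^ 'n) \<Rightarrow> real"
  assumes "F differentiable (at z)"
  shows "hamiltonian_field F z =
    ((\<chi> i. frechet_derivative F (at z) (0, axis i 1)),
     (\<chi> i. - frechet_derivative F (at z) (axis i 1, 0)))"
proof -
  let ?D = "frechet_derivative F (at z)"
  let ?X = "((\<chi> i. ?D (0, axis i 1)), (\<chi> i. - ?D (axis i 1, 0)))"
  have lin: "linear ?D" using assms by (rule linear_frechet_derivative)
  have ev: "symplectic_form X (0, axis i 1) = fst X $ i"
           "symplectic_form X (axis i 1, 0) = - (snd X $ i)" for X :: "(real^'n) \<times> (real^'n)" and i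
    by (simp_all add: symplectic_form_def inner_axis)
  have l1: "linear (\<lambda>a. ?D (a, 0))" 
    using linear_compose[of "\<lambda>a. (a, 0)" ?D] lin
    by (simp add: o_def linear_iff)
  have l2: "linear (\<lambda>b. ?D (0, b))"
    using linear_compose[of "\<lambda>b. (0, b)" ?D] lin
    by (simp add: o_def linear_iff)
  have e1: "?D (a, 0) = (\<Sum>i\<in>UNIV. a $ i * ?D (axis i 1, 0))" for a
  proof -
    have "?D (a, 0) = ?D ((\<Sum>i\<in>UNIV. a $ i *\<^sub>R axis i 1), 0)"
      by (simp add: basis_expansion flip: scalar_mult_eq_scaleR)
    also have "\<dots> = (\<Sum>i\<in>UNIV. a $ i * ?D (axis i 1, 0))"
      using linear_sum[OF l1, of "\<lambda>i. a $ i *\<^sub>R axis i 1" UNIV] linear_cmul[OF l1] by simp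
    finally show ?thesis .
  qed
  have e2: "?D (0, b) = (\<Sum>i\<in>UNIV. b $ i * ?D (0, axis i 1))" for b
  proof -
    have "?D (0, b) = ?D (0, (\<Sum>i\<in>UNIV. b $ i *\<^sub>R axis i 1))"
      by (simp add: basis_expansion flip: scalar_mult_eq_scaleR)
    also have "\<dots> = (\<Sum>i\<in>UNIV. b $ i * ?D (0, axis i 1))"
      using linear_sum[OF l2, of "\<lambda>i. b $ i *\<^sub>R axis i 1" UNIV] linear_cmul[OF l2] by simp
    finally show ?thesis .
  qed
  have ex: "symplectic_form ?X Y = ?D Y" for Y
  proof -
    have "?D Y = ?D (fst Y, 0) + ?D (0, snd Y)"
      using linear_add[OF lin, of "(fst Y, 0)" "(0, snd Y)"] by simp
    then show ?thesis
      by (simp add: e1[of "fst Y"] e2[of "snd Y"] symplectic_form_def inner_vec_def sum_negf mult.commute)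
  qed
  have un: "X = ?X" if "\<forall>Y. symplectic_form X Y = ?D Y" for X
  proof (rule prod_eqI)
    show "fst X = fst ?X" using that ev(1)[of X] by (simp add: vec_eq_iff)
    show "snd X = snd ?X" using that ev(2)[of X]
      by (simp add: vec_eq_iff)
  qed
  show ?thesis unfolding hamiltonian_field_def
    by (rule the_equality) (use ex un in blast)+
qed

text \<open>The Poisson bracket at \<open>z\<close>, computed in the canonical coordinates induced by \<open>c\<close>.\<close>

definition poisson_bracket ::
  "('m, 'n::finite) chart set \<Rightarrow> ('m, 'n) chart \<Rightarrow> ('m \<times> ('m, 'n) covector \<Rightarrow> real) \<Rightarrow>
   ('m \<times> ('m, 'n) covector \<Rightarrow> real) \<Rightarrow> 'm \<times> ('m, 'n) covector \<Rightarrow> real" where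
  "poisson_bracket A c F K z =
     symplectic_form (hamiltonian_field (in_coords A c F) (cotangent_coord c z))
                     (hamiltonian_field (in_coords A c K) (cotangent_coord c z))"

text \<open>
  The bracket vanishes identically.  Differentiability is included so that the bracket is
  never that of a junk derivative.
\<close>

definition poisson_commute ::
  "('m, 'n::finite) chart set \<Rightarrow> ('m \<times> ('m, 'n) covector \<Rightarrow> real) \<Rightarrow>
   ('m \<times> ('m, 'n) covector \<Rightarrow> real) \<Rightarrow> bool" where
  "poisson_commute A F K \<longleftrightarrow>
     (\<forall>z\<in>cotangent_bundle A. \<forall>c\<in>A. fst z \<in> chart_dom c \<longrightarrow>
        in_coords A c F differentiable (at (cotangent_coord c z)) \<and>
        in_coords A c K differentiable (at (cotangent_coord c z)) \<and>
        poisson_bracket A c F K z = 0)"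

definition hamiltonian_trajectory ::
  "('m::{t2_space,second_countable_topology}, 'n::finite) chart set \<Rightarrow>
   ('m \<times> ('m, 'n) covector \<Rightarrow> real) \<Rightarrow> real set \<Rightarrow> (real \<Rightarrow> 'm \<times> ('m, 'n) covector) \<Rightarrow> bool" where
  "hamiltonian_trajectory A H T z \<longleftrightarrow>
     open_interval T \<and> z ` T \<subseteq> cotangent_bundle A \<and> continuous_on T (fst \<circ> z) \<and>
     (\<forall>c\<in>A. \<forall>t\<in>T. fst (z t) \<in> chart_dom c \<longrightarrow>
        ((\<lambda>s. cotangent_coord c (z s)) has_vector_derivative
           hamiltonian_field (in_coords A c H) (cotangent_coord c (z t))) (at t))"

definition integral_of_hamiltonian_flow ::
  "('m::{t2_space,second_countable_topology}, 'n::finite) chart set \<Rightarrow>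
   ('m \<times> ('m, 'n) covector \<Rightarrow> real) \<Rightarrow> ('m \<times> ('m, 'n) covector \<Rightarrow> real) \<Rightarrow> bool" where
  "integral_of_hamiltonian_flow A H F \<longleftrightarrow>
     (\<forall>T z. hamiltonian_trajectory A H T z \<longrightarrow> (\<forall>s\<in>T. \<forall>t\<in>T. F (z s) = F (z t)))"

text \<open>
  The Hamiltonian \<open>g(\<xi>,\<xi>)/2\<close> of the geodesic flow, with the covector \<open>p\<close> identified with
  \<open>\<xi> = g\<^sup>-\<^sup>1 p\<close>.  The value does not depend on the chart chosen by \<open>chart_at\<close>.
\<close>

definition geodesic_hamiltonian ::
  "('m, 'n::finite) chart set \<Rightarrow> ('m, 'n) tensor2 \<Rightarrow> 'm \<times> ('m, 'n) covector \<Rightarrow> real" where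
  "geodesic_hamiltonian A g = (\<lambda>(m, p).
     let c = chart_at A m; \<xi> = matrix_inv (g c m) *v p c
     in (1/2) * (\<xi> \<bullet> (g c m *v \<xi>)))"


section \<open>The functions \<open>I\<^sub>k\<close>\<close>

definition matrix_pow :: "real ^ 'n ^ 'n \<Rightarrow> nat \<Rightarrow> real ^ 'n::finite ^ 'n" where
  "matrix_pow M k = (((**) M) ^^ k) (mat 1)"

text \<open>
  \<open>char_coeff M i\<close> is the coefficient of \<open>\<mu>\<^sup>n\<^sup>-\<^sup>i\<close> in \<open>det (M - \<mu> E)\<close>; the determinant is taken over
  the polynomial ring, where \<open>\<mu>\<close> is \<open>[:0, 1:]\<close>.
\<close>

definition char_coeff :: "real ^ 'n ^ 'n::finite \<Rightarrow> nat \<Rightarrow> real" where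
  "char_coeff M i = coeff (det ((\<chi> r s. [:M $ r $ s:]) - mat [:0, 1:])) (CARD('n) - i)"

definition G_tensor ::
  "('m, 'n::finite) chart \<Rightarrow> ('m, 'n) tensor2 \<Rightarrow> ('m, 'n) tensor2 \<Rightarrow> 'm \<Rightarrow> real ^ 'n ^ 'n" where
  "G_tensor c g gb m = matrix_inv (g c m) ** gb c m"

text \<open>In a mixed tensor the upper index is the row index: \<open>S\<^sup>j\<^sub>\<alpha> = S $ j $ \<alpha>\<close>.\<close>

definition S_tensor ::
  "('m, 'n::finite) chart \<Rightarrow> ('m, 'n) tensor2 \<Rightarrow> ('m, 'n) tensor2 \<Rightarrow> nat \<Rightarrow> 'm \<Rightarrow> real ^ 'n ^ 'n" where
  "S_tensor c g gb k m =
     ((det (g c m) / det (gb c m)) powr (real (k + 2) / real (CARD('n) + 1))) *\<^sub>R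
     (\<Sum>i\<le>k. char_coeff (G_tensor c g gb m) i *\<^sub>R matrix_pow (G_tensor c g gb m) (k - i + 1))"

text \<open>Again the value does not depend on the chart chosen by \<open>chart_at\<close>.\<close>

definition I_fun ::
  "('m, 'n::finite) chart set \<Rightarrow> ('m, 'n) tensor2 \<Rightarrow> ('m, 'n) tensor2 \<Rightarrow> nat \<Rightarrow>
   'm \<times> ('m, 'n) covector \<Rightarrow> real" where
  "I_fun A g gb k = (\<lambda>(m, p).
     let c = chart_at A m
     in \<Sum>\<alpha>\<in>UNIV. \<Sum>i\<in>UNIV. \<Sum>j\<in>UNIV.
          matrix_inv (g c m) $ \<alpha> $ i * S_tensor c g gb k m $ j $ \<alpha> * p c $ i * p c $ j)"

end

theory Submission
  imports Defs
begin

text \<open>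
  At every point a nonzero vector is the velocity of a \<open>g\<close>-geodesic, which is a reparameterized geodesic of
  the second metric; hence the difference of the Christoffel symbols sends \<open>(v,v)\<close> to a multiple of
  \<open>v\<close> and equals \<open>\<phi>(w) v + \<phi>(v) w\<close>.  For \<open>L = (det gb / det g)\<^bsup>1/(n+1)\<^esup> gb\<^sup>-\<^sup>1 g\<close> this says that
  the covariant derivative of \<open>L\<close> along \<open>w\<close> is \<open>(\<kappa> w\<^sup>T + w \<kappa>\<^sup>T) g\<close> for some vector \<open>\<kappa>\<close>.  By the
  Cayley-Hamilton theorem \<open>\<Sum>\<^sub>k s\<^sup>n\<^sup>-\<^sup>1\<^sup>-\<^sup>k S\<^sub>k = - det (1 - s L) (1 - s L)\<^sup>-\<^sup>1\<close>, and the brackets of the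
  functions with different small \<open>s\<close> and \<open>t\<close> on the right vanish by the resolvent identity; comparing
  coefficients gives \<open>{I\<^sub>k, I\<^sub>l} = 0\<close>.  Finally \<open>S\<^sub>n\<^sub>-\<^sub>1 = -1\<close>, so the Hamiltonian is \<open>- I\<^sub>n\<^sub>-\<^sub>1 / 2\<close>.
\<close>

section \<open>Differential calculus of matrix products, inverses and determinants\<close>

section \<open>Matrix calculus\<close>

text \<open>The exponent 1/(n+1) comes from a trace: if the connections differ by
  \<open>\<phi>(w) v + \<phi>(v) w\<close>, this difference along w has trace (n+1) \<phi>(w), so
  log (det gb / det g) has derivative 2 (n+1) \<phi>(w). The covariant derivative of gb^-1 g
  contains -2 \<phi>(w) times gb^-1 g itself; the scalar factor of L removes exactly this term and
  leaves two of rank one. The weights (k+2)/(n+1) let the powers of the factor be absorbed into s.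
  The family in s avoids differentiating the coefficients c_i one by one, since determinant and
  resolvent have closed derivatives. A bracket sees only first derivatives at a point, so no special
  coordinates are chosen: the Christoffel terms are carried along and cancel by symmetry. The
  obstacle comes at the start: geodesic equivalence constrains the connections only once enough
  geodesics exist, and a geodesic has to satisfy the equation in every chart. Hence the existence
  theorem for the ODE and the transformation law of the Christoffel symbols.\<close>

lemma matrix_add_rdistrib':
  fixes A B :: "'a::semiring_1 ^ 'n ^ 'm" shows "(A + B) ** C = A ** C + B ** C"
  by (vector matrix_matrix_mult_def sum.distrib[symmetric] distrib_right)

lemma bounded_bilinear_matrix_mult:
  "bounded_bilinear ((**) :: real ^ 'n ^ 'm \<Rightarrow> real ^ 'p ^ 'n \<Rightarrow> real ^ 'p ^ 'm)"
  unfolding bilinear_conv_bounded_bilinear[symmetric] bilinear_def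
  by (simp add: linear_iff matrix_add_ldistrib matrix_add_rdistrib')
   (simp add: matrix_matrix_mult_def vec_eq_iff sum_distrib_left mult.assoc mult.left_commute)

lemma bounded_bilinear_matrix_vector_mult:
  "bounded_bilinear ((*v) :: real ^ 'n ^ 'm \<Rightarrow> real ^ 'n \<Rightarrow> real ^ 'm)"
  unfolding bilinear_conv_bounded_bilinear[symmetric] bilinear_def
  by (auto simp: linear_iff matrix_vector_mult_def vec_eq_iff algebra_simps sum.distrib
      sum_distrib_left)

lemma bounded_linear_transpose: "bounded_linear (transpose :: real ^ 'n ^ 'm \<Rightarrow> _)"
  unfolding linear_conv_bounded_linear[symmetric]
  by (auto simp: linear_iff transpose_def vec_eq_iff)

lemma bounded_linear_trace: "bounded_linear (trace :: real ^ 'n ^ 'n \<Rightarrow> real)"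
  unfolding linear_conv_bounded_linear[symmetric]
  by (auto simp: linear_iff trace_def sum.distrib sum_distrib_left)

lemmas matrix_mult_zero =
  bounded_bilinear.zero_left[OF bounded_bilinear_matrix_mult]
  bounded_bilinear.zero_right[OF bounded_bilinear_matrix_mult]

lemma matrix_mult_minus:
  fixes A :: "real ^ 'n ^ 'm"
  shows "(- A) ** B = - (A ** B)" and "A ** (- B) = - (A ** B)"
  by (simp_all add: matrix_matrix_mult_def vec_eq_iff sum_negf)

lemmas matrix_mult_FDERIV = bounded_bilinear.FDERIV[OF bounded_bilinear_matrix_mult]
lemmas matrix_vector_FDERIV = bounded_bilinear.FDERIV[OF bounded_bilinear_matrix_vector_mult]

lemma matrix_inv_right: "invertible A \<Longrightarrow> A ** matrix_inv A = mat 1"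
  and matrix_inv_left: "invertible A \<Longrightarrow> matrix_inv A ** A = mat 1"
  for A :: "real ^ 'n ^ 'n"
  unfolding invertible_def matrix_inv_def by (metis (mono_tags, lifting) someI_ex)+

lemma matrix_inv_eqI: "A ** B = mat 1 \<Longrightarrow> matrix_inv A = B"
  for A :: "real ^ 'n ^ 'n"
  by (metis invertible_def matrix_inv_left matrix_left_right_inverse matrix_mul_assoc
      matrix_mul_lid matrix_mul_rid)

lemma invertible_matrix_inv: "invertible A \<Longrightarrow> invertible (matrix_inv A)"
  for A :: "real ^ 'n ^ 'n"
  using invertible_def matrix_inv_left matrix_inv_right by blast

lemma matrix_inv_mult:
  "invertible A \<Longrightarrow> invertible B \<Longrightarrow> matrix_inv (A ** B) = matrix_inv B ** matrix_inv A"
  for A B :: "real ^ 'n ^ 'n"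
  by (rule matrix_inv_eqI) (metis matrix_inv_right matrix_mul_assoc matrix_mul_rid)

lemma matrix_inv_transpose:
  "invertible A \<Longrightarrow> matrix_inv (transpose A) = transpose (matrix_inv A)"
  for A :: "real ^ 'n ^ 'n"
  by (rule matrix_inv_eqI) (metis matrix_inv_left matrix_transpose_mul transpose_mat)

lemma has_derivative_det_general:
  fixes A :: "real ^ 'n ^ 'n"
  shows "(det has_derivative (\<lambda>H. \<Sum>p | p permutes UNIV. of_int (sign p) *
     (\<Sum>i\<in>UNIV. H $ i $ p i * (\<Prod>j\<in>UNIV - {i}. A $ j $ p j)))) (at A)"
  unfolding det_def[abs_def]
proof (intro has_derivative_sum has_derivative_mult_right)
  fix p :: "'n \<Rightarrow> 'n"
  show "((\<lambda>x. \<Prod>i\<in>UNIV. x $ i $ p i) has_derivative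
        (\<lambda>H. \<Sum>i\<in>UNIV. H $ i $ p i * (\<Prod>j\<in>UNIV - {i}. A $ j $ p j))) (at A)"
    by (rule has_derivative_prod) (intro bounded_linear_imp_has_derivative
        bounded_linear_compose[OF bounded_linear_vec_nth bounded_linear_vec_nth])
qed

text \<open>Only the identity permutation survives: any other permutation moves at least two
  indices, so after one factor is removed an off-diagonal zero of the identity matrix
  remains.\<close>

lemma has_derivative_det_mat_1: "(det has_derivative trace) (at (mat 1 :: real ^ 'n ^ 'n))"
proof -
  have "(\<Sum>p | p permutes UNIV. of_int (sign p) *
     (\<Sum>i\<in>UNIV. H $ i $ p i * (\<Prod>j\<in>UNIV - {i}. (mat 1 :: real ^ 'n ^ 'n) $ j $ p j))) = trace H"
    (is "?lhs = _") for H :: "real ^ 'n ^ 'n"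
  proof -
    have z: "(\<Sum>i\<in>UNIV. H $ i $ p i * (\<Prod>j\<in>UNIV - {i}. (mat 1 :: real ^ 'n ^ 'n) $ j $ p j)) = 0"
      if p: "p permutes UNIV" "p \<noteq> id" for p
    proof (rule sum.neutral, rule ballI)
      fix i
      have "\<exists>j. j \<noteq> i \<and> p j \<noteq> j"
      proof (rule ccontr)
        assume "\<not> ?thesis"
        then have "\<And>j. j \<noteq> i \<Longrightarrow> p j = j" by auto
        moreover from this have "p i = i"
          by (metis p(1) permutes_inj injD)
        ultimately show False using p(2) by (metis eq_id_iff)
      qed
      then obtain j where "j \<noteq> i" "p j \<noteq> j" by blast
      then have "(\<Prod>j\<in>UNIV - {i}. (mat 1 :: real ^ 'n ^ 'n) $ j $ p j) = 0"
        by (intro prod_zero) (auto simp: mat_def intro!: bexI[of _ j])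
      then show "H $ i $ p i * (\<Prod>j\<in>UNIV - {i}. (mat 1 :: real ^ 'n ^ 'n) $ j $ p j) = 0" by simp
    qed
    have "?lhs = (\<Sum>p\<in>{id}. of_int (sign p) *
       (\<Sum>i\<in>UNIV. H $ i $ p i * (\<Prod>j\<in>UNIV - {i}. (mat 1 :: real ^ 'n ^ 'n) $ j $ p j)))"
      by (rule sum.mono_neutral_right) (auto simp: z finite_permutations permutes_id)
    also have "\<dots> = trace H" by (simp add: mat_def trace_def sign_id)
    finally show ?thesis .
  qed
  then show ?thesis using has_derivative_det_general[of "mat 1 :: real ^ 'n ^ 'n"] by simp
qed

text \<open>Jacobi's formula. The factorization
  \<open>det (M y) = det (M x) * det (matrix_inv (M x) ** M y)\<close> moves the base point to the
  identity matrix, where the derivative of the determinant is the trace.\<close>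

lemma has_derivative_det:
  fixes M :: "'a::real_normed_vector \<Rightarrow> real ^ 'n ^ 'n"
  assumes M: "(M has_derivative M') (at x)" and inv: "invertible (M x)"
  shows "((\<lambda>x. det (M x)) has_derivative (\<lambda>h. det (M x) * trace (matrix_inv (M x) ** M' h))) (at x)"
proof -
  have e: "det (M y) = det (M x) * det (matrix_inv (M x) ** M y)" for y
    using inv by (simp add: matrix_mul_assoc matrix_inv_right flip: det_mul)
  have "((\<lambda>y. matrix_inv (M x) ** M y) has_derivative (\<lambda>h. matrix_inv (M x) ** M' h)) (at x)"
    by (rule bounded_linear.has_derivative[OF
          bounded_bilinear.bounded_linear_right[OF bounded_bilinear_matrix_mult] M])
  moreover have "(det has_derivative trace) (at (matrix_inv (M x) ** M x))"
    using has_derivative_det_mat_1 inv by (simp add: matrix_inv_left)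
  ultimately have "((\<lambda>y. det (matrix_inv (M x) ** M y)) has_derivative
      (\<lambda>h. trace (matrix_inv (M x) ** M' h))) (at x)"
    by (rule has_derivative_compose)
  then have "((\<lambda>y. det (M x) * det (matrix_inv (M x) ** M y)) has_derivative
      (\<lambda>h. det (M x) * trace (matrix_inv (M x) ** M' h))) (at x)"
    by (rule has_derivative_mult_right)
  then show ?thesis by (simp flip: e)
qed

lemma matrix_differentiable_componentwise:
  fixes M :: "'a::euclidean_space \<Rightarrow> real ^ 'n ^ 'm"
  shows "M differentiable (at x) \<longleftrightarrow> (\<forall>i j. (\<lambda>x. M x $ i $ j) differentiable (at x))"
    (is "?l = ?r")
proof
  assume ?l
  then obtain M' where M: "(M has_derivative M') (at x)" by (auto simp: differentiable_def)
  show ?r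
    using bounded_linear.has_derivative[OF bounded_linear_compose[OF bounded_linear_vec_nth bounded_linear_vec_nth] M]
    by (auto simp: differentiable_def)
next
  assume ?r
  then obtain f where f: "\<And>i j. ((\<lambda>x. M x $ i $ j) has_derivative f i j) (at x)"
    unfolding differentiable_def by metis
  have "((\<lambda>x. M x \<bullet> b) has_derivative (\<lambda>h. (\<chi> i j. f i j h) \<bullet> b)) (at x)" if b: "b \<in> Basis" for b
  proof -
    obtain i and j :: 'n where "b = axis i (axis j 1)" using b by (auto simp: Basis_vec_def)
    then show ?thesis using f[of i j] by (simp add: inner_axis)
  qed
  then have "(M has_derivative (\<lambda>h. \<chi> i j. f i j h)) (at x)"
    using has_derivative_componentwise_within[of M _ x UNIV] by blast
  then show ?l by (auto simp: differentiable_def)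
qed

lemma det_differentiable:
  fixes M :: "'a::euclidean_space \<Rightarrow> real ^ 'n ^ 'n"
  assumes "M differentiable (at x)"
  shows "(\<lambda>x. det (M x)) differentiable (at x)"
  using assms unfolding differentiable_def
  by (elim exE) (rule exI, erule has_derivative_compose[OF _ has_derivative_det_general])

lemma continuous_at_det: "isCont det (A :: real ^ 'n ^ 'n)"
  using has_derivative_continuous[OF has_derivative_det_general] .

lemma matrix_inv_cramer:
  fixes A :: "real ^ 'n ^ 'n"
  assumes "det A \<noteq> 0"
  shows "matrix_inv A $ k $ l = det (\<chi> i j. if j = k then axis l 1 $ i else A $ i $ j) / det A"
proof -
  have "A *v (matrix_inv A *v axis l 1) = axis l 1"
    using assms by (simp add: matrix_vector_mul_assoc matrix_inv_right invertible_det_nz)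
  then have "matrix_inv A *v axis l 1 =
      (\<chi> k. det (\<chi> i j. if j = k then axis l 1 $ i else A $ i $ j) / det A)"
    using cramer[OF assms] by blast
  then have "(matrix_inv A *v axis l 1) $ k = det (\<chi> i j. if j = k then axis l 1 $ i else A $ i $ j) / det A"
    by simp
  then show ?thesis by (simp add: matrix_vector_mul_component inner_axis)
qed

text \<open>By Cramer's rule the entries of the inverse are quotients of determinants, at all points
  near x because the determinant stays nonzero there.\<close>

lemma matrix_inv_differentiable:
  fixes M :: "'a::euclidean_space \<Rightarrow> real ^ 'n ^ 'n"
  assumes M: "M differentiable (at x)" and inv: "invertible (M x)"
  shows "(\<lambda>x. matrix_inv (M x)) differentiable (at x)"
    and "\<forall>\<^sub>F y in at x. invertible (M y)"
proof -
  have nz: "det (M x) \<noteq> 0" using inv invertible_det_nz by blast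
  have d: "(\<lambda>x. det (M x)) differentiable (at x)" using M by (rule det_differentiable)
  then have "isCont (\<lambda>x. det (M x)) x" by (rule differentiable_imp_continuous_within)
  then have ev: "\<forall>\<^sub>F y in at x. det (M y) \<noteq> 0"
    using nz by (simp add: continuous_within tendsto_imp_eventually_ne)
  then show "\<forall>\<^sub>F y in at x. invertible (M y)" by (simp add: invertible_det_nz)
  show "(\<lambda>x. matrix_inv (M x)) differentiable (at x)"
    unfolding matrix_differentiable_componentwise
  proof (intro allI)
    fix k l
    let ?N = "\<lambda>y. (\<chi> i j. if j = k then axis l 1 $ i else M y $ i $ j) :: real ^ 'n ^ 'n"
    have "?N differentiable (at x)"
      unfolding matrix_differentiable_componentwise
    proof (intro allI)
      fix i j
      show "(\<lambda>y. ?N y $ i $ j) differentiable (at x)"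
        using M unfolding matrix_differentiable_componentwise by (cases "j = k") simp_all
    qed
    then have "(\<lambda>y. det (?N y) / det (M y)) differentiable (at x)"
      using d nz by (rule differentiable_divide[OF det_differentiable])
    moreover have "\<forall>\<^sub>F y in at x. det (?N y) / det (M y) = matrix_inv (M y) $ k $ l"
      using ev by eventually_elim (simp add: matrix_inv_cramer)
    moreover have "det (?N x) / det (M x) = matrix_inv (M x) $ k $ l"
      using nz by (simp add: matrix_inv_cramer)
    ultimately show "(\<lambda>y. matrix_inv (M y) $ k $ l) differentiable (at x)"
      unfolding differentiable_def
      by (elim exE) (rule exI, erule (1) has_derivative_transform_eventually, simp_all)
  qed
qed

text \<open>Cramer's rule already gives the existence of the derivative, so its value follows by
  differentiating \<open>matrix_inv (M y) ** M y = mat 1\<close>, which holds near x.\<close>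

lemma has_derivative_matrix_inv:
  fixes M :: "'a::euclidean_space \<Rightarrow> real ^ 'n ^ 'n"
  assumes M: "(M has_derivative M') (at x)" and inv: "invertible (M x)"
  shows "((\<lambda>x. matrix_inv (M x)) has_derivative
     (\<lambda>h. - (matrix_inv (M x) ** M' h ** matrix_inv (M x)))) (at x)"
proof -
  have diff: "M differentiable (at x)" using M by (auto simp: differentiable_def)
  obtain N' where N: "((\<lambda>x. matrix_inv (M x)) has_derivative N') (at x)"
    using matrix_inv_differentiable(1)[OF diff inv] by (auto simp: differentiable_def)
  have "((\<lambda>y. matrix_inv (M y) ** M y) has_derivative
      (\<lambda>h. matrix_inv (M x) ** M' h + N' h ** M x)) (at x)"
    by (rule matrix_mult_FDERIV[OF N M])
  moreover have "((\<lambda>y. matrix_inv (M y) ** M y) has_derivative (\<lambda>h. 0)) (at x)"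
    by (rule has_derivative_transform_eventually[OF has_derivative_const[of "mat 1"]])
      (use matrix_inv_differentiable(2)[OF diff inv] inv in
        \<open>auto elim!: eventually_mono simp: matrix_inv_left\<close>)
  ultimately have "(\<lambda>h. matrix_inv (M x) ** M' h + N' h ** M x) = (\<lambda>h. 0)"
    by (rule has_derivative_unique)
  then have "N' h ** M x = - (matrix_inv (M x) ** M' h)" for h
    by (metis (no_types, lifting) add_eq_0_iff)
  then have "N' h ** M x ** matrix_inv (M x) = - (matrix_inv (M x) ** M' h) ** matrix_inv (M x)" for h
    by simp
  then have "N' h = - (matrix_inv (M x) ** M' h ** matrix_inv (M x))" for h
    using inv by (simp add: matrix_mul_assoc[symmetric] matrix_inv_right matrix_mult_minus)
  then show ?thesis using N by presburger
qed

section \<open>Characteristic polynomial, Cayley-Hamilton theorem and adjugate\<close>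

section \<open>Characteristic polynomials\<close>

abbreviation poly_char_matrix :: "real ^ 'n ^ 'n \<Rightarrow> real poly ^ 'n ^ 'n" where
  "poly_char_matrix M \<equiv> (\<chi> r s. [:M $ r $ s:]) - mat [:0, 1:]"

definition det_char_poly :: "real ^ 'n ^ 'n \<Rightarrow> real poly" where
  "det_char_poly M = det (poly_char_matrix M)"

lemma char_coeff_eq: "char_coeff (M :: real ^ 'n ^ 'n) i = coeff (det_char_poly M) (CARD('n) - i)"
  by (simp add: char_coeff_def det_char_poly_def)

lemma poly_det: "poly (det N) \<mu> = det (\<chi> i j. poly (N $ i $ j) \<mu>)"
  for N :: "real poly ^ 'n ^ 'n"
  by (simp add: det_def poly_sum poly_prod of_int_poly)

lemma poly_det_char_poly: "poly (det_char_poly M) \<mu> = det (M - mat \<mu>)"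
  unfolding det_char_poly_def poly_det
  by (rule arg_cong[where f = det]) (simp add: vec_eq_iff mat_def)

lemma degree_det_char_poly: "degree (det_char_poly (M :: real ^ 'n ^ 'n)) \<le> CARD('n)"
  unfolding det_char_poly_def det_def
proof (rule degree_sum_le)
  fix p :: "'n \<Rightarrow> 'n"
  have "degree (\<Prod>i\<in>UNIV. poly_char_matrix M $ i $ p i) \<le>
      sum (degree \<circ> (\<lambda>i. poly_char_matrix M $ i $ p i)) UNIV"
    by (rule degree_prod_sum_le) simp
  also have "\<dots> \<le> (\<Sum>i\<in>(UNIV :: 'n set). 1)"
    by (rule sum_mono) (simp add: mat_def degree_diff_le)
  finally show "degree (of_int (sign p) * (\<Prod>i\<in>UNIV. poly_char_matrix M $ i $ p i)) \<le> CARD('n)"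
    by (intro order_trans[OF degree_mult_le]) simp
qed (simp add: finite_permutations)

lemma det_eq_char_coeff_sum:
  "det (M - mat \<mu>) = (\<Sum>i\<le>CARD('n). char_coeff M i * \<mu> ^ (CARD('n) - i))"
  for M :: "real ^ 'n ^ 'n"
proof -
  have "det (M - mat \<mu>) = (\<Sum>i\<le>CARD('n). coeff (det_char_poly M) i * \<mu> ^ i)"
    unfolding poly_det_char_poly[symmetric] poly_altdef using degree_det_char_poly[of M]
    by (intro sum.mono_neutral_left) (auto simp: coeff_eq_0)
  also have "\<dots> = (\<Sum>i\<le>CARD('n). char_coeff M i * \<mu> ^ (CARD('n) - i))"
    unfolding char_coeff_eq
    by (rule sum.reindex_bij_witness[of _ "\<lambda>i. CARD('n) - i" "\<lambda>i. CARD('n) - i"]) auto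
  finally show ?thesis .
qed

text \<open>Used for chart independence: a change of chart conjugates G by the Jacobian. The
  coefficients are compared through values, which determine a real polynomial.\<close>

lemma char_coeff_similar:
  fixes M J :: "real ^ 'n ^ 'n"
  assumes J: "invertible J"
  shows "char_coeff (matrix_inv J ** M ** J) i = char_coeff M i"
proof -
  have "det (matrix_inv J ** M ** J - mat \<mu>) = det (M - mat \<mu>)" for \<mu>
  proof -
    have "matrix_inv J ** M ** J - mat \<mu> = matrix_inv J ** (M - mat \<mu>) ** J"
    proof -
      have m: "mat \<mu> = \<mu> *\<^sub>R (mat 1 :: real ^ 'n ^ 'n)" by (simp add: vec_eq_iff mat_def)
      show ?thesis unfolding m
        by (simp add: bounded_bilinear.diff_left[OF bounded_bilinear_matrix_mult]
            bounded_bilinear.diff_right[OF bounded_bilinear_matrix_mult]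
            bounded_bilinear.scaleR_left[OF bounded_bilinear_matrix_mult]
            bounded_bilinear.scaleR_right[OF bounded_bilinear_matrix_mult] matrix_inv_left J)
    qed
    then have "det (matrix_inv J ** M ** J - mat \<mu>) = det (M - mat \<mu>) * det (matrix_inv J ** J)"
      by (simp add: det_mul)
    then show ?thesis by (simp add: matrix_inv_left J)
  qed
  then have "det_char_poly (matrix_inv J ** M ** J) = det_char_poly M"
    by (simp add: poly_eq_poly_eq_iff[symmetric] fun_eq_iff poly_det_char_poly)
  then show ?thesis by (simp add: char_coeff_eq)
qed

text \<open>A number above a bound K for the operator norm is not an eigenvalue, so the value at
  \<open>K + 1\<close> is nonzero. This allows the characteristic polynomial to be cancelled from a
  product.\<close>

lemma det_char_poly_nonzero: "det_char_poly (M :: real ^ 'n ^ 'n) \<noteq> 0"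
proof
  assume z: "det_char_poly M = 0"
  obtain K where K: "K > 0" "\<And>v. norm (M *v v) \<le> norm v * K"
    using bounded_linear.pos_bounded[OF matrix_vector_mul_bounded_linear[of M]] by blast
  have "v = 0" if "(M - mat (K + 1)) *v v = 0" for v
  proof -
    have "mat (K + 1) *v v = (K + 1) *\<^sub>R v"
      by (simp add: vec_eq_iff mat_def matrix_vector_mult_def if_distrib [where f="\<lambda>x. x * _"] cong: if_cong)
    then have "norm (M *v v) = (K + 1) * norm v"
      using that K(1) by (simp add: matrix_vector_mult_diff_rdistrib)
    then show "v = 0" using K(2)[of v] by (simp add: algebra_simps)
  qed
  then have "invertible (M - mat (K + 1))"
    by (metis matrix_left_invertible_ker invertible_left_inverse)
  then show False using z poly_det_char_poly[of M "K + 1"] by (simp add: invertible_det_nz)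
qed

lemma matrix_pow_simps:
  "matrix_pow M 0 = mat 1" "matrix_pow M (Suc k) = M ** matrix_pow M k"
  by (simp_all add: matrix_pow_def)

lemma matrix_pow_commute: "matrix_pow M k ** M = M ** matrix_pow M k"
  by (induction k) (simp_all add: matrix_pow_simps flip: matrix_mul_assoc)

text \<open>Comparing coefficients in \<open>(M - \<mu>) adj (M - \<mu>) = det (M - \<mu>)\<close> makes the sum telescope.\<close>

theorem cayley_hamilton:
  fixes M :: "real ^ 'n ^ 'n"
  shows "(\<Sum>i\<le>CARD('n). char_coeff M i *\<^sub>R matrix_pow M (CARD('n) - i)) = 0"
proof -
  \<comment> \<open>The adjugate of the polynomial matrix, by Cramer's determinants: column k is
    replaced by the unit vector l.\<close>
  define q where "q k l = det ((\<chi> i j. if j = k then (if i = l then 1 else 0)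
     else poly_char_matrix M $ i $ j) :: real poly ^ 'n ^ 'n)" for k l
  define d where "d = det_char_poly M"
  have adj: "(\<Sum>j\<in>UNIV. poly_char_matrix M $ i $ j * q j l) = (if i = l then d else 0)" for i l
  proof -
    \<comment> \<open>The factor d makes the identity trivial at the roots of d; at every other
      \<mu> the real matrix \<open>M - mat \<mu>\<close> is invertible and Cramer's rule
      applies.\<close>
    have "poly (d * ((\<Sum>j\<in>UNIV. poly_char_matrix M $ i $ j * q j l) - (if i = l then d else 0))) \<mu> = 0" for \<mu>
    proof (cases "poly d \<mu> = 0")
      case False
      define N where "N = M - mat \<mu>"
      have N: "poly d \<mu> = det N" by (simp add: d_def N_def poly_det_char_poly)
      have Nij: "poly (poly_char_matrix M $ i $ j) \<mu> = N $ i $ j" for i j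
        by (simp add: N_def mat_def)
      have nz: "det N \<noteq> 0" using False N by simp
      have "poly (q j l) \<mu> = det N * matrix_inv N $ j $ l" for j
      proof -
        have "poly (q j l) \<mu> = det (\<chi> i' j'. if j' = j then axis l 1 $ i' else N $ i' $ j')"
          unfolding q_def poly_det
          by (rule arg_cong[where f = det]) (simp add: vec_eq_iff axis_def Nij del: vector_minus_component)
        then show ?thesis using nz by (simp add: matrix_inv_cramer)
      qed
      then have "poly (\<Sum>j\<in>UNIV. poly_char_matrix M $ i $ j * q j l) \<mu> = 
          det N * (N ** matrix_inv N) $ i $ l"
        by (simp add: poly_sum Nij matrix_matrix_mult_def sum_distrib_left mult.left_commute del: vector_minus_component)
      also have "\<dots> = (if i = l then det N else 0)"
        using nz by (simp add: matrix_inv_right invertible_det_nz mat_def)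
      finally show ?thesis by (simp add: N)
    qed simp
    then have "d * ((\<Sum>j\<in>UNIV. poly_char_matrix M $ i $ j * q j l) - (if i = l then d else 0)) = 0"
      unfolding poly_eq_poly_eq_iff[symmetric] by (intro ext) simp
    then show ?thesis using det_char_poly_nonzero[of M] by (simp add: d_def)
  qed
  define Q where "Q k = (\<chi> i l. coeff (q i l) k)" for k
  have pcm: "poly_char_matrix M $ i $ j * p = smult (M $ i $ j) p - (if i = j then pCons 0 p else 0)" for i j p
    by (simp add: mat_def left_diff_distrib)
  have adj': "(\<Sum>j\<in>UNIV. smult (M $ i $ j) (q j l)) - pCons 0 (q i l) = (if i = l then d else 0)" for i l
    using adj[of i l] unfolding pcm by (simp add: sum_subtractf)
  have tel: "(\<Sum>k\<le>N. coeff d k *\<^sub>R matrix_pow M k) = matrix_pow M (Suc N) ** Q N" for N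
  proof (induction N)
    case 0
    have "M ** Q 0 = coeff d 0 *\<^sub>R mat 1"
      using arg_cong[OF adj', of "\<lambda>p. coeff p 0"]
      by (simp add: vec_eq_iff matrix_matrix_mult_def Q_def coeff_sum mat_def)
    then show ?case by (simp add: matrix_pow_simps)
  next
    case (Suc N)
    have "M ** Q (Suc N) - Q N = coeff d (Suc N) *\<^sub>R mat 1"
      using arg_cong[OF adj', of "\<lambda>p. coeff p (Suc N)"]
      by (simp add: vec_eq_iff matrix_matrix_mult_def Q_def coeff_sum mat_def)
    then have e: "M ** Q (Suc N) = Q N + coeff d (Suc N) *\<^sub>R mat 1" by (simp add: algebra_simps)
    have "matrix_pow M (Suc (Suc N)) ** Q (Suc N) = matrix_pow M (Suc N) ** (M ** Q (Suc N))"
      by (metis matrix_pow_simps(2) matrix_pow_commute matrix_mul_assoc)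
    also have "\<dots> = matrix_pow M (Suc N) ** Q N + coeff d (Suc N) *\<^sub>R matrix_pow M (Suc N)"
      unfolding e by (simp add: matrix_add_ldistrib bounded_bilinear.scaleR_right[OF bounded_bilinear_matrix_mult])
    finally show ?case using Suc.IH by simp
  qed
  \<comment> \<open>Beyond the degrees of all entries of q the coefficient matrix \<open>Q N\<close>
    is zero, so the telescoped sum vanishes; extending the sum from n to N only adds zero
    coefficients of d.\<close>
  obtain N where N: "N \<ge> CARD('n)" "Q N = 0"
  proof -
    define N where "N = Suc (CARD('n) + (\<Sum>i\<in>UNIV. \<Sum>l\<in>UNIV. degree (q i l)))"
    have "degree (q i l) < N" for i l
    proof -
      have "degree (q i l) \<le> (\<Sum>l\<in>UNIV. degree (q i l))" by (rule member_le_sum) auto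
      also have "\<dots> \<le> (\<Sum>i\<in>UNIV. \<Sum>l\<in>UNIV. degree (q i l))"
        by (rule member_le_sum[of i UNIV "\<lambda>i. \<Sum>l\<in>UNIV. degree (q i l)"]) auto
      finally show ?thesis by (simp add: N_def)
    qed
    then have "Q N = 0" by (simp add: Q_def vec_eq_iff coeff_eq_0)
    then show thesis using that[of N] by (simp add: N_def)
  qed
  have "(\<Sum>k\<le>CARD('n). coeff d k *\<^sub>R matrix_pow M k) = (\<Sum>k\<le>N. coeff d k *\<^sub>R matrix_pow M k)"
    using N(1) degree_det_char_poly[of M]
    by (intro sum.mono_neutral_left) (auto simp: d_def coeff_eq_0)
  also have "\<dots> = 0" using tel[of N] N(2) by (simp add: matrix_mult_zero)
  finally have "(\<Sum>k\<le>CARD('n). coeff d k *\<^sub>R matrix_pow M k) = 0" .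
  moreover have "(\<Sum>k\<le>CARD('n). coeff d k *\<^sub>R matrix_pow M k) =
     (\<Sum>i\<le>CARD('n). char_coeff M i *\<^sub>R matrix_pow M (CARD('n) - i))"
    unfolding char_coeff_eq d_def
    by (rule sum.reindex_bij_witness[of _ "\<lambda>i. CARD('n) - i" "\<lambda>i. CARD('n) - i"]) auto
  ultimately show ?thesis by simp
qed

text \<open>The Horner partial sums of the characteristic polynomial evaluated at M. Up to sign they
  are the coefficient matrices of the adjugate of \<open>M - mat \<mu>\<close>.\<close>

definition char_partial :: "real ^ 'n ^ 'n \<Rightarrow> nat \<Rightarrow> real ^ 'n ^ 'n" where
  "char_partial M k = (\<Sum>i\<le>k. char_coeff M i *\<^sub>R matrix_pow M (k - i))"

lemma char_partial_Suc: "char_partial M (Suc k) = M ** char_partial M k + char_coeff M (Suc k) *\<^sub>R mat 1"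
  by (simp add: char_partial_def bounded_bilinear.sum_right[OF bounded_bilinear_matrix_mult]
      bounded_bilinear.scaleR_right[OF bounded_bilinear_matrix_mult] Suc_diff_le matrix_pow_simps)

text \<open>Summing only up to an arbitrary N leaves the remainder \<open>char_partial M N\<close>,
  which makes an induction along the Horner recursion possible; at N = n the remainder vanishes by
  Cayley-Hamilton.\<close>

lemma char_partial_sum:
  fixes M :: "real ^ 'n ^ 'n"
  shows "(M - mat \<mu>) ** (\<Sum>k<CARD('n). \<mu> ^ (CARD('n) - 1 - k) *\<^sub>R char_partial M k) =
    - det (M - mat \<mu>) *\<^sub>R mat 1"
proof -
  have m: "mat \<mu> ** A = \<mu> *\<^sub>R A" for A :: "real ^ 'n ^ 'n"
  proof -
    have "mat \<mu> = \<mu> *\<^sub>R (mat 1 :: real ^ 'n ^ 'n)" by (simp add: vec_eq_iff mat_def)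
    then show ?thesis by (simp add: bounded_bilinear.scaleR_left[OF bounded_bilinear_matrix_mult])
  qed
  have "(M - mat \<mu>) ** (\<Sum>k<N. \<mu> ^ (N - 1 - k) *\<^sub>R char_partial M k) =
    char_partial M N - (\<Sum>j\<le>N. (char_coeff M j * \<mu> ^ (N - j)) *\<^sub>R mat 1)" for N
  proof (induction N)
    case 0
    show ?case by (simp add: matrix_mult_zero char_partial_def matrix_pow_simps)
  next
    case (Suc N)
    have a: "(\<Sum>k<Suc N. \<mu> ^ (Suc N - 1 - k) *\<^sub>R char_partial M k) = 
        \<mu> *\<^sub>R (\<Sum>k<N. \<mu> ^ (N - 1 - k) *\<^sub>R char_partial M k) + char_partial M N"
    proof -
      have "\<mu> ^ (N - k) = \<mu> * \<mu> ^ (N - Suc k)" if "k < N" for k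
        using that by (metis Suc_diff_Suc power_Suc)
      then show ?thesis by (simp add: scaleR_sum_right)
    qed
    have b: "(\<Sum>j\<le>Suc N. (char_coeff M j * \<mu> ^ (Suc N - j)) *\<^sub>R (mat 1 :: real ^ 'n ^ 'n)) =
        \<mu> *\<^sub>R (\<Sum>j\<le>N. (char_coeff M j * \<mu> ^ (N - j)) *\<^sub>R mat 1) + char_coeff M (Suc N) *\<^sub>R mat 1"
      by (simp add: scaleR_sum_right Suc_diff_le mult.left_commute)
    show ?case
      unfolding a b matrix_add_ldistrib bounded_bilinear.scaleR_right[OF bounded_bilinear_matrix_mult] Suc.IH
        char_partial_Suc
      by (simp add: bounded_bilinear.diff_left[OF bounded_bilinear_matrix_mult] m algebra_simps)
  qed
  from this[of "CARD('n)"] show ?thesis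
    using cayley_hamilton[of M]
    by (simp add: char_partial_def det_eq_char_coeff_sum flip: scaleR_sum_left)
qed

text \<open>Differentiability of every coefficient (\<open>DP\<close>) is preserved by the sums and
  products in the Leibniz formula, so it passes from the entries of the polynomial matrix to its
  determinant.\<close>

lemma char_coeff_differentiable:
  fixes M :: "'a::euclidean_space \<Rightarrow> real ^ 'n ^ 'n"
  assumes "M differentiable (at x)"
  shows "(\<lambda>x. char_coeff (M x) i) differentiable (at x)"
proof -
  define DP where "DP f \<longleftrightarrow> (\<forall>i. (\<lambda>x. coeff (f x) i) differentiable (at x))" for f :: "'a \<Rightarrow> real poly"
  have DP_const: "DP (\<lambda>_. p)" for p by (simp add: DP_def)
  have DP_mult: "DP (\<lambda>x. f x * h x)" if "DP f" "DP h" for f h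
    using that unfolding DP_def coeff_mult by (auto intro!: differentiable_sum differentiable_mult)
  have DP_sum: "DP (\<lambda>x. \<Sum>p\<in>S. f p x)" if "\<And>p. DP (f p)" "finite S" for f :: "('n \<Rightarrow> 'n) \<Rightarrow> 'a \<Rightarrow> real poly" and S
    using that unfolding DP_def coeff_sum by (auto intro!: differentiable_sum)
  have DP_prod: "DP (\<lambda>x. \<Prod>i\<in>S. f i x)" if "\<And>i. DP (f i)" for f :: "'n \<Rightarrow> 'a \<Rightarrow> real poly" and S
    using finite[of S] by (induction S rule: finite_induct) (auto simp: DP_const DP_mult that)
  have "DP (\<lambda>x. poly_char_matrix (M x) $ i $ j)" for i j
  proof -
    have "(\<lambda>x. coeff [:M x $ i $ j:] k) differentiable (at x)" for k
      using assms unfolding matrix_differentiable_componentwise by (cases k) simp_all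
    then show ?thesis by (simp add: DP_def)
  qed
  then have "DP (\<lambda>x. det (poly_char_matrix (M x)))"
    unfolding det_def by (intro DP_sum DP_mult DP_const DP_prod) (auto simp: finite_permutations)
  then show ?thesis by (simp add: DP_def char_coeff_def)
qed

lemma matrix_mult_differentiable:
  fixes M :: "'a::real_normed_vector \<Rightarrow> real ^ 'n ^ 'm" and N :: "'a \<Rightarrow> real ^ 'p ^ 'n"
  assumes "M differentiable (at x)" "N differentiable (at x)"
  shows "(\<lambda>x. M x ** N x) differentiable (at x)"
  using assms unfolding differentiable_def by (elim exE) (rule exI, erule (1) matrix_mult_FDERIV)

lemma matrix_pow_differentiable:
  fixes M :: "'a::euclidean_space \<Rightarrow> real ^ 'n ^ 'n"
  assumes "M differentiable (at x)"
  shows "(\<lambda>x. matrix_pow (M x) k) differentiable (at x)"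
  by (induction k) (simp_all add: matrix_pow_simps matrix_mult_differentiable assms)

section \<open>Picard-Lindelof theorem and local solutions of the geodesic equation\<close>

section \<open>Ordinary differential equations\<close>

text \<open>For either sign of c the difference is the oriented integral from 0 to c, over a length
  of at most a.\<close>

lemma norm_integral_difference_bound:
  fixes h :: "real \<Rightarrow> 'a::euclidean_space"
  assumes h: "continuous_on UNIV h" "\<And>s. norm (h s) \<le> C" and c: "-a \<le> c" "c \<le> a"
  shows "norm (integral {-a..c} h - integral {-a..0} h) \<le> C * a"
proof -
  have C: "0 \<le> C" using h(2)[of 0] norm_ge_zero order_trans by blast
  have int: "h integrable_on {p..q}" for p q
    using h(1) continuous_on_subset integrable_continuous_real by blast
  show ?thesis
  proof (cases "0 \<le> c")
    case True
    have "integral {-a..0} h + integral {0..c} h = integral {-a..c} h"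
      using c True int by (intro Henstock_Kurzweil_Integration.integral_combine) auto
    then have "norm (integral {-a..c} h - integral {-a..0} h) = norm (integral {0..c} h)"
      by (metis add_diff_cancel_left')
    also have "\<dots> \<le> C * (c - 0)"
      using True h by (intro integral_bound) (auto intro: continuous_on_subset)
    also have "\<dots> \<le> C * a" using c C by (simp add: mult_left_mono)
    finally show ?thesis .
  next
    case False
    have "integral {-a..c} h + integral {c..0} h = integral {-a..0} h"
      using c False int by (intro Henstock_Kurzweil_Integration.integral_combine) auto
    then have "norm (integral {-a..c} h - integral {-a..0} h) = norm (integral {c..0} h)"
      by (metis add_diff_cancel_left' norm_minus_commute)
    also have "\<dots> \<le> C * (0 - c)"
      using False h by (intro integral_bound) (auto intro: continuous_on_subset)
    also have "\<dots> \<le> C * a" using c C by (intro mult_left_mono) auto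
    finally show ?thesis .
  qed
qed

text \<open>Composing X with the projection to the closed ball gives a field Y that is bounded and
  Lipschitz on the whole space, so the Picard operator acts on all bounded continuous functions on
  the line and Banach's theorem applies. The fixed point stays in the ball, where Y and X
  agree.\<close>

theorem picard_lindelof:
  fixes X :: "'a::euclidean_space \<Rightarrow> 'a"
  assumes r: "0 < r"
    and lip: "\<And>x y. x \<in> cball z r \<Longrightarrow> y \<in> cball z r \<Longrightarrow> norm (X x - X y) \<le> K * norm (x - y)"
  obtains a u where "0 < a" "u 0 = z"
    "\<And>t. \<bar>t\<bar> < a \<Longrightarrow> u t \<in> cball z r \<and> (u has_vector_derivative X (u t)) (at t)"
proof -
  define S where "S = cball z r"
  have S: "closed S" "convex S" "S \<noteq> {}" "z \<in> S" using r by (auto simp: S_def)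
  define Y where "Y x = X (closest_point S x)" for x
  define M where "M = max K 1"
  have M: "M \<ge> 1" "K \<le> M" by (auto simp: M_def)
  have cpS: "closest_point S x \<in> S" for x using S closest_point_in_set by blast
  have Ylip: "norm (Y x - Y y) \<le> M * norm (x - y)" for x y
  proof -
    have "norm (Y x - Y y) \<le> K * norm (closest_point S x - closest_point S y)"
      using lip cpS by (simp add: Y_def S_def)
    also have "\<dots> \<le> M * norm (closest_point S x - closest_point S y)"
      using M by (simp add: mult_right_mono)
    also have "\<dots> \<le> M * norm (x - y)"
      using closest_point_lipschitz[OF S(2,1,3), of x y] M by (simp add: dist_norm)
    finally show ?thesis .
  qed
  define B where "B = norm (X z) + M * r + 1"
  have B: "B > 0" using M r by (simp add: B_def add_nonneg_pos)
  have Yb: "norm (Y x) \<le> B" for x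
  proof -
    have "norm (Y x - X z) \<le> K * norm (closest_point S x - z)"
      using lip cpS S(4) by (simp add: Y_def S_def)
    also have "\<dots> \<le> M * norm (closest_point S x - z)" using M by (simp add: mult_right_mono)
    also have "\<dots> \<le> M * r" using cpS[of x] M by (simp add: S_def dist_norm norm_minus_commute)
    finally have "norm (Y x - X z) \<le> M * r" .
    moreover have "norm (Y x) \<le> norm (X z) + norm (Y x - X z)"
      by (metis norm_triangle_sub)
    ultimately show ?thesis by (simp add: B_def)
  qed
  have Ycont: "continuous_on UNIV Y"
  proof -
    have "M-lipschitz_on UNIV Y" using Ylip M by (simp add: lipschitz_on_def dist_norm)
    then show ?thesis by (rule lipschitz_on_continuous_on)
  qed
  \<comment> \<open>The first bound makes the Picard operator a contraction with factor 1/2, the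
    second keeps its values in the ball.\<close>
  define a where "a = min (1 / (2 * M)) (r / B)"
  have a: "0 < a" "M * a \<le> 1 / 2" "B * a \<le> r"
  proof -
    show "0 < a" using M B r by (simp add: a_def)
    have "M * a \<le> M * (1 / (2 * M))" using M by (intro mult_left_mono) (auto simp: a_def)
    then show "M * a \<le> 1 / 2" using M by simp
    have "B * a \<le> B * (r / B)" using B by (intro mult_left_mono) (auto simp: a_def)
    then show "B * a \<le> r" using B by simp
  qed
  \<comment> \<open>Time is clamped to [-a, a]: the iterates are then defined and bounded on the
    whole line, and on the open interval nothing changes.\<close>
  define c where "c t = max (-a) (min a t)" for t
  have c: "-a \<le> c t" "c t \<le> a" for t using a by (auto simp: c_def)
  have ccont: "continuous_on UNIV c" unfolding c_def by (intro continuous_intros)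
  define \<Phi> where "\<Phi> u t = z + (integral {-a..c t} (\<lambda>s. Y (u s)) - integral {-a..0} (\<lambda>s. Y (u s)))"
    for u :: "real \<Rightarrow> 'a" and t
  have Yu: "continuous_on T (\<lambda>s. Y (apply_bcontfun u s))" for u :: "real \<Rightarrow>\<^sub>C 'a" and T
    using continuous_on_compose2[OF Ycont continuous_on_apply_bcontfun] by auto
  have \<Phi>b: "norm (\<Phi> (apply_bcontfun u) t - z) \<le> B * a" for u t
    using norm_integral_difference_bound[OF Yu[of UNIV u] Yb c, of t] by (simp add: \<Phi>_def)
  have "\<Phi> (apply_bcontfun u) \<in> bcontfun" for u
  proof (rule bcontfun_normI)
    have "continuous_on {-a..a} (\<lambda>q. integral {-a..q} (\<lambda>s. Y (apply_bcontfun u s)))"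
      by (intro indefinite_integral_continuous_1 integrable_continuous_real Yu)
    then have "continuous_on UNIV (\<lambda>t. integral {-a..c t} (\<lambda>s. Y (apply_bcontfun u s)))"
      by (rule continuous_on_compose2[OF _ ccont]) (use c in \<open>auto simp: image_subset_iff\<close>)
    then show "continuous_on UNIV (\<Phi> (apply_bcontfun u))"
      unfolding \<Phi>_def by (intro continuous_intros)
    show "norm (\<Phi> (apply_bcontfun u) t) \<le> norm z + B * a" for t
      using \<Phi>b[of u t] norm_triangle_sub[of "\<Phi> (apply_bcontfun u) t" z] by simp
  qed
  then have ap: "apply_bcontfun (Bcontfun (\<Phi> (apply_bcontfun u))) = \<Phi> (apply_bcontfun u)" for u
    by (simp add: Bcontfun_inverse)
  have "\<exists>!u. Bcontfun (\<Phi> (apply_bcontfun u)) = u"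
  proof (rule banach_fix_type[of "1 / 2"])
    show "\<forall>u v. dist (Bcontfun (\<Phi> (apply_bcontfun u))) (Bcontfun (\<Phi> (apply_bcontfun v))) \<le> 1 / 2 * dist u v"
    proof (intro allI dist_bound)
      fix u v :: "real \<Rightarrow>\<^sub>C 'a" and t
      let ?h = "\<lambda>s. Y (apply_bcontfun u s) - Y (apply_bcontfun v s)"
      have "norm (?h s) \<le> M * dist u v" for s
      proof -
        have "norm (?h s) \<le> M * dist (apply_bcontfun u s) (apply_bcontfun v s)"
          using Ylip by (simp add: dist_norm)
        also have "\<dots> \<le> M * dist u v" using M dist_bounded by (simp add: mult_left_mono)
        finally show ?thesis .
      qed
      then have "norm (integral {-a..c t} ?h - integral {-a..0} ?h) \<le> M * dist u v * a"
        by (intro norm_integral_difference_bound c continuous_on_diff Yu)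
      also have "\<dots> \<le> 1 / 2 * dist u v"
        using mult_right_mono[OF a(2), of "dist u v"] by (simp add: mult_ac)
      also have "integral {-a..c t} ?h - integral {-a..0} ?h =
          \<Phi> (apply_bcontfun u) t - \<Phi> (apply_bcontfun v) t"
        by (simp add: \<Phi>_def integral_diff integrable_continuous_real Yu)
      finally show "dist (apply_bcontfun (Bcontfun (\<Phi> (apply_bcontfun u))) t)
          (apply_bcontfun (Bcontfun (\<Phi> (apply_bcontfun v))) t) \<le> 1 / 2 * dist u v"
        unfolding ap dist_norm[of "\<Phi> _ _"] .
    qed
  qed auto
  then obtain u where "Bcontfun (\<Phi> (apply_bcontfun u)) = u" by blast
  then have u: "\<Phi> (apply_bcontfun u) = apply_bcontfun u" using ap by metis
  show thesis
  proof (rule that[of a "apply_bcontfun u"])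
    have "c 0 = 0" using a by (simp add: c_def)
    then show "apply_bcontfun u 0 = z" using u by (metis \<Phi>_def add.right_neutral cancel_comm_monoid_add_class.diff_cancel)
    fix t assume t: "\<bar>t\<bar> < a"
    have inS: "apply_bcontfun u t \<in> S"
      using \<Phi>b[of u t] a unfolding u by (simp add: S_def dist_norm norm_minus_commute)
    have "at t within {-a..a} = at t" using t by (intro at_within_Icc_at) auto
    moreover have "((\<lambda>q. integral {-a..q} (\<lambda>s. Y (apply_bcontfun u s))) has_vector_derivative Y (apply_bcontfun u t))
        (at t within {-a..a})"
      by (rule integral_has_vector_derivative[OF Yu]) (use t in auto)
    ultimately have "((\<lambda>q. integral {-a..q} (\<lambda>s. Y (apply_bcontfun u s))) has_vector_derivative
        Y (apply_bcontfun u t)) (at t)" by simp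
    then have "((\<lambda>q. z + (integral {-a..q} (\<lambda>s. Y (apply_bcontfun u s)) - integral {-a..0} (\<lambda>s. Y (apply_bcontfun u s))))
        has_vector_derivative Y (apply_bcontfun u t)) (at t)"
      by (auto intro!: derivative_eq_intros)
    then have "(apply_bcontfun u has_vector_derivative Y (apply_bcontfun u t)) (at t)"
    proof (rule has_vector_derivative_transform_within_open[of _ _ _ "{-a<..<a}"])
      fix q assume "q \<in> {-a<..<a}"
      then have "c q = q" by (auto simp: c_def)
      then show "z + (integral {-a..q} (\<lambda>s. Y (apply_bcontfun u s)) - integral {-a..0} (\<lambda>s. Y (apply_bcontfun u s))) =
          apply_bcontfun u q"
        using fun_cong[OF u, of q] by (simp add: \<Phi>_def)
    qed (use t in auto)
    moreover have "Y (apply_bcontfun u t) = X (apply_bcontfun u t)"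
      using inS by (simp add: Y_def closest_point_self)
    ultimately show "apply_bcontfun u t \<in> cball z r \<and>
        (apply_bcontfun u has_vector_derivative X (apply_bcontfun u t)) (at t)"
      using inS by (simp add: S_def)
  qed (use a in auto)
qed

text \<open>Boundedness is included because products of Lipschitz functions are Lipschitz only when
  the factors are bounded.\<close>

definition bounded_lipschitz :: "'a::metric_space set \<Rightarrow> ('a \<Rightarrow> real) \<Rightarrow> bool" where
  "bounded_lipschitz K f \<longleftrightarrow>
     (\<exists>C\<ge>0. \<forall>x\<in>K. \<bar>f x\<bar> \<le> C \<and> (\<forall>y\<in>K. \<bar>f x - f y\<bar> \<le> C * dist x y))"

lemma bounded_lipschitz_const: "bounded_lipschitz K (\<lambda>_. c)"
  unfolding bounded_lipschitz_def by (rule exI[of _ "\<bar>c\<bar>"]) simp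

lemma bounded_lipschitz_add:
  assumes "bounded_lipschitz K f" "bounded_lipschitz K h"
  shows "bounded_lipschitz K (\<lambda>x. f x + h x)"
proof -
  obtain C D where C: "C \<ge> 0" "\<And>x. x \<in> K \<Longrightarrow> \<bar>f x\<bar> \<le> C" "\<And>x y. x \<in> K \<Longrightarrow> y \<in> K \<Longrightarrow> \<bar>f x - f y\<bar> \<le> C * dist x y"
    and D: "D \<ge> 0" "\<And>x. x \<in> K \<Longrightarrow> \<bar>h x\<bar> \<le> D" "\<And>x y. x \<in> K \<Longrightarrow> y \<in> K \<Longrightarrow> \<bar>h x - h y\<bar> \<le> D * dist x y"
    using assms unfolding bounded_lipschitz_def by metis
  have "\<bar>f x + h x\<bar> \<le> C + D" if "x \<in> K" for x using C(2)[OF that] D(2)[OF that] by linarith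
  moreover have "\<bar>f x + h x - (f y + h y)\<bar> \<le> (C + D) * dist x y" if "x \<in> K" "y \<in> K" for x y
    using C(3)[OF that] D(3)[OF that] by (simp add: distrib_right)
  ultimately show ?thesis unfolding bounded_lipschitz_def using C(1) D(1)
    by (intro exI[of _ "C + D"]) auto
qed

lemma bounded_lipschitz_mult:
  assumes "bounded_lipschitz K f" "bounded_lipschitz K h"
  shows "bounded_lipschitz K (\<lambda>x. f x * h x)"
proof -
  obtain C D where C: "C \<ge> 0" "\<And>x. x \<in> K \<Longrightarrow> \<bar>f x\<bar> \<le> C" "\<And>x y. x \<in> K \<Longrightarrow> y \<in> K \<Longrightarrow> \<bar>f x - f y\<bar> \<le> C * dist x y"
    and D: "D \<ge> 0" "\<And>x. x \<in> K \<Longrightarrow> \<bar>h x\<bar> \<le> D" "\<And>x y. x \<in> K \<Longrightarrow> y \<in> K \<Longrightarrow> \<bar>h x - h y\<bar> \<le> D * dist x y"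
    using assms unfolding bounded_lipschitz_def by metis
  have CD: "0 \<le> C * D" using C(1) D(1) by simp
  have 1: "\<bar>f x * h x\<bar> \<le> C * D" if "x \<in> K" for x
    using C(2)[OF that] D(2)[OF that] C(1) unfolding abs_mult by (intro mult_mono) auto
  have 2: "\<bar>f x * h x - f y * h y\<bar> \<le> (2 * (C * D)) * dist x y" if xy: "x \<in> K" "y \<in> K" for x y
  proof -
    have "f x * h x - f y * h y = (f x - f y) * h x + f y * (h x - h y)" by (simp add: algebra_simps)
    then have "\<bar>f x * h x - f y * h y\<bar> \<le> \<bar>f x - f y\<bar> * \<bar>h x\<bar> + \<bar>f y\<bar> * \<bar>h x - h y\<bar>"
      by (metis abs_mult abs_triangle_ineq)
    also have "\<dots> \<le> (C * dist x y) * D + C * (D * dist x y)"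
      using C D xy by (intro add_mono mult_mono) auto
    finally show ?thesis by (simp add: algebra_simps)
  qed
  show ?thesis unfolding bounded_lipschitz_def
  proof (intro exI[of _ "2 * (C * D)"] conjI ballI)
    show "\<bar>f x * h x\<bar> \<le> 2 * (C * D)" if "x \<in> K" for x using 1[OF that] CD by linarith
  qed (use 2 CD in auto)
qed

lemma bounded_lipschitz_sum:
  assumes "finite I" "\<And>i. i \<in> I \<Longrightarrow> bounded_lipschitz K (f i)"
  shows "bounded_lipschitz K (\<lambda>x. \<Sum>i\<in>I. f i x)"
  using assms by (induction I rule: finite_induct) (auto simp: bounded_lipschitz_const bounded_lipschitz_add)

lemma bounded_lipschitz_diff:
  assumes "bounded_lipschitz K f" "bounded_lipschitz K h"
  shows "bounded_lipschitz K (\<lambda>x. f x - h x)"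
  using bounded_lipschitz_add[OF assms(1) bounded_lipschitz_mult[OF bounded_lipschitz_const[of K "-1"] assms(2)]]
  by simp

lemma bounded_lipschitz_compose:
  assumes "bounded_lipschitz K f" "\<And>x. x \<in> L \<Longrightarrow> h x \<in> K" "\<And>x y. dist (h x) (h y) \<le> dist x y"
  shows "bounded_lipschitz L (\<lambda>x. f (h x))"
proof -
  obtain C where C: "C \<ge> 0" "\<And>x. x \<in> K \<Longrightarrow> \<bar>f x\<bar> \<le> C" "\<And>x y. x \<in> K \<Longrightarrow> y \<in> K \<Longrightarrow> \<bar>f x - f y\<bar> \<le> C * dist x y"
    using assms unfolding bounded_lipschitz_def by metis
  have "\<bar>f (h x) - f (h y)\<bar> \<le> C * dist x y" if "x \<in> L" "y \<in> L" for x y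
    using C(3)[of "h x" "h y"] mult_left_mono[OF assms(3)[of x y] C(1)] assms(2) that by fastforce
  then show ?thesis using C assms(2) unfolding bounded_lipschitz_def by (intro exI[of _ C]) auto
qed

text \<open>Mean value inequality on a compact convex set; the operator norm of the derivative is
  bounded by the sum of the directional derivatives along the basis, each continuous on K.\<close>

lemma bounded_lipschitz_C1:
  fixes f :: "'a::euclidean_space \<Rightarrow> real"
  assumes C1: "Ck_on 1 U f" and K: "compact K" "convex K" "K \<subseteq> U"
  shows "bounded_lipschitz K f"
proof -
  have d: "(f has_derivative frechet_derivative f (at x)) (at x within K)" if "x \<in> K" for x
    using that C1 K(3) by (auto simp: frechet_derivative_works intro: has_derivative_at_withinI)
  have "continuous_on K f" by (rule has_derivative_continuous_on) (rule d)
  then have "bounded (f ` K)" using K(1) compact_continuous_image compact_imp_bounded by blast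
  then obtain B where B: "\<And>x. x \<in> K \<Longrightarrow> \<bar>f x\<bar> \<le> B" by (auto simp: bounded_iff)
  have "\<exists>D. \<forall>x\<in>K. \<bar>frechet_derivative f (at x) b\<bar> \<le> D" for b
  proof -
    have "continuous_on K (\<lambda>x. frechet_derivative f (at x) b)"
      using C1 K(3) by (auto intro: continuous_on_subset)
    then have "bounded ((\<lambda>x. frechet_derivative f (at x) b) ` K)"
      using K(1) compact_continuous_image compact_imp_bounded by blast
    then show ?thesis by (auto simp: bounded_iff)
  qed
  then obtain D where D: "\<And>b x. x \<in> K \<Longrightarrow> \<bar>frechet_derivative f (at x) b\<bar> \<le> D b" by metis
  \<comment> \<open>The absolute values keep C nonnegative also when K is empty and nothing
    constrains B and D.\<close>
  define C where "C = \<bar>B\<bar> + \<bar>\<Sum>b\<in>(Basis :: 'a set). D b\<bar>"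
  have on: "onorm (frechet_derivative f (at x)) \<le> C" if "x \<in> K" for x
  proof -
    have "onorm (frechet_derivative f (at x)) \<le> (\<Sum>b\<in>Basis. norm (frechet_derivative f (at x) b))"
      by (rule onorm_componentwise[OF has_derivative_bounded_linear[OF d[OF that]]])
    also have "\<dots> \<le> (\<Sum>b\<in>Basis. D b)" using D that by (intro sum_mono) simp
    finally show ?thesis by (simp add: C_def)
  qed
  have "\<bar>f x - f y\<bar> \<le> C * dist x y" if "x \<in> K" "y \<in> K" for x y
    using differentiable_bound[OF K(2) d on, of x y] that by (simp add: dist_norm)
  moreover have "\<bar>f x\<bar> \<le> C" if "x \<in> K" for x using B[OF that] by (simp add: C_def)
  ultimately show ?thesis unfolding bounded_lipschitz_def by (intro exI[of _ C]) (auto simp: C_def)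
qed

text \<open>The second-order equation becomes a first-order system for position and velocity,
  Lipschitz on a closed ball around the initial state. The hypothesis on \<open>\<Gamma>\<close>
  covers every ball inside U because the radius is only found in the proof.\<close>

lemma geodesic_ode_solution:
  fixes \<Gamma> :: "'n::finite \<Rightarrow> 'n \<Rightarrow> 'n \<Rightarrow> real ^ 'n \<Rightarrow> real"
  assumes U: "open U" "x0 \<in> U"
    and \<Gamma>: "\<And>i j k r. cball x0 r \<subseteq> U \<Longrightarrow> bounded_lipschitz (cball x0 r) (\<Gamma> i j k)"
  obtains a y v where "0 < a" "y 0 = x0" "v 0 = v0"
    "\<And>t. \<bar>t\<bar> < a \<Longrightarrow> y t \<in> U \<and> (y has_vector_derivative v t) (at t) \<and>
      (v has_vector_derivative (\<chi> i. - (\<Sum>j\<in>UNIV. \<Sum>k\<in>UNIV. \<Gamma> i j k (y t) * v t $ j * v t $ k))) (at t)"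
proof -
  obtain r where r: "r > 0" "cball x0 r \<subseteq> U" using U open_contains_cball by blast
  define X where "X z = (snd z, \<chi> i. - (\<Sum>j\<in>UNIV. \<Sum>k\<in>UNIV. \<Gamma> i j k (fst z) * snd z $ j * snd z $ k))"
    for z :: "(real ^ 'n) \<times> (real ^ 'n)"
  let ?K = "cball (x0, v0) r"
  have lf: "dist (fst x) (fst y) \<le> dist x y" for x y :: "(real ^ 'n) \<times> (real ^ 'n)"
    by (rule dist_fst_le)
  have "bounded_lipschitz ?K (\<lambda>z. \<Gamma> i j k (fst z))" for i j k
    by (rule bounded_lipschitz_compose[OF \<Gamma>[OF r(2)] _ lf])
      (metis fst_conv lf mem_cball order_trans)
  moreover have sndl: "bounded_lipschitz ?K (\<lambda>z. snd z $ j)" for j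
  proof -
    have "bounded_lipschitz (cball v0 r) (\<lambda>v. v $ j)"
    proof (rule bounded_lipschitz_C1[where U = UNIV])
      have "frechet_derivative (\<lambda>v. v $ j) (at x) = (\<lambda>v. v $ j)" for x :: "real ^ 'n"
        by (rule frechet_derivative_at[symmetric])
          (rule bounded_linear_imp_has_derivative[OF bounded_linear_vec_nth])
      then show "Ck_on 1 UNIV (\<lambda>v :: real ^ 'n. v $ j)"
        by (auto simp: bounded_linear_imp_differentiable[OF bounded_linear_vec_nth])
    qed auto
    then show ?thesis
      by (rule bounded_lipschitz_compose[OF _ _ dist_snd_le]) (metis snd_conv dist_snd_le mem_cball order_trans)
  qed
  ultimately have c: "bounded_lipschitz ?K (\<lambda>z. (- 1) * (\<Sum>j\<in>UNIV. \<Sum>k\<in>UNIV. \<Gamma> i j k (fst z) * snd z $ j * snd z $ k))" for i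
    by (intro bounded_lipschitz_mult bounded_lipschitz_sum bounded_lipschitz_const) auto
  have "bounded_lipschitz ?K (\<lambda>z. X z \<bullet> b)" if b: "b \<in> Basis" for b
  proof -
    from b consider j where "b = (axis j 1, 0)" | j where "b = (0, axis j 1)"
      by (auto simp: Basis_prod_def Basis_vec_def)
    then show ?thesis
      by cases (use sndl c in \<open>auto simp: X_def inner_axis\<close>)
  qed
  then have "\<exists>C. \<forall>b\<in>Basis. C b \<ge> 0 \<and> (\<forall>x\<in>?K. \<forall>y\<in>?K. \<bar>X x \<bullet> b - X y \<bullet> b\<bar> \<le> C b * dist x y)"
    unfolding bounded_lipschitz_def by metis
  then obtain C where C: "\<And>b x y. b \<in> Basis \<Longrightarrow> x \<in> ?K \<Longrightarrow> y \<in> ?K \<Longrightarrow> \<bar>X x \<bullet> b - X y \<bullet> b\<bar> \<le> C b * dist x y"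
    by blast
  have lip: "norm (X x - X y) \<le> (\<Sum>b\<in>Basis. C b) * norm (x - y)" if "x \<in> ?K" "y \<in> ?K" for x y
  proof -
    have "norm (X x - X y) \<le> (\<Sum>b\<in>Basis. \<bar>(X x - X y) \<bullet> b\<bar>)" by (rule norm_le_l1)
    also have "\<dots> \<le> (\<Sum>b\<in>Basis. C b * dist x y)"
      using C that by (intro sum_mono) (simp add: inner_diff_left)
    finally show ?thesis by (simp add: sum_distrib_right dist_norm)
  qed
  obtain a u where a: "0 < a" and u0: "u 0 = (x0, v0)"
    and u: "\<And>t. \<bar>t\<bar> < a \<Longrightarrow> u t \<in> ?K \<and> (u has_vector_derivative X (u t)) (at t)"
    using picard_lindelof[OF r(1) lip] by blast
  show thesis
  proof (rule that[OF a, of "\<lambda>t. fst (u t)" "\<lambda>t. snd (u t)"])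
    fix t assume t: "\<bar>t\<bar> < a"
    have "fst (u t) \<in> U"
      using u[OF t] r(2) lf[of "(x0, v0)" "u t"] by (auto simp: subset_iff)
    moreover have "((\<lambda>t. fst (u t)) has_vector_derivative fst (X (u t))) (at t)"
      "((\<lambda>t. snd (u t)) has_vector_derivative snd (X (u t))) (at t)"
      by (rule bounded_linear.has_vector_derivative[OF bounded_linear_fst u[OF t, THEN conjunct2]],
          rule bounded_linear.has_vector_derivative[OF bounded_linear_snd u[OF t, THEN conjunct2]])
    ultimately show "fst (u t) \<in> U \<and> ((\<lambda>t. fst (u t)) has_vector_derivative snd (u t)) (at t) \<and>
      ((\<lambda>t. snd (u t)) has_vector_derivative (\<chi> i. - (\<Sum>j\<in>UNIV. \<Sum>k\<in>UNIV. \<Gamma> i j k (fst (u t)) *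
        snd (u t) $ j * snd (u t) $ k))) (at t)"
      by (simp add: X_def)
  qed (simp_all add: u0)
qed

section \<open>Equality of mixed second derivatives\<close>

section \<open>Symmetry of second derivatives\<close>

lemma frechet_derivative_eqI:
  "(f has_derivative f') (at x) \<Longrightarrow> frechet_derivative f (at x) = f'"
  by (rule frechet_derivative_at[symmetric])

text \<open>Since S is open, agreement on S is agreement near each of its points, so all the
  derivatives in \<open>Ck_on\<close> agree as well.\<close>

lemma Ck_on_cong:
  assumes "open S" "\<And>x. x \<in> S \<Longrightarrow> f x = h x" "Ck_on k S f"
  shows "Ck_on k S h"
  using assms(2,3)
proof (induction k arbitrary: f h)
  case 0
  then show ?case using continuous_on_cong by fastforce
next
  case (Suc k)
  have h: "(h has_derivative frechet_derivative f (at x)) (at x)" if x: "x \<in> S" for x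
  proof -
    have "(f has_derivative frechet_derivative f (at x)) (at x)"
      using Suc.prems(2) x by (simp add: frechet_derivative_works)
    then show ?thesis
      by (rule has_derivative_transform_within_open[OF _ assms(1) x]) (rule Suc.prems(1))
  qed
  then have "frechet_derivative h (at x) = frechet_derivative f (at x)" if "x \<in> S" for x
    using that frechet_derivative_eqI by blast
  then have "Ck_on k S (\<lambda>x. frechet_derivative h (at x) v)" for v
    using Suc.IH[of "\<lambda>x. frechet_derivative f (at x) v" "\<lambda>x. frechet_derivative h (at x) v"] Suc.prems(2)
    by simp
  then show ?case using h unfolding Ck_on.simps differentiable_def by blast
qed

lemma Ck_on_bounded_linear:
  assumes "open S" "bounded_linear L" "Ck_on k S f"
  shows "Ck_on k S (\<lambda>x. L (f x))"
  using assms(3)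
proof (induction k arbitrary: f)
  case 0
  then show ?case using bounded_linear.continuous_on[OF assms(2)] by simp
next
  case (Suc k)
  have h: "((\<lambda>x. L (f x)) has_derivative (\<lambda>v. L (frechet_derivative f (at x) v))) (at x)" if x: "x \<in> S" for x
    using Suc.prems x by (intro bounded_linear.has_derivative[OF assms(2)]) (simp add: frechet_derivative_works)
  have "Ck_on k S (\<lambda>x. L (frechet_derivative f (at x) v))" for v
    using Suc.IH Suc.prems by simp
  then have "Ck_on k S (\<lambda>x. frechet_derivative (\<lambda>x. L (f x)) (at x) v)" for v
    by (rule Ck_on_cong[OF assms(1), rotated]) (simp add: frechet_derivative_eqI[OF h])
  then show ?case using h unfolding Ck_on.simps differentiable_def by blast
qed

lemma Ck_on_nth: "open S \<Longrightarrow> Ck_on k S f \<Longrightarrow> Ck_on k S (\<lambda>x. f x $ i)"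
  for f :: "'a::real_normed_vector \<Rightarrow> 'b::real_normed_vector ^ 'n"
  by (rule Ck_on_bounded_linear[OF _ bounded_linear_vec_nth])

text \<open>The mean value theorem is applied twice: along v to the difference of two translates of
  f by \<open>h *\<^sub>R w\<close>, then along w to the derivative in direction v.\<close>

lemma second_difference:
  fixes f :: "'a::real_normed_vector \<Rightarrow> real"
  assumes f: "Ck_on 2 U f" and h: "0 < h"
    and U: "\<And>s t. 0 \<le> s \<Longrightarrow> s \<le> h \<Longrightarrow> 0 \<le> t \<Longrightarrow> t \<le> h \<Longrightarrow> x + s *\<^sub>R v + t *\<^sub>R w \<in> U"
  obtains s t where "0 < s" "s < h" "0 < t" "t < h"
    "f (x + h *\<^sub>R v + h *\<^sub>R w) - f (x + h *\<^sub>R v) - f (x + h *\<^sub>R w) + f x =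
     h * (h * frechet_derivative (\<lambda>y. frechet_derivative f (at y) v) (at (x + s *\<^sub>R v + t *\<^sub>R w)) w)"
proof -
  have line: "((\<lambda>s. p (a + s *\<^sub>R b)) has_field_derivative frechet_derivative p (at (a + s *\<^sub>R b)) b) (at s)"
    if "p differentiable (at (a + s *\<^sub>R b))" for p :: "'a \<Rightarrow> real" and a b s
  proof -
    have "((\<lambda>s. a + s *\<^sub>R b) has_derivative (\<lambda>r. r *\<^sub>R b)) (at s)"
      by (auto intro!: derivative_eq_intros)
    moreover have p: "(p has_derivative frechet_derivative p (at (a + s *\<^sub>R b))) (at (a + s *\<^sub>R b))"
      using that by (simp add: frechet_derivative_works)
    ultimately have "((\<lambda>s. p (a + s *\<^sub>R b)) has_derivative
        (\<lambda>r. frechet_derivative p (at (a + s *\<^sub>R b)) (r *\<^sub>R b))) (at s)"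
      by (rule has_derivative_compose)
    moreover have "(\<lambda>r. frechet_derivative p (at (a + s *\<^sub>R b)) (r *\<^sub>R b)) =
        (*) (frechet_derivative p (at (a + s *\<^sub>R b)) b)"
      using linear_cmul[OF has_derivative_linear[OF p]] by (simp add: fun_eq_iff)
    ultimately show ?thesis by (simp add: has_field_derivative_def)
  qed
  have d1: "f differentiable (at y)" and d2: "(\<lambda>y. frechet_derivative f (at y) v) differentiable (at y)"
    if "y \<in> U" for y
    using f that by (auto simp: numeral_2_eq_2)
  let ?\<phi> = "\<lambda>s. f ((x + h *\<^sub>R w) + s *\<^sub>R v) - f (x + s *\<^sub>R v)"
  have "\<exists>s>0. s < h \<and> ?\<phi> h - ?\<phi> 0 = (h - 0) *
     (frechet_derivative f (at ((x + h *\<^sub>R w) + s *\<^sub>R v)) v - frechet_derivative f (at (x + s *\<^sub>R v)) v)"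
  proof (rule MVT2[OF h])
    fix s assume s: "0 \<le> s" "s \<le> h"
    show "(?\<phi> has_field_derivative
       frechet_derivative f (at ((x + h *\<^sub>R w) + s *\<^sub>R v)) v - frechet_derivative f (at (x + s *\<^sub>R v)) v) (at s)"
      using U[OF s, of h] U[OF s, of 0] h
      by (intro DERIV_diff line d1) (auto simp: add_ac)
  qed
  then obtain s where s: "0 < s" "s < h" and e1: "?\<phi> h - ?\<phi> 0 = h *
     (frechet_derivative f (at ((x + h *\<^sub>R w) + s *\<^sub>R v)) v - frechet_derivative f (at (x + s *\<^sub>R v)) v)"
    by auto
  let ?p = "\<lambda>y. frechet_derivative f (at y) v"
  let ?\<psi> = "\<lambda>t. ?p ((x + s *\<^sub>R v) + t *\<^sub>R w)"
  have "\<exists>t>0. t < h \<and> ?\<psi> h - ?\<psi> 0 = (h - 0) *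
     frechet_derivative ?p (at ((x + s *\<^sub>R v) + t *\<^sub>R w)) w"
  proof (rule MVT2[OF h])
    fix t assume t: "0 \<le> t" "t \<le> h"
    show "(?\<psi> has_field_derivative frechet_derivative ?p (at ((x + s *\<^sub>R v) + t *\<^sub>R w)) w) (at t)"
      using U[of s t] s t by (intro line d2) auto
  qed
  then obtain t where t: "0 < t" "t < h" and e2: "?\<psi> h - ?\<psi> 0 = h *
     frechet_derivative ?p (at ((x + s *\<^sub>R v) + t *\<^sub>R w)) w"
    by auto
  have "f (x + h *\<^sub>R v + h *\<^sub>R w) - f (x + h *\<^sub>R v) - f (x + h *\<^sub>R w) + f x = ?\<phi> h - ?\<phi> 0"
    by (simp add: add_ac)
  also have "\<dots> = h * (?\<psi> h - ?\<psi> 0)" unfolding e1 by (simp add: add_ac)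
  finally show thesis using that[OF s t] e2 by simp
qed

text \<open>The second difference over a parallelogram is symmetric in v and w, so both mixed
  derivatives take a common value at two points of every small parallelogram; by continuity they
  cannot differ at x.\<close>

theorem second_derivative_symmetric:
  fixes f :: "'a::real_normed_vector \<Rightarrow> real"
  assumes f: "Ck_on 2 U f" and U: "open U" "x \<in> U"
  shows "frechet_derivative (\<lambda>y. frechet_derivative f (at y) v) (at x) w =
         frechet_derivative (\<lambda>y. frechet_derivative f (at y) w) (at x) v"
proof (rule ccontr)
  define P where "P v w y = frechet_derivative (\<lambda>y. frechet_derivative f (at y) v) (at y) w" for v w y
  assume "\<not> ?thesis"
  then have ne: "P v w x \<noteq> P w v x" by (simp add: P_def)
  define \<epsilon> where "\<epsilon> = \<bar>P v w x - P w v x\<bar> / 2"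
  have \<epsilon>: "\<epsilon> > 0" using ne by (simp add: \<epsilon>_def)
  have "continuous_on U (P v w)" for v w using f by (simp add: P_def[abs_def] numeral_2_eq_2)
  then have "isCont (P v w) x" for v w using U continuous_on_eq_continuous_at by blast
  then have "\<exists>\<delta>>0. \<forall>y. dist y x < \<delta> \<longrightarrow> dist (P v w y) (P v w x) < \<epsilon>" for v w
    using \<epsilon> unfolding continuous_at_eps_delta by blast
  then obtain \<delta> where \<delta>: "\<And>v w. \<delta> v w > 0" "\<And>v w y. dist y x < \<delta> v w \<Longrightarrow> dist (P v w y) (P v w x) < \<epsilon>"
    by metis
  obtain r where r: "r > 0" "ball x r \<subseteq> U" using U open_contains_ball by blast
  define \<rho> where "\<rho> = min r (min (\<delta> v w) (\<delta> w v))"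
  have \<rho>: "\<rho> > 0" using r \<delta> by (simp add: \<rho>_def)
  \<comment> \<open>Small enough for the whole parallelogram to lie within \<rho> of x; the summand
    1 keeps the denominator positive when v and w vanish.\<close>
  define h where "h = \<rho> / (2 * (norm v + norm w + 1))"
  have nvw: "norm v + norm w + 1 > 0" by (simp add: add_nonneg_pos)
  have h: "h > 0" using \<rho> nvw by (simp add: h_def)
  have hb: "h * (norm v + norm w) < \<rho>"
  proof -
    have "h * (norm v + norm w) \<le> h * (norm v + norm w + 1)" using h by simp
    also have "\<dots> = \<rho> / 2" using nvw by (simp add: h_def field_simps)
    finally show ?thesis using \<rho> by simp
  qed
  have near: "dist (x + s *\<^sub>R v + t *\<^sub>R w) x < \<rho>" if "0 \<le> s" "s \<le> h" "0 \<le> t" "t \<le> h" for s t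
  proof -
    have "dist (x + s *\<^sub>R v + t *\<^sub>R w) x = norm (s *\<^sub>R v + t *\<^sub>R w)" by (simp add: dist_norm add.assoc)
    also have "\<dots> \<le> norm (s *\<^sub>R v) + norm (t *\<^sub>R w)" by (rule norm_triangle_ineq)
    also have "\<dots> \<le> h * norm v + h * norm w" using that by (auto intro!: add_mono mult_right_mono)
    also have "\<dots> < \<rho>" using hb by (simp add: distrib_left)
    finally show ?thesis .
  qed
  have inU: "x + s *\<^sub>R v + t *\<^sub>R w \<in> U" if "0 \<le> s" "s \<le> h" "0 \<le> t" "t \<le> h" for s t
    using near[OF that] r by (auto simp: \<rho>_def dist_commute subset_iff)
  obtain s t where st: "0 < s" "s < h" "0 < t" "t < h"
    and e1: "f (x + h *\<^sub>R v + h *\<^sub>R w) - f (x + h *\<^sub>R v) - f (x + h *\<^sub>R w) + f x =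
      h * (h * P v w (x + s *\<^sub>R v + t *\<^sub>R w))"
    using second_difference[OF f h inU] unfolding P_def by blast
  have inU': "x + s *\<^sub>R w + t *\<^sub>R v \<in> U" if "0 \<le> s" "s \<le> h" "0 \<le> t" "t \<le> h" for s t
    using inU[of t s] that by (simp add: add_ac)
  obtain s' t' where st': "0 < s'" "s' < h" "0 < t'" "t' < h"
    and e2: "f (x + h *\<^sub>R w + h *\<^sub>R v) - f (x + h *\<^sub>R w) - f (x + h *\<^sub>R v) + f x =
      h * (h * P w v (x + s' *\<^sub>R w + t' *\<^sub>R v))"
    using second_difference[OF f h inU'] unfolding P_def by blast
  have c: "x + h *\<^sub>R w + h *\<^sub>R v = x + h *\<^sub>R v + h *\<^sub>R w" by (simp add: add_ac)
  have "h * (h * P v w (x + s *\<^sub>R v + t *\<^sub>R w)) = h * (h * P w v (x + s' *\<^sub>R w + t' *\<^sub>R v))"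
    using e1 e2 unfolding c by linarith
  then have eq: "P v w (x + s *\<^sub>R v + t *\<^sub>R w) = P w v (x + s' *\<^sub>R w + t' *\<^sub>R v)" using h by simp
  have "dist (P v w (x + s *\<^sub>R v + t *\<^sub>R w)) (P v w x) < \<epsilon>"
    using near[of s t] st by (intro \<delta>) (auto simp: \<rho>_def)
  moreover have "dist (P w v (x + s' *\<^sub>R w + t' *\<^sub>R v)) (P w v x) < \<epsilon>"
    using near[of t' s'] st' by (intro \<delta>) (auto simp: \<rho>_def add_ac)
  ultimately have "\<bar>P v w x - P w v x\<bar> < 2 * \<epsilon>" unfolding eq dist_real_def by linarith
  then show False by (simp add: \<epsilon>_def)
qed

section \<open>Atlas, Jacobians, and the Levi-Civita connection in a chart\<close>

section \<open>Charts and Christoffel symbols\<close>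

lemma inner_transpose_left: "(transpose A *v x) \<bullet> y = x \<bullet> (A *v y)" for A :: "real ^ 'n ^ 'm"
  by (simp add: transpose_matrix_vector dot_lmul_matrix)

lemma inner_transpose_right: "x \<bullet> (transpose A *v y) = (A *v x) \<bullet> y" for A :: "real ^ 'n ^ 'm"
  by (metis inner_commute inner_transpose_left)

lemma matrix_eq_innerI:
  fixes A B :: "real ^ 'n ^ 'n"
  assumes "\<And>z v. z \<bullet> (A *v v) = z \<bullet> (B *v v)"
  shows "A = B"
  using assms by (metis matrix_eq vector_eq_ldot)

definition local_metric :: "('m, 'n) tensor2 \<Rightarrow> ('m, 'n::finite) chart \<Rightarrow> real ^ 'n \<Rightarrow> real ^ 'n ^ 'n" where
  "local_metric g c x = g c (chart_inv c x)"

text \<open>The connection matrix \<Gamma>(w), with one lower index contracted with w. The covariant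
  derivative of an endomorphism field L along w is its ordinary derivative plus \<Gamma>(w) L - L
  \<Gamma>(w), so sums over indices become matrix algebra.\<close>

definition christoffel_matrix ::
  "('m, 'n) tensor2 \<Rightarrow> ('m, 'n::finite) chart \<Rightarrow> 'm \<Rightarrow> real ^ 'n \<Rightarrow> real ^ 'n ^ 'n" where
  "christoffel_matrix g c m w = (\<chi> i k. \<Sum>j\<in>UNIV. christoffel g c m i j k * w $ j)"

lemma christoffel_matrix_vector:
  "christoffel_matrix g c m w *v v =
   (\<chi> i. \<Sum>j\<in>UNIV. \<Sum>k\<in>UNIV. christoffel g c m i j k * w $ j * v $ k)"
  unfolding christoffel_matrix_def matrix_vector_mult_def
  by (simp add: vec_eq_iff sum_distrib_right) (intro allI sum.swap)

lemma linear_matrix_entry_expansion: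
  fixes D :: "real ^ 'n \<Rightarrow> real ^ 'n ^ 'n"
  assumes "linear D"
  shows "D w $ i $ j = (\<Sum>k\<in>UNIV. D (axis k 1) $ i $ j * w $ k)"
proof -
  have "D w = D (\<Sum>k\<in>UNIV. w $ k *\<^sub>R axis k 1)"
    by (simp add: basis_expansion flip: scalar_mult_eq_scaleR)
  also have "\<dots> = (\<Sum>k\<in>UNIV. w $ k *\<^sub>R D (axis k 1))"
    by (simp add: linear_sum[OF assms] linear_cmul[OF assms])
  finally show ?thesis by (simp add: mult.commute)
qed

locale smooth_manifold =
  fixes A :: "('m::{t2_space,second_countable_topology}, 'n::finite) chart set"
  assumes atlas: "smooth_atlas A"
begin

lemma charts_cover: obtains c where "c \<in> A" "m \<in> chart_dom c"
  using atlas unfolding smooth_atlas_def by blast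

lemma chart_at_in: "chart_at A m \<in> A" "m \<in> chart_dom (chart_at A m)"
proof -
  have "\<exists>c. c \<in> A \<and> m \<in> chart_dom c" using charts_cover[of m] by blast
  then show "chart_at A m \<in> A" "m \<in> chart_dom (chart_at A m)"
    unfolding chart_at_def by (metis (mono_tags, lifting) someI_ex)+
qed

context
  fixes c assumes c: "c \<in> A"
begin

lemma chart_homeomorphism: "homeomorphism (chart_dom c) (chart_im c) (coord c) (chart_inv c)"
  and open_chart_dom: "open (chart_dom c)" and open_chart_im: "open (chart_im c)"
  using atlas c unfolding smooth_atlas_def by blast+

lemma chart_inv_coord: "m \<in> chart_dom c \<Longrightarrow> chart_inv c (coord c m) = m"
  and coord_chart_inv: "x \<in> chart_im c \<Longrightarrow> coord c (chart_inv c x) = x"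
  and coord_in: "m \<in> chart_dom c \<Longrightarrow> coord c m \<in> chart_im c"
  and chart_inv_in: "x \<in> chart_im c \<Longrightarrow> chart_inv c x \<in> chart_dom c"
  using chart_homeomorphism unfolding homeomorphism_def by blast+

lemma coord_image_eq: "S \<subseteq> chart_dom c \<Longrightarrow> coord c ` S = chart_im c \<inter> chart_inv c -` S"
  using chart_inv_coord coord_chart_inv coord_in by (auto simp: image_iff) (metis subsetD)+

lemma open_coord_image:
  assumes "open S" "S \<subseteq> chart_dom c"
  shows "open (coord c ` S)"
  unfolding coord_image_eq[OF assms(2)]
  using chart_homeomorphism open_chart_im assms(1) continuous_on_open_vimage
  unfolding homeomorphism_def by (metis inf_commute)

end

context
  fixes c d assumes cd: "c \<in> A" "d \<in> A"
begin

definition "overlap = coord c ` (chart_dom c \<inter> chart_dom d)"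

lemma open_overlap: "open overlap"
  unfolding overlap_def using cd by (intro open_coord_image) (auto simp: open_chart_dom)

lemma coord_in_overlap: "m \<in> chart_dom c \<Longrightarrow> m \<in> chart_dom d \<Longrightarrow> coord c m \<in> overlap"
  unfolding overlap_def by blast

lemma transition_coord: "m \<in> chart_dom c \<Longrightarrow> transition c d (coord c m) = coord d m"
  by (simp add: transition_def chart_inv_coord[OF cd(1)])

lemma transition_smooth: "Ck_on k overlap (transition c d)"
  using atlas cd unfolding smooth_atlas_def smooth_on_def overlap_def by blast

lemma transition_has_derivative:
  assumes "x \<in> overlap"
  shows "(transition c d has_derivative (\<lambda>h. jacobian (transition c d) (at x) *v h)) (at x)"
proof -
  have "transition c d differentiable (at x)" using transition_smooth[of 1] assms by simp
  then show ?thesis by (simp add: jacobian_works)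
qed

lemma transition_derivative_eq:
  "x \<in> overlap \<Longrightarrow> frechet_derivative (transition c d) (at x) v = jacobian (transition c d) (at x) *v v"
  using frechet_derivative_eqI[OF transition_has_derivative] by simp

text \<open>The derivative of the Jacobian is the second derivative of the transition map, a
  symmetric bilinear map by the equality of mixed derivatives. The symmetry is what cancels the
  unwanted terms in the transformation of the Christoffel symbols.\<close>

lemma jacobian_derivative:
  assumes x: "x \<in> overlap"
  obtains D where "((\<lambda>x. jacobian (transition c d) (at x)) has_derivative D) (at x)"
    "\<And>v w. D v *v w = D w *v v"
proof -
  let ?J = "\<lambda>x. jacobian (transition c d) (at x)"
  have d: "(\<lambda>x. frechet_derivative (transition c d) (at x) v) differentiable (at x)" for v
    using transition_smooth[of 2] x by (simp add: numeral_2_eq_2)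
  have "?J differentiable (at x)"
    unfolding matrix_differentiable_componentwise
  proof (intro allI)
    fix i j
    obtain D where "((\<lambda>x. frechet_derivative (transition c d) (at x) (axis j 1)) has_derivative D) (at x)"
      using d unfolding differentiable_def by blast
    from bounded_linear.has_derivative[OF bounded_linear_vec_nth this, of i] show "(\<lambda>x. ?J x $ i $ j) differentiable (at x)"
      by (auto simp: jacobian_def matrix_def differentiable_def)
  qed
  then obtain D where D: "(?J has_derivative D) (at x)" by (auto simp: differentiable_def)
  have Dv: "((\<lambda>y. frechet_derivative (transition c d) (at y) v) has_derivative (\<lambda>w. D w *v v)) (at x)" for v
  proof (rule has_derivative_transform_within_open[OF _ open_overlap x])
    show "((\<lambda>y. ?J y *v v) has_derivative (\<lambda>w. D w *v v)) (at x)"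
      by (rule bounded_linear.has_derivative[OF
            bounded_bilinear.bounded_linear_left[OF bounded_bilinear_matrix_vector_mult] D])
  qed (simp add: transition_derivative_eq)
  have "D v *v w = D w *v v" for v w
  proof -
    have "(D v *v w) $ i = (D w *v v) $ i" for i
    proof -
      let ?f = "\<lambda>y. transition c d y $ i"
      have C2: "Ck_on 2 overlap ?f" by (rule Ck_on_nth[OF open_overlap transition_smooth])
      have f1: "frechet_derivative ?f (at y) v = frechet_derivative (transition c d) (at y) v $ i"
        if "y \<in> overlap" for y v
        using frechet_derivative_eqI[OF bounded_linear.has_derivative[OF bounded_linear_vec_nth
              transition_has_derivative[OF that]]] transition_derivative_eq[OF that] by simp
      have D2: "((\<lambda>y. frechet_derivative ?f (at y) v) has_derivative (\<lambda>w. (D w *v v) $ i)) (at x)" for v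
      proof (rule has_derivative_transform_within_open[OF _ open_overlap x])
        show "((\<lambda>y. frechet_derivative (transition c d) (at y) v $ i) has_derivative (\<lambda>w. (D w *v v) $ i)) (at x)"
          by (rule bounded_linear.has_derivative[OF bounded_linear_vec_nth Dv])
      qed (simp add: f1)
      show ?thesis
        using second_derivative_symmetric[OF C2 open_overlap x, of v w]
        by (simp add: frechet_derivative_eqI[OF D2])
    qed
    then show ?thesis by (simp add: vec_eq_iff)
  qed
  then show thesis using that D by blast
qed

end

abbreviation J where "J c d m \<equiv> jacobian (transition c d) (at (coord c m))"

lemma jacobian_chain:
  assumes cde: "c \<in> A" "d \<in> A" "e \<in> A" and m: "m \<in> chart_dom c" "m \<in> chart_dom d" "m \<in> chart_dom e"
  shows "J c e m = J d e m ** J c d m"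
proof -
  let ?W = "coord c ` (chart_dom c \<inter> chart_dom d \<inter> chart_dom e)"
  have W: "open ?W" "coord c m \<in> ?W"
    using cde m by (auto intro!: open_coord_image simp: open_chart_dom open_Int)
  have "(transition d e has_derivative (\<lambda>h. J d e m *v h)) (at (transition c d (coord c m)))"
    using transition_has_derivative[OF cde(2,3) coord_in_overlap[OF cde(2,3) m(2,3)]]
    by (simp add: transition_coord cde m)
  from has_derivative_compose[OF transition_has_derivative[OF cde(1,2) coord_in_overlap[OF cde(1,2) m(1,2)]] this]
  have "((\<lambda>x. transition d e (transition c d x)) has_derivative (\<lambda>h. (J d e m ** J c d m) *v h)) (at (coord c m))"
    by (simp add: matrix_vector_mul_assoc)
  then have "(transition c e has_derivative (\<lambda>h. (J d e m ** J c d m) *v h)) (at (coord c m))"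
    by (rule has_derivative_transform_within_open[OF _ W]) (auto simp: transition_coord cde)
  moreover have "(transition c e has_derivative (\<lambda>h. J c e m *v h)) (at (coord c m))"
    by (rule transition_has_derivative[OF cde(1,3) coord_in_overlap[OF cde(1,3) m(1,3)]])
  ultimately have "(\<lambda>h. (J d e m ** J c d m) *v h) = (\<lambda>h. J c e m *v h)"
    by (rule has_derivative_unique)
  then show ?thesis by (metis matrix_eq)
qed

lemma jacobian_self:
  assumes c: "c \<in> A" and m: "m \<in> chart_dom c"
  shows "J c c m = mat 1"
proof -
  have "(transition c c has_derivative (\<lambda>h. h)) (at (coord c m))"
    by (rule has_derivative_transform_within_open[OF has_derivative_ident open_chart_im[OF c] coord_in[OF c m]])
      (simp add: transition_def coord_chart_inv c)
  moreover have "(transition c c has_derivative (\<lambda>h. J c c m *v h)) (at (coord c m))"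
    by (rule transition_has_derivative[OF c c coord_in_overlap[OF c c m m]])
  ultimately have "(\<lambda>h. h) = (\<lambda>h. J c c m *v h)" by (rule has_derivative_unique)
  then show ?thesis by (metis matrix_eq matrix_vector_mul_lid)
qed

lemma jacobian_inverse:
  assumes "c \<in> A" "d \<in> A" "m \<in> chart_dom c" "m \<in> chart_dom d"
  shows "J d c m ** J c d m = mat 1" and "invertible (J c d m)"
proof -
  show 1: "J d c m ** J c d m = mat 1"
    using jacobian_chain[of c d c m] jacobian_self[of c m] assms by simp
  show "invertible (J c d m)" using 1 invertible_left_inverse by blast
qed

end

locale riemannian_metric = smooth_manifold A
  for A :: "('m::{t2_space,second_countable_topology}, 'n::finite) chart set" +
  fixes g :: "('m, 'n) tensor2"
  assumes metric: "C2_riemannian_metric A g"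
begin

lemma metric_C2: "c \<in> A \<Longrightarrow> Ck_on 2 (chart_im c) (local_metric g c)"
  using metric unfolding C2_riemannian_metric_def local_metric_def[abs_def] by blast

lemma metric_symmetric: "c \<in> A \<Longrightarrow> m \<in> chart_dom c \<Longrightarrow> transpose (g c m) = g c m"
  and metric_pos: "c \<in> A \<Longrightarrow> m \<in> chart_dom c \<Longrightarrow> v \<noteq> 0 \<Longrightarrow> v \<bullet> (g c m *v v) > 0"
  using metric unfolding C2_riemannian_metric_def by blast+

lemma metric_transform:
  "c \<in> A \<Longrightarrow> d \<in> A \<Longrightarrow> m \<in> chart_dom c \<Longrightarrow> m \<in> chart_dom d \<Longrightarrow>
    g c m = transpose (J c d m) ** g d m ** J c d m"
  using metric unfolding C2_riemannian_metric_def Let_def by blast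

lemma metric_invertible: "c \<in> A \<Longrightarrow> m \<in> chart_dom c \<Longrightarrow> invertible (g c m)"
  using metric_pos
  by (metis inner_zero_right invertible_left_inverse less_irrefl matrix_left_invertible_ker)

lemma local_metric_coord: "c \<in> A \<Longrightarrow> m \<in> chart_dom c \<Longrightarrow> local_metric g c (coord c m) = g c m"
  by (simp add: local_metric_def chart_inv_coord)

lemma local_metric_derivative:
  assumes "c \<in> A" "m \<in> chart_dom c"
  obtains D where "(local_metric g c has_derivative D) (at (coord c m))"
proof -
  have "local_metric g c differentiable (at (coord c m))"
    using metric_C2[of c] assms coord_in by (simp add: numeral_2_eq_2)
  then show thesis using that by (auto simp: differentiable_def)
qed

lemma partial_metric_eq:
  assumes D: "(local_metric g c has_derivative D) (at (coord c m))"
  shows "partial_metric g c m k i j = D (axis k 1) $ i $ j"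
proof -
  have "((\<lambda>x. local_metric g c x $ i $ j) has_derivative (\<lambda>h. D h $ i $ j)) (at (coord c m))"
    by (rule bounded_linear.has_derivative[OF
          bounded_linear_compose[OF bounded_linear_vec_nth bounded_linear_vec_nth] D])
  from frechet_derivative_eqI[OF this] show ?thesis
    by (simp add: partial_metric_def local_metric_def)
qed

context
  fixes c m D
  assumes c: "c \<in> A" and m: "m \<in> chart_dom c"
    and D: "(local_metric g c has_derivative D) (at (coord c m))"
begin

lemma metric_derivative_symmetric: "transpose (D w) = D w"
proof -
  have "((\<lambda>x. transpose (local_metric g c x)) has_derivative (\<lambda>w. transpose (D w))) (at (coord c m))"
    by (rule bounded_linear.has_derivative[OF bounded_linear_transpose D])
  then have "(local_metric g c has_derivative (\<lambda>w. transpose (D w))) (at (coord c m))"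
    by (rule has_derivative_transform_within_open[OF _ open_chart_im[OF c] coord_in[OF c m]])
      (simp add: local_metric_def metric_symmetric c chart_inv_in)
  with D have "D = (\<lambda>w. transpose (D w))" by (rule has_derivative_unique)
  then show ?thesis by metis
qed

text \<open>Koszul's formula for constant fields in a chart: multiplying by the metric removes its
  inverse from the Christoffel symbols. Index sums are handled here once, so that later arguments
  can use inner products.\<close>

lemma christoffel_lowered:
  "z \<bullet> (g c m *v (christoffel_matrix g c m w *v v)) =
   (1/2) * (z \<bullet> (D w *v v) + z \<bullet> (D v *v w) - w \<bullet> (D z *v v))"
proof -
  define p where "p k i j = D (axis k 1) $ i $ j" for k i j
  have lin: "linear D" by (rule has_derivative_linear[OF D])
  have Dp: "D w $ i $ j = (\<Sum>k\<in>UNIV. p k i j * w $ k)" for w i j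
    unfolding p_def by (rule linear_matrix_entry_expansion[OF lin])
  define u where "u = (\<chi> l. \<Sum>j\<in>UNIV. \<Sum>k\<in>UNIV. (p j l k + p k l j - p l j k) * w $ j * v $ k)"
  have "christoffel_matrix g c m w *v v = (1/2) *\<^sub>R (matrix_inv (g c m) *v u)"
  proof -
    have "(christoffel_matrix g c m w *v v) $ i = (1/2) * (\<Sum>l\<in>UNIV. matrix_inv (g c m) $ i $ l * u $ l)" for i
    proof -
      have "(christoffel_matrix g c m w *v v) $ i = 
        (\<Sum>j\<in>UNIV. \<Sum>k\<in>UNIV. \<Sum>l\<in>UNIV. (1/2) * (matrix_inv (g c m) $ i $ l * ((p j l k + p k l j - p l j k) * w $ j * v $ k)))"
        unfolding christoffel_matrix_vector christoffel_def partial_metric_eq[OF D] p_def[symmetric]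
        by (simp add: sum_distrib_left sum_distrib_right sum_divide_distrib mult_ac)
      also have "\<dots> = (\<Sum>j\<in>UNIV. \<Sum>l\<in>UNIV. \<Sum>k\<in>UNIV. (1/2) * (matrix_inv (g c m) $ i $ l * ((p j l k + p k l j - p l j k) * w $ j * v $ k)))"
        by (intro sum.cong refl sum.swap)
      also have "\<dots> = (\<Sum>l\<in>UNIV. \<Sum>j\<in>UNIV. \<Sum>k\<in>UNIV. (1/2) * (matrix_inv (g c m) $ i $ l * ((p j l k + p k l j - p l j k) * w $ j * v $ k)))"
        by (rule sum.swap)
      also have "\<dots> = (1/2) * (\<Sum>l\<in>UNIV. matrix_inv (g c m) $ i $ l * u $ l)"
        by (simp add: u_def sum_distrib_left)
      finally show ?thesis .
    qed
    then show ?thesis by (simp add: vec_eq_iff matrix_vector_mult_def)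
  qed
  then have "g c m *v (christoffel_matrix g c m w *v v) = (1/2) *\<^sub>R ((g c m ** matrix_inv (g c m)) *v u)"
    by (simp add: matrix_vector_mult_scaleR matrix_vector_mul_assoc)
  also have "\<dots> = (1/2) *\<^sub>R u" by (simp add: matrix_inv_right metric_invertible c m)
  finally have "z \<bullet> (g c m *v (christoffel_matrix g c m w *v v)) = (1/2) * (z \<bullet> u)" by simp
  also have "z \<bullet> u = (\<Sum>l\<in>UNIV. \<Sum>j\<in>UNIV. \<Sum>k\<in>UNIV. p j l k * w $ j * v $ k * z $ l) +
     (\<Sum>l\<in>UNIV. \<Sum>j\<in>UNIV. \<Sum>k\<in>UNIV. p k l j * w $ j * v $ k * z $ l) -
     (\<Sum>l\<in>UNIV. \<Sum>j\<in>UNIV. \<Sum>k\<in>UNIV. p l j k * w $ j * v $ k * z $ l)"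
    unfolding u_def inner_vec_def
    by (simp add: sum_distrib_left sum.distrib sum_subtractf algebra_simps)
  also have "(\<Sum>l\<in>UNIV. \<Sum>j\<in>UNIV. \<Sum>k\<in>UNIV. p j l k * w $ j * v $ k * z $ l) = z \<bullet> (D w *v v)"
  proof -
    have "z \<bullet> (D w *v v) = (\<Sum>l\<in>UNIV. \<Sum>k\<in>UNIV. \<Sum>j\<in>UNIV. p j l k * w $ j * v $ k * z $ l)"
      unfolding inner_vec_def matrix_vector_mult_def Dp
      by (simp add: sum_distrib_left sum_distrib_right mult_ac)
    also have "\<dots> = (\<Sum>l\<in>UNIV. \<Sum>j\<in>UNIV. \<Sum>k\<in>UNIV. p j l k * w $ j * v $ k * z $ l)"
      by (intro sum.cong refl sum.swap)
    finally show ?thesis ..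
  qed
  also have "(\<Sum>l\<in>UNIV. \<Sum>j\<in>UNIV. \<Sum>k\<in>UNIV. p k l j * w $ j * v $ k * z $ l) = z \<bullet> (D v *v w)"
    unfolding inner_vec_def matrix_vector_mult_def Dp
    by (simp add: sum_distrib_left sum_distrib_right mult_ac)
  also have "(\<Sum>l\<in>UNIV. \<Sum>j\<in>UNIV. \<Sum>k\<in>UNIV. p l j k * w $ j * v $ k * z $ l) = w \<bullet> (D z *v v)"
  proof -
    have "w \<bullet> (D z *v v) = (\<Sum>j\<in>UNIV. \<Sum>k\<in>UNIV. \<Sum>l\<in>UNIV. p l j k * w $ j * v $ k * z $ l)"
      unfolding inner_vec_def matrix_vector_mult_def Dp
      by (simp add: sum_distrib_left sum_distrib_right mult_ac)
    also have "\<dots> = (\<Sum>j\<in>UNIV. \<Sum>l\<in>UNIV. \<Sum>k\<in>UNIV. p l j k * w $ j * v $ k * z $ l)"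
      by (intro sum.cong refl sum.swap)
    also have "\<dots> = (\<Sum>l\<in>UNIV. \<Sum>j\<in>UNIV. \<Sum>k\<in>UNIV. p l j k * w $ j * v $ k * z $ l)"
      by (rule sum.swap)
    finally show ?thesis ..
  qed
  finally show ?thesis .
qed

lemma metric_derivative_inner: "z \<bullet> (D w *v v) = v \<bullet> (D w *v z)"
  by (metis inner_commute inner_transpose_left metric_derivative_symmetric)

lemma metric_inner_commute: "z \<bullet> (g c m *v v) = v \<bullet> (g c m *v z)"
  by (metis c m inner_commute inner_transpose_left metric_symmetric)

lemma metric_cancel: "(\<And>z. z \<bullet> (g c m *v a) = z \<bullet> (g c m *v b)) \<Longrightarrow> a = b"
  by (metis c m matrix_inv_left matrix_vector_mul_assoc matrix_vector_mul_lid metric_invertible vector_eq_ldot)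

text \<open>Torsion-freeness, read off from Koszul's formula.\<close>

lemma christoffel_matrix_commute:
  "christoffel_matrix g c m w *v v = christoffel_matrix g c m v *v w"
  by (rule metric_cancel) (simp add: christoffel_lowered metric_derivative_inner[of w _ v])

text \<open>Metric compatibility: in the sum of Koszul's formulas for (z, v) and (v, z) all terms
  but the derivative along w cancel.\<close>

lemma metric_derivative_christoffel:
  "D w = g c m ** christoffel_matrix g c m w + transpose (christoffel_matrix g c m w) ** g c m"
proof (rule matrix_eq_innerI)
  fix z v
  have "z \<bullet> ((transpose (christoffel_matrix g c m w) ** g c m) *v v) =
    z \<bullet> (transpose (christoffel_matrix g c m w) *v (g c m *v v))"
    by (simp only: matrix_vector_mul_assoc)
  also have "\<dots> = (christoffel_matrix g c m w *v z) \<bullet> (g c m *v v)"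
    by (rule inner_transpose_right)
  also have "\<dots> = v \<bullet> (g c m *v (christoffel_matrix g c m w *v z))"
    by (rule metric_inner_commute)
  finally have T: "z \<bullet> ((transpose (christoffel_matrix g c m w) ** g c m) *v v) =
    v \<bullet> (g c m *v (christoffel_matrix g c m w *v z))" .
  have "z \<bullet> (D w *v v) = z \<bullet> (g c m *v (christoffel_matrix g c m w *v v)) +
    v \<bullet> (g c m *v (christoffel_matrix g c m w *v z))"
    unfolding christoffel_lowered
    using metric_derivative_inner[of v w z] metric_derivative_inner[of v z w]
      metric_derivative_inner[of z v w] by (simp add: field_simps)
  then show "z \<bullet> (D w *v v) =
    z \<bullet> ((g c m ** christoffel_matrix g c m w + transpose (christoffel_matrix g c m w) ** g c m) *v v)"
    unfolding matrix_vector_mult_add_rdistrib inner_add_right T by (simp only: matrix_vector_mul_assoc)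
qed

end

end

section \<open>Transformation between charts and existence of geodesics\<close>

section \<open>Geodesics\<close>

lemma Ck_on_matrix_entry: "open S \<Longrightarrow> Ck_on k S M \<Longrightarrow> Ck_on k S (\<lambda>x. M x $ i $ j)"
  for M :: "'a::real_normed_vector \<Rightarrow> real ^ 'n ^ 'm"
  by (rule Ck_on_bounded_linear[OF _ bounded_linear_compose[OF bounded_linear_vec_nth bounded_linear_vec_nth]])

lemma continuous_on_matrix_mult:
  fixes M :: "'a::topological_space \<Rightarrow> real ^ 'n ^ 'm" and N :: "'a \<Rightarrow> real ^ 'p ^ 'n"
  shows "continuous_on S M \<Longrightarrow> continuous_on S N \<Longrightarrow> continuous_on S (\<lambda>x. M x ** N x)"
  by (rule bounded_bilinear.continuous_on[OF bounded_bilinear_matrix_mult])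

lemma Ck_on_matrix_inv:
  fixes M :: "'a::euclidean_space \<Rightarrow> real ^ 'n ^ 'n"
  assumes S: "open S" and M: "Ck_on 1 S M" and inv: "\<And>x. x \<in> S \<Longrightarrow> invertible (M x)"
  shows "Ck_on 1 S (\<lambda>x. matrix_inv (M x))"
proof -
  have d: "((\<lambda>x. matrix_inv (M x)) has_derivative
      (\<lambda>h. - (matrix_inv (M x) ** frechet_derivative M (at x) h ** matrix_inv (M x)))) (at x)"
    if "x \<in> S" for x
    using that M inv by (intro has_derivative_matrix_inv) (auto simp: frechet_derivative_works)
  have c: "continuous_on S (\<lambda>x. matrix_inv (M x))"
    by (rule has_derivative_continuous_on) (rule has_derivative_at_withinI[OF d])
  have "continuous_on S (\<lambda>x. - (matrix_inv (M x) ** frechet_derivative M (at x) h ** matrix_inv (M x)))" for h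
    using M by (intro continuous_on_minus continuous_on_matrix_mult c) auto
  then have "continuous_on S (\<lambda>x. frechet_derivative (\<lambda>x. matrix_inv (M x)) (at x) h)" for h
    by (rule continuous_on_eq) (simp add: frechet_derivative_eqI[OF d])
  moreover have "(\<lambda>x. matrix_inv (M x)) differentiable (at x)" if "x \<in> S" for x
    using d[OF that] by (auto simp: differentiable_def)
  ultimately show ?thesis by simp
qed

context riemannian_metric
begin

lemma metric_derivative_transform:
  assumes c: "c \<in> A" "m \<in> chart_dom c" and d: "d \<in> A" "m \<in> chart_dom d"
    and Dc: "(local_metric g c has_derivative Dc) (at (coord c m))"
    and Dd: "(local_metric g d has_derivative Dd) (at (coord d m))"
    and DJ: "((\<lambda>x. jacobian (transition c d) (at x)) has_derivative DJ) (at (coord c m))"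
  shows "Dc w = transpose (DJ w) ** g d m ** J c d m + transpose (J c d m) ** Dd (J c d m *v w) ** J c d m +
    transpose (J c d m) ** g d m ** DJ w"
proof -
  let ?W = "overlap c d" and ?\<tau> = "transition c d" and ?J = "\<lambda>x. jacobian (transition c d) (at x)"
  have W: "coord c m \<in> ?W" by (rule coord_in_overlap[OF c(1) d(1) c(2) d(2)])
  have tc: "?\<tau> (coord c m) = coord d m" by (rule transition_coord[OF c(1) d(1) c(2)])
  have Dd': "((\<lambda>x. local_metric g d (?\<tau> x)) has_derivative (\<lambda>w. Dd (J c d m *v w))) (at (coord c m))"
    using has_derivative_compose[OF transition_has_derivative[OF c(1) d(1) W]] Dd unfolding tc by blast
  have JT: "((\<lambda>x. transpose (?J x)) has_derivative (\<lambda>w. transpose (DJ w))) (at (coord c m))"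
    by (rule bounded_linear.has_derivative[OF bounded_linear_transpose DJ])
  have "((\<lambda>x. transpose (?J x) ** local_metric g d (?\<tau> x) ** ?J x) has_derivative
     (\<lambda>w. (transpose (J c d m) ** local_metric g d (?\<tau> (coord c m))) ** DJ w +
       (transpose (J c d m) ** Dd (J c d m *v w) + transpose (DJ w) ** local_metric g d (?\<tau> (coord c m))) ** J c d m))
     (at (coord c m))"
    by (rule matrix_mult_FDERIV[OF matrix_mult_FDERIV[OF JT Dd'] DJ])
  then have "(local_metric g c has_derivative
     (\<lambda>w. (transpose (J c d m) ** local_metric g d (?\<tau> (coord c m))) ** DJ w +
       (transpose (J c d m) ** Dd (J c d m *v w) + transpose (DJ w) ** local_metric g d (?\<tau> (coord c m))) ** J c d m))
     (at (coord c m))"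
  proof (rule has_derivative_transform_within_open[OF _ open_overlap[OF c(1) d(1)] W])
    fix x assume "x \<in> ?W"
    then obtain m' where m': "m' \<in> chart_dom c" "m' \<in> chart_dom d" "x = coord c m'"
      unfolding overlap_def[OF c(1) d(1)] by blast
    then show "transpose (?J x) ** local_metric g d (?\<tau> x) ** ?J x = local_metric g c x"
      using c d by (simp add: transition_coord local_metric_coord metric_transform[of c d m'])
  qed
  with Dc have "Dc = (\<lambda>w. (transpose (J c d m) ** local_metric g d (?\<tau> (coord c m))) ** DJ w +
       (transpose (J c d m) ** Dd (J c d m *v w) + transpose (DJ w) ** local_metric g d (?\<tau> (coord c m))) ** J c d m)"
    by (rule has_derivative_unique)
  then show ?thesis using c d by (simp add: tc local_metric_coord matrix_add_rdistrib')
qed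

text \<open>The geodesic equation is quadratic in the velocity, so equal arguments v are what is
  required. After pairing with \<open>J c d m *v z\<close>, Koszul's formula and the product rule
  leave two terms that contain the derivative of the Jacobian applied to z; they cancel by
  \<open>sym\<close> and the symmetry of g.\<close>

lemma christoffel_transform:
  assumes c: "c \<in> A" "m \<in> chart_dom c" and d: "d \<in> A" "m \<in> chart_dom d"
    and DJ: "((\<lambda>x. jacobian (transition c d) (at x)) has_derivative DJ) (at (coord c m))"
    and sym: "\<And>v w. DJ v *v w = DJ w *v v"
  shows "J c d m *v (christoffel_matrix g c m v *v v) =
    DJ v *v v + christoffel_matrix g d m (J c d m *v v) *v (J c d m *v v)"
proof -
  let ?J = "J c d m" and ?w = "J c d m *v v"
  obtain Dc where Dc: "(local_metric g c has_derivative Dc) (at (coord c m))"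
    using local_metric_derivative[OF c] .
  obtain Dd where Dd: "(local_metric g d has_derivative Dd) (at (coord d m))"
    using local_metric_derivative[OF d] .
  note tr = metric_derivative_transform[OF c d Dc Dd DJ]
  have T: "a \<bullet> (Dc b *v e) = (DJ b *v a) \<bullet> (g d m *v (?J *v e)) + (?J *v a) \<bullet> (Dd (?J *v b) *v (?J *v e)) +
      (?J *v a) \<bullet> (g d m *v (DJ b *v e))" for a b e
    unfolding tr
    by (simp only: matrix_vector_mult_add_rdistrib inner_add_right inner_transpose_right
        flip: matrix_vector_mul_assoc)
  have eq: "(?J *v z) \<bullet> (g d m *v (?J *v (christoffel_matrix g c m v *v v))) =
      (?J *v z) \<bullet> (g d m *v (DJ v *v v + christoffel_matrix g d m ?w *v ?w))" for z
  proof -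
    have "(?J *v z) \<bullet> (g d m *v (?J *v (christoffel_matrix g c m v *v v))) =
       z \<bullet> (g c m *v (christoffel_matrix g c m v *v v))"
      unfolding metric_transform[OF c(1) d(1) c(2) d(2)]
      by (simp only: inner_transpose_right flip: matrix_vector_mul_assoc)
    also have "\<dots> = z \<bullet> (Dc v *v v) - (1/2) * (v \<bullet> (Dc z *v v))"
      by (simp add: christoffel_lowered[OF c Dc])
    also have "\<dots> = (?J *v z) \<bullet> (Dd ?w *v ?w) - (1/2) * (?w \<bullet> (Dd (?J *v z) *v ?w)) +
        (?J *v z) \<bullet> (g d m *v (DJ v *v v))"
      unfolding T sym[of z v] using metric_inner_commute[OF d Dd, of ?w "DJ v *v z"]
      by (simp add: field_simps)
    also have "\<dots> = (?J *v z) \<bullet> (g d m *v (christoffel_matrix g d m ?w *v ?w)) +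
        (?J *v z) \<bullet> (g d m *v (DJ v *v v))"
      by (simp add: christoffel_lowered[OF d Dd])
    finally show ?thesis by (simp add: matrix_vector_right_distrib inner_add_right)
  qed
  show ?thesis
  proof (rule metric_cancel[OF d Dd])
    fix z
    have "z = ?J *v (matrix_inv ?J *v z)"
      by (simp add: matrix_vector_mul_assoc matrix_inv_right jacobian_inverse(2) c d)
    then show "z \<bullet> (g d m *v (?J *v (christoffel_matrix g c m v *v v))) =
      z \<bullet> (g d m *v (DJ v *v v + christoffel_matrix g d m ?w *v ?w))"
      using eq by metis
  qed
qed

text \<open>The equation is solved in the chart c but demanded in every chart d. There the velocity
  is the Jacobian times v, and the derivative of the Jacobian along the curve is exactly the
  inhomogeneous term in the transformation of the Christoffel symbols.\<close>

lemma geodesic_of_chart_solution: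
  assumes c: "c \<in> A" and a: "0 < a"
    and y: "\<And>t. \<bar>t\<bar> < a \<Longrightarrow> y t \<in> chart_im c"
    and v0: "\<And>t. \<bar>t\<bar> < a \<Longrightarrow> v t \<noteq> 0"
    and dy: "\<And>t. \<bar>t\<bar> < a \<Longrightarrow> (y has_vector_derivative v t) (at t)"
    and dv: "\<And>t. \<bar>t\<bar> < a \<Longrightarrow>
      (v has_vector_derivative - (christoffel_matrix g c (chart_inv c (y t)) (v t) *v v t)) (at t)"
  shows "geodesic A g {-a<..<a} (\<lambda>t. chart_inv c (y t))"
  unfolding geodesic_def
proof (intro conjI ballI)
  let ?T = "{-a<..<a}" and ?\<gamma> = "\<lambda>t. chart_inv c (y t)"
  show "open_interval ?T"
    using a by (auto simp: open_interval_def is_interval_oo)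
  have cy: "continuous_on ?T y"
    by (rule continuous_at_imp_continuous_on) (auto intro!: has_vector_derivative_continuous[OF dy])
  show cg: "continuous_on ?T ?\<gamma>"
    using chart_homeomorphism[OF c] y
    by (intro continuous_on_compose2[OF _ cy]) (auto simp: homeomorphism_def)
  fix d assume d: "d \<in> A"
  let ?J = "\<lambda>x. jacobian (transition c d) (at x)"
  show "\<exists>v. \<forall>t\<in>?T. ?\<gamma> t \<in> chart_dom d \<longrightarrow> v t \<noteq> 0 \<and>
      ((\<lambda>s. coord d (?\<gamma> s)) has_vector_derivative v t) (at t) \<and>
      (v has_vector_derivative
         (\<chi> i. - (\<Sum>j\<in>UNIV. \<Sum>k\<in>UNIV. christoffel g d (?\<gamma> t) i j k * v t $ j * v t $ k))) (at t)"
  proof (intro exI[of _ "\<lambda>t. ?J (y t) *v v t"] ballI impI)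
    fix t assume t: "t \<in> ?T" and in_d: "?\<gamma> t \<in> chart_dom d"
    let ?m = "?\<gamma> t"
    have t': "\<bar>t\<bar> < a" using t by auto
    have m: "?m \<in> chart_dom c" by (rule chart_inv_in[OF c y[OF t']])
    have yt: "coord c ?m = y t" by (rule coord_chart_inv[OF c y[OF t']])
    have ov: "y t \<in> overlap c d" using coord_in_overlap[OF c d m in_d] yt by simp
    have nz: "?J (y t) *v v t \<noteq> 0"
    proof
      assume "?J (y t) *v v t = 0"
      then have "matrix_inv (J c d ?m) *v (J c d ?m *v v t) = 0" by (simp add: yt)
      then show False
        using v0[OF t'] by (simp add: matrix_vector_mul_assoc matrix_inv_left jacobian_inverse(2) c d m in_d)
    qed
    have dtau: "((\<lambda>s. transition c d (y s)) has_vector_derivative ?J (y t) *v v t) (at t)"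
      using has_derivative_compose[OF dy[OF t', unfolded has_vector_derivative_def] transition_has_derivative[OF c d ov]]
      unfolding has_vector_derivative_def by (simp add: matrix_vector_mult_scaleR)
    have d1: "((\<lambda>s. coord d (?\<gamma> s)) has_vector_derivative ?J (y t) *v v t) (at t)"
    proof (rule has_vector_derivative_transform_within_open[OF dtau _ t])
      show "transition c d (y s) = coord d (chart_inv c (y s))" for s
        by (simp add: transition_def)
    qed simp
    obtain DJ where DJ: "(?J has_derivative DJ) (at (y t))" and sym: "\<And>v w. DJ v *v w = DJ w *v v"
      using jacobian_derivative[OF c d ov] by blast
    have "((\<lambda>s. ?J (y s)) has_vector_derivative DJ (v t)) (at t)"
      using has_derivative_compose[OF dy[OF t', unfolded has_vector_derivative_def] DJ]
        linear_cmul[OF has_derivative_linear[OF DJ]]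
      unfolding has_vector_derivative_def by simp
    from bounded_bilinear.has_vector_derivative[OF bounded_bilinear_matrix_vector_mult this dv[OF t']]
    have "((\<lambda>s. ?J (y s) *v v s) has_vector_derivative
        ?J (y t) *v (- (christoffel_matrix g c ?m (v t) *v v t)) + DJ (v t) *v v t) (at t)" .
    moreover have "?J (y t) *v (- (christoffel_matrix g c ?m (v t) *v v t)) + DJ (v t) *v v t =
        - (christoffel_matrix g d ?m (?J (y t) *v v t) *v (?J (y t) *v v t))"
      using christoffel_transform[OF c m d in_d, unfolded yt, OF DJ sym, of "v t"]
      by (simp add: bounded_bilinear.minus_right[OF bounded_bilinear_matrix_vector_mult])
    moreover have "(\<chi> i. - (\<Sum>j\<in>UNIV. \<Sum>k\<in>UNIV. christoffel g d ?m i j k * w $ j * w $ k)) =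
        - (christoffel_matrix g d ?m w *v w)" for w
      by (simp add: christoffel_matrix_vector vec_eq_iff)
    ultimately show "?J (y t) *v v t \<noteq> 0 \<and>
      ((\<lambda>s. coord d (?\<gamma> s)) has_vector_derivative ?J (y t) *v v t) (at t) \<and>
      ((\<lambda>t. ?J (y t) *v v t) has_vector_derivative
         (\<chi> i. - (\<Sum>j\<in>UNIV. \<Sum>k\<in>UNIV. christoffel g d ?m i j k * (?J (y t) *v v t) $ j * (?J (y t) *v v t) $ k))) (at t)"
      using nz d1 by simp
  qed
qed

text \<open>Here second derivatives of the metric are put to use: the Christoffel symbols are built
  from C^1 functions and therefore Lipschitz on closed balls.\<close>

lemma christoffel_bounded_lipschitz:
  assumes c: "c \<in> A" and r: "cball x0 r \<subseteq> chart_im c"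
  shows "bounded_lipschitz (cball x0 r) (\<lambda>x. christoffel g c (chart_inv c x) i j k)"
proof -
  let ?U = "chart_im c"
  have U: "open ?U" by (rule open_chart_im[OF c])
  have lip: "bounded_lipschitz (cball x0 r) f" if "Ck_on 1 ?U f" for f
    by (rule bounded_lipschitz_C1[OF that _ _ r]) auto
  have "Ck_on 1 ?U (local_metric g c)" using metric_C2[OF c]
    by (auto simp: numeral_2_eq_2 differentiable_imp_continuous_on differentiable_on_def
        differentiable_at_withinI)
  then have "Ck_on 1 ?U (\<lambda>x. matrix_inv (local_metric g c x))"
    by (rule Ck_on_matrix_inv[OF U]) (simp add: local_metric_def metric_invertible[OF c chart_inv_in[OF c]])
  then have inv: "bounded_lipschitz (cball x0 r) (\<lambda>x. matrix_inv (local_metric g c x) $ i $ j)" for i j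
    using Ck_on_matrix_entry[OF U] lip by blast
  have partial: "bounded_lipschitz (cball x0 r) (\<lambda>x. partial_metric g c (chart_inv c x) k i j)" for i j k
  proof -
    have "Ck_on 2 ?U (\<lambda>x. local_metric g c x $ i $ j)" by (rule Ck_on_matrix_entry[OF U metric_C2[OF c]])
    then have "Ck_on 1 ?U (\<lambda>x. frechet_derivative (\<lambda>x. local_metric g c x $ i $ j) (at x) (axis k 1))"
      by (simp add: numeral_2_eq_2)
    then have "Ck_on 1 ?U (\<lambda>x. partial_metric g c (chart_inv c x) k i j)"
      by (rule Ck_on_cong[OF U, rotated]) (simp add: partial_metric_def local_metric_def coord_chart_inv[OF c])
    then show ?thesis by (rule lip)
  qed
  show ?thesis
    unfolding christoffel_def
    using inv unfolding local_metric_def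
    by (intro bounded_lipschitz_mult bounded_lipschitz_const bounded_lipschitz_sum bounded_lipschitz_add
        bounded_lipschitz_diff partial) auto
qed

lemma geodesic_exists:
  assumes c: "c \<in> A" and m: "m \<in> chart_dom c" and v0: "v0 \<noteq> 0"
  obtains a y v where "0 < a" "geodesic A g {-a<..<a} (\<lambda>t. chart_inv c (y t))"
    "\<And>t. \<bar>t\<bar> < a \<Longrightarrow> y t \<in> chart_im c"
    "y 0 = coord c m" "v 0 = v0" "\<And>t. \<bar>t\<bar> < a \<Longrightarrow> (y has_vector_derivative v t) (at t)"
    "(v has_vector_derivative - (christoffel_matrix g c m v0 *v v0)) (at 0)"
proof -
  have ev: "(\<chi> i. - (\<Sum>j\<in>UNIV. \<Sum>k\<in>UNIV. christoffel g c m i j k * w $ j * w $ k)) =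
        - (christoffel_matrix g c m w *v w)" for w m
    by (simp add: christoffel_matrix_vector vec_eq_iff)
  obtain a y v where a: "0 < a" and y0: "y 0 = coord c m" and v: "v 0 = v0" and
    sol: "\<And>t. \<bar>t\<bar> < a \<Longrightarrow> y t \<in> chart_im c \<and> (y has_vector_derivative v t) (at t) \<and>
      (v has_vector_derivative (\<chi> i. - (\<Sum>j\<in>UNIV. \<Sum>k\<in>UNIV. christoffel g c (chart_inv c (y t)) i j k * v t $ j * v t $ k))) (at t)"
  proof (rule geodesic_ode_solution[OF open_chart_im[OF c] coord_in[OF c m],
        of "\<lambda>i j k x. christoffel g c (chart_inv c x) i j k" v0])
    show "bounded_lipschitz (cball (coord c m) r) (\<lambda>x. christoffel g c (chart_inv c x) i j k)"
      if "cball (coord c m) r \<subseteq> chart_im c" for i j k r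
      by (rule christoffel_bounded_lipschitz[OF c that])
  qed (rule that, blast+)
  \<comment> \<open>A geodesic must have nonzero velocity at all times, so the interval is shrunk
    until continuity guarantees this.\<close>
  have "isCont v 0" using sol[of 0] a has_vector_derivative_continuous by auto
  then have "\<forall>\<^sub>F t in at 0. v t \<noteq> 0" using v v0 by (simp add: continuous_within tendsto_imp_eventually_ne)
  then obtain e where e: "e > 0" "\<And>t. t \<noteq> 0 \<Longrightarrow> dist t 0 < e \<Longrightarrow> v t \<noteq> 0"
    unfolding eventually_at by blast
  define b where "b = min a e"
  have b: "0 < b" and ba: "\<And>t. \<bar>t\<bar> < b \<Longrightarrow> \<bar>t\<bar> < a" using a e by (auto simp: b_def)
  have nz: "v t \<noteq> 0" if "\<bar>t\<bar> < b" for t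
    using e(2)[of t] that v v0 by (cases "t = 0") (auto simp: b_def)
  have dv: "(v has_vector_derivative - (christoffel_matrix g c (chart_inv c (y t)) (v t) *v v t)) (at t)"
    if "\<bar>t\<bar> < b" for t
    using sol[OF ba[OF that]] by (simp add: ev)
  have dv0: "(v has_vector_derivative - (christoffel_matrix g c m v0 *v v0)) (at 0)"
    using dv[of 0] b by (simp add: y0 v chart_inv_coord[OF c m])
  have dy: "(y has_vector_derivative v t) (at t)" and yi: "y t \<in> chart_im c" if "\<bar>t\<bar> < b" for t
    using sol[OF ba[OF that]] by blast+
  show thesis
    by (rule that[OF b geodesic_of_chart_solution[OF c b yi nz dy dv] yi y0 v dy dv0])
qed

end

section \<open>From common unparameterized geodesics to the relation between the connections\<close>

section \<open>Projectively equivalent connections\<close>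

definition outer :: "real ^ 'n \<Rightarrow> real ^ 'n \<Rightarrow> real ^ 'n ^ 'n" where
  "outer a b = (\<chi> i j. a $ i * b $ j)"

lemma outer_mult_vector: "outer a b *v v = (b \<bullet> v) *\<^sub>R a"
  by (simp add: outer_def matrix_vector_mult_def vec_eq_iff inner_vec_def sum_distrib_left sum_distrib_right mult_ac)

lemma trace_outer: "trace (outer a b) = a \<bullet> b"
  by (simp add: outer_def trace_def inner_vec_def)

lemma matrix_mult_outer: "M ** outer a b = outer (M *v a) b"
  by (simp add: outer_def matrix_matrix_mult_def matrix_vector_mult_def vec_eq_iff sum_distrib_left sum_distrib_right mult_ac)

lemma outer_mult_matrix: "outer a b ** M = outer a (transpose M *v b)"
  by (simp add: outer_def matrix_matrix_mult_def matrix_vector_mult_def vec_eq_iff sum_distrib_left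
      transpose_def mult_ac)

lemma transpose_outer: "transpose (outer a b) = outer b a"
  by (simp add: outer_def transpose_def vec_eq_iff mult.commute)

lemma outer_scaleR: "outer (k *\<^sub>R a) b = k *\<^sub>R outer a b" "outer a (k *\<^sub>R b) = k *\<^sub>R outer a b"
  by (simp_all add: outer_def vec_eq_iff)

lemma transpose_add: "transpose (M + N) = transpose M + transpose N" for M N :: "real ^ 'n ^ 'm"
  by (simp add: transpose_def vec_eq_iff)

lemmas matrix_algebra =
  matrix_add_ldistrib matrix_add_rdistrib'
  bounded_bilinear.diff_left[OF bounded_bilinear_matrix_mult]
  bounded_bilinear.diff_right[OF bounded_bilinear_matrix_mult]
  bounded_bilinear.scaleR_left[OF bounded_bilinear_matrix_mult]
  bounded_bilinear.scaleR_right[OF bounded_bilinear_matrix_mult]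
  matrix_mult_minus

lemma matrix_inv_cancel:
  fixes M :: "real ^ 'n ^ 'n"
  assumes "invertible M"
  shows "N ** M ** matrix_inv M = N" "N ** matrix_inv M ** M = N"
  using assms by (simp_all add: matrix_inv_left matrix_inv_right flip: matrix_mul_assoc)

text \<open>The segment from the identity to M consists of positive definite, hence invertible,
  matrices; the determinant is 1 at its start and cannot change sign along it.\<close>

lemma positive_definite_det_pos:
  fixes M :: "real ^ 'n ^ 'n"
  assumes pos: "\<And>v. v \<noteq> 0 \<Longrightarrow> v \<bullet> (M *v v) > 0"
  shows "det M > 0"
proof (rule ccontr)
  assume neg: "\<not> det M > 0"
  define f where "f t = det ((1 - t) *\<^sub>R mat 1 + t *\<^sub>R M)" for t
  have "continuous_on {0..1} f"
    unfolding f_def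
  proof (rule continuous_on_compose2[of UNIV det])
    show "continuous_on UNIV (det :: real ^ 'n ^ 'n \<Rightarrow> real)"
      by (simp add: continuous_at_det continuous_at_imp_continuous_on)
  qed (intro continuous_intros, simp)
  moreover have "f 1 \<le> 0" "0 \<le> f 0" using neg by (simp_all add: f_def)
  ultimately obtain t where t: "0 \<le> t" "t \<le> 1" "f t = 0"
    using IVT2'[of f 1 0 0] by auto
  have "v = 0" if "((1 - t) *\<^sub>R mat 1 + t *\<^sub>R M) *v v = 0" for v
  proof (rule ccontr)
    assume v: "v \<noteq> 0"
    have "0 = v \<bullet> (((1 - t) *\<^sub>R mat 1 + t *\<^sub>R M) *v v)" using that by simp
    also have "\<dots> = (1 - t) * (v \<bullet> v) + t * (v \<bullet> (M *v v))"
      by (simp add: matrix_vector_mult_add_rdistrib inner_add_right flip: scaleR_matrix_vector_assoc)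
    also have "\<dots> > 0"
    proof (cases "t = 0")
      case True
      then show ?thesis using v by simp
    next
      case False
      then show ?thesis using t pos[OF v] by (intro add_nonneg_pos) auto
    qed
    finally show False by simp
  qed
  then have "invertible ((1 - t) *\<^sub>R mat 1 + t *\<^sub>R M)"
    by (metis invertible_left_inverse matrix_left_invertible_ker)
  then show False using t(3) by (simp add: f_def invertible_det_nz)
qed

text \<open>The parallelogram identity makes the proportionality factor \<open>\<alpha>\<close> additive.\<close>

lemma parallel_symmetric_bilinear:
  fixes T :: "real ^ 'n \<Rightarrow> real ^ 'n \<Rightarrow> real ^ 'n"
  assumes lin: "\<And>w. linear (T w)" and sym: "\<And>v w. T v w = T w v"
    and par: "\<And>v. \<exists>\<alpha>. T v v = \<alpha> *\<^sub>R v"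
  obtains \<phi> where "\<And>w v. T w v = (\<phi> \<bullet> w) *\<^sub>R v + (\<phi> \<bullet> v) *\<^sub>R w"
proof -
  note add = linear_add[OF lin] linear_diff[OF lin] linear_cmul[OF lin]
  have add': "T (a + b) v = T a v + T b v" "T (a - b) v = T a v - T b v" "T (k *\<^sub>R a) v = k *\<^sub>R T a v" for a b v k
    using add sym by metis+
  \<comment> \<open>The factor is not determined at v = 0; the value 0 there is the one compatible
    with linearity.\<close>
  define \<alpha> where "\<alpha> v = (if v = 0 then 0 else SOME a. T v v = a *\<^sub>R v)" for v
  have \<alpha>: "T v v = \<alpha> v *\<^sub>R v" for v
  proof (cases "v = 0")
    case True
    then show ?thesis using add(3)[of 0 0 0] by (simp add: \<alpha>_def)
  next
    case False
    then show ?thesis using someI_ex[OF par[of v]] by (simp add: \<alpha>_def)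
  qed
  have \<alpha>0: "\<alpha> 0 = 0" by (simp add: \<alpha>_def)
  have uniq: "\<alpha> v = a" if "T v v = a *\<^sub>R v" "v \<noteq> 0" for v a using that \<alpha>[of v] by simp
  have hom: "\<alpha> (k *\<^sub>R v) = k * \<alpha> v" for k v
  proof (cases "k = 0 \<or> v = 0")
    case False
    then show ?thesis by (intro uniq) (auto simp: add add' \<alpha>[of v] mult.commute)
  qed (auto simp: \<alpha>0)
  have addit: "\<alpha> (v + w) = \<alpha> v + \<alpha> w" for v w
  proof (cases "\<exists>k. w = k *\<^sub>R v")
    case True
    then obtain k where "w = k *\<^sub>R v" by blast
    then have "v + w = (1 + k) *\<^sub>R v" by (simp add: scaleR_left_distrib)
    then show ?thesis using \<open>w = k *\<^sub>R v\<close> by (simp add: hom distrib_right)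
  next
    case nk: False
    show ?thesis
    proof (cases "v = 0")
      case v: False
      have indep: "a = 0 \<and> b = 0" if "a *\<^sub>R v + b *\<^sub>R w = 0" for a b
      proof -
        have "b = 0"
        proof (rule ccontr)
          assume b: "b \<noteq> 0"
          have "b *\<^sub>R w = - (a *\<^sub>R v)" using that by (simp add: eq_neg_iff_add_eq_0 add.commute)
          then have "(1 / b) *\<^sub>R (b *\<^sub>R w) = (1 / b) *\<^sub>R (- (a *\<^sub>R v))" by simp
          then have "w = (- a / b) *\<^sub>R v" using b by simp
          then show False using nk by blast
        qed
        then show ?thesis using that v by simp
      qed
      have "T (v + w) (v + w) + T (v - w) (v - w) = 2 *\<^sub>R T v v + 2 *\<^sub>R T w w"
        by (simp add: add add' scaleR_2)
      then have "\<alpha> (v + w) *\<^sub>R (v + w) + \<alpha> (v - w) *\<^sub>R (v - w) = 2 *\<^sub>R \<alpha> v *\<^sub>R v + 2 *\<^sub>R \<alpha> w *\<^sub>R w"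
        by (simp only: \<alpha>)
      then have "(\<alpha> (v + w) + \<alpha> (v - w) - 2 * \<alpha> v) *\<^sub>R v + (\<alpha> (v + w) - \<alpha> (v - w) - 2 * \<alpha> w) *\<^sub>R w = 0"
        by (simp add: algebra_simps)
      from indep[OF this] show ?thesis by simp
    qed (simp add: \<alpha>0)
  qed
  have "linear \<alpha>" by (rule linearI) (simp_all add: addit hom)
  \<comment> \<open>Halved because polarization gives 2 T(w, v) = \<alpha>(w) v + \<alpha>(v)
    w.\<close>
  define \<phi> where "\<phi> = (\<chi> i. \<alpha> (axis i 1) / 2)"
  have \<phi>: "\<alpha> v = 2 * (\<phi> \<bullet> v)" for v
  proof -
    have "\<alpha> v = \<alpha> (\<Sum>k\<in>UNIV. v $ k *\<^sub>R axis k 1)"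
      by (simp add: basis_expansion flip: scalar_mult_eq_scaleR)
    also have "\<dots> = (\<Sum>k\<in>UNIV. v $ k * \<alpha> (axis k 1))"
      by (simp add: linear_sum[OF \<open>linear \<alpha>\<close>] hom)
    also have "\<dots> = 2 * (\<phi> \<bullet> v)" by (simp add: \<phi>_def inner_vec_def sum_distrib_left mult.commute)
    finally show ?thesis .
  qed
  show thesis
  proof (rule that)
    fix w v
    have "2 *\<^sub>R T w v = T (v + w) (v + w) - T v v - T w w"
      using sym[of v w] by (simp add: add add' scaleR_2)
    also have "\<dots> = \<alpha> w *\<^sub>R v + \<alpha> v *\<^sub>R w" by (simp add: \<alpha> addit algebra_simps)
    finally have "(1/2) *\<^sub>R (2 *\<^sub>R T w v) = (1/2) *\<^sub>R (\<alpha> w *\<^sub>R v + \<alpha> v *\<^sub>R w)" by simp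
    then show "T w v = (\<phi> \<bullet> w) *\<^sub>R v + (\<phi> \<bullet> v) *\<^sub>R w" by (simp add: \<phi> scaleR_right_distrib)
  qed
qed

lemma linear_christoffel_matrix: "linear (christoffel_matrix g c m)"
  by (rule linearI)
    (simp_all add: christoffel_matrix_def vec_eq_iff distrib_left sum.distrib sum_distrib_left mult_ac)

locale equivalent_metrics = g: riemannian_metric A g + gb: riemannian_metric A gb
  for A :: "('m::{t2_space,second_countable_topology}, 'n::finite) chart set" and g gb +
  assumes equivalent: "geodesically_equivalent A g gb"
begin

text \<open>The velocities satisfy v = \<phi>' w(\<phi>) on a whole interval, so the relation can be
  differentiated at 0. Since the Christoffel terms are quadratic, the factor \<phi>'^2 turns w into
  v, and only the summand with \<phi>'' remains; it is parallel to the velocity.\<close>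

lemma christoffel_difference_parallel:
  assumes c: "c \<in> A" and m: "m \<in> chart_dom c"
  shows "\<exists>\<alpha>. (christoffel_matrix gb c m v0 - christoffel_matrix g c m v0) *v v0 = \<alpha> *\<^sub>R v0"
proof (cases "v0 = 0")
  case False
  obtain a y v where a: "0 < a" and geo: "geodesic A g {-a<..<a} (\<lambda>t. chart_inv c (y t))"
    and yi: "\<And>t. \<bar>t\<bar> < a \<Longrightarrow> y t \<in> chart_im c"
    and y0: "y 0 = coord c m" and v0: "v 0 = v0"
    and dy: "\<And>t. \<bar>t\<bar> < a \<Longrightarrow> (y has_vector_derivative v t) (at t)"
    and dv: "(v has_vector_derivative - (christoffel_matrix g c m v0 *v v0)) (at 0)"
    by (rule g.geodesic_exists[OF c m False]) (rule that)
  let ?T = "{-a<..<a}"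
  obtain T' \<gamma>' where geo': "geodesic A gb T' \<gamma>'"
    and "same_unparameterized ?T (\<lambda>t. chart_inv c (y t)) T' \<gamma>'"
    using equivalent geo unfolding geodesically_equivalent_def by metis
  then obtain \<phi> where \<phi>2: "Ck_on 2 ?T \<phi>" and \<phi>nz: "\<And>t. t \<in> ?T \<Longrightarrow> deriv \<phi> t \<noteq> 0" and \<phi>T: "\<phi> ` ?T = T'"
    and same: "\<And>t. t \<in> ?T \<Longrightarrow> chart_inv c (y t) = \<gamma>' (\<phi> t)"
    unfolding same_unparameterized_def by blast
  have ex: "\<exists>v. \<forall>t\<in>T'. \<gamma>' t \<in> chart_dom c \<longrightarrow> v t \<noteq> 0 \<and>
      ((\<lambda>s. coord c (\<gamma>' s)) has_vector_derivative v t) (at t) \<and>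
      (v has_vector_derivative
         (\<chi> i. - (\<Sum>j\<in>UNIV. \<Sum>k\<in>UNIV. christoffel gb c (\<gamma>' t) i j k * v t $ j * v t $ k))) (at t)"
    using geo' c unfolding geodesic_def by blast
  have ev: "(\<chi> i. - (\<Sum>j\<in>UNIV. \<Sum>k\<in>UNIV. christoffel gb c m i j k * w $ j * w $ k)) =
        - (christoffel_matrix gb c m w *v w)" for w m
    by (simp add: christoffel_matrix_vector vec_eq_iff)
  obtain w where w: "\<And>t. t \<in> T' \<Longrightarrow> \<gamma>' t \<in> chart_dom c \<Longrightarrow> 
      ((\<lambda>s. coord c (\<gamma>' s)) has_vector_derivative w t) (at t) \<and>
      (w has_vector_derivative - (christoffel_matrix gb c (\<gamma>' t) (w t) *v w t)) (at t)"
    using ex unfolding ev by blast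
  have inc: "\<gamma>' (\<phi> t) \<in> chart_dom c" "\<phi> t \<in> T'" and coy: "coord c (\<gamma>' (\<phi> t)) = y t" if "t \<in> ?T" for t
    using that same[OF that] yi[of t] \<phi>T g.chart_inv_in[OF c, of "y t"] g.coord_chart_inv[OF c, of "y t"] by auto
  have d\<phi>: "(\<phi> has_vector_derivative deriv \<phi> t) (at t)" if "t \<in> ?T" for t
  proof -
    have "\<phi> differentiable (at t)" using \<phi>2 that by (auto simp: numeral_2_eq_2)
    then show ?thesis
      by (metis DERIV_imp_deriv has_real_derivative_iff_has_vector_derivative real_differentiable_def)
  qed
  have vt: "v t = deriv \<phi> t *\<^sub>R w (\<phi> t)" if t: "t \<in> ?T" for t
  proof -
    have "((\<lambda>s. coord c (\<gamma>' s)) \<circ> \<phi> has_vector_derivative deriv \<phi> t *\<^sub>R w (\<phi> t)) (at t)"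
      using d\<phi>[OF t] w[OF inc(2,1)[OF t]] by (intro vector_diff_chain_at) auto
    then have "(y has_vector_derivative deriv \<phi> t *\<^sub>R w (\<phi> t)) (at t)"
      by (rule has_vector_derivative_transform_within_open[OF _ _ t]) (auto simp: coy)
    moreover have "\<bar>t\<bar> < a" using t by auto
    ultimately show ?thesis using vector_derivative_unique_at[OF dy] by blast
  qed
  have zT: "0 \<in> ?T" using a by simp
  let ?w = "w (\<phi> 0)" and ?p = "deriv \<phi> 0"
  have g0: "\<gamma>' (\<phi> 0) = m"
    using same[OF zT] by (simp add: y0 g.chart_inv_coord[OF c m])
  \<comment> \<open>q is the second derivative of the reparameterization at 0; it exists because
    \<open>Ck_on 2\<close> makes the Frechet derivative applied to 1, which is
    \<open>deriv \<phi>\<close>, differentiable.\<close>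
  obtain q where q: "(deriv \<phi> has_vector_derivative q) (at 0)"
  proof -
    have "(\<lambda>t. frechet_derivative \<phi> (at t) 1) differentiable (at 0)"
      using \<phi>2 zT by (auto simp: numeral_2_eq_2)
    then obtain q where "((\<lambda>t. frechet_derivative \<phi> (at t) 1) has_vector_derivative q) (at 0)"
      by (metis has_real_derivative_iff_has_vector_derivative real_differentiable_def)
    then have "(deriv \<phi> has_vector_derivative q) (at 0)"
    proof (rule has_vector_derivative_transform_within_open[OF _ _ zT])
      fix t assume "t \<in> ?T"
      from frechet_derivative_eqI[OF d\<phi>[OF this, unfolded has_vector_derivative_def]]
      show "frechet_derivative \<phi> (at t) 1 = deriv \<phi> t" by simp
    qed simp
    then show thesis by (rule that)
  qed
  have "(w \<circ> \<phi> has_vector_derivative ?p *\<^sub>R - (christoffel_matrix gb c m ?w *v ?w)) (at 0)"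
    using d\<phi>[OF zT] w[OF inc(2,1)[OF zT]] unfolding g0 by (intro vector_diff_chain_at) auto
  then have "((\<lambda>t. deriv \<phi> t *\<^sub>R (w \<circ> \<phi>) t) has_vector_derivative
      ?p *\<^sub>R (?p *\<^sub>R - (christoffel_matrix gb c m ?w *v ?w)) + q *\<^sub>R (w \<circ> \<phi>) 0) (at 0)"
    using q by (intro has_vector_derivative_scaleR) (simp_all add: has_real_derivative_iff_has_vector_derivative o_def)
  then have "(v has_vector_derivative
      ?p *\<^sub>R (?p *\<^sub>R - (christoffel_matrix gb c m ?w *v ?w)) + q *\<^sub>R (w \<circ> \<phi>) 0) (at 0)"
    by (rule has_vector_derivative_transform_within_open[OF _ _ zT]) (auto simp: vt)
  from vector_derivative_unique_at[OF dv this]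
  have e: "- (christoffel_matrix g c m v0 *v v0) =
      ?p *\<^sub>R (?p *\<^sub>R - (christoffel_matrix gb c m ?w *v ?w)) + q *\<^sub>R ?w"
    by simp
  have v0w: "v0 = ?p *\<^sub>R ?w" using vt[OF zT] v0 by simp
  have "christoffel_matrix gb c m v0 *v v0 = ?p *\<^sub>R (?p *\<^sub>R (christoffel_matrix gb c m ?w *v ?w))"
    unfolding v0w by (simp add: linear_cmul[OF linear_christoffel_matrix] matrix_vector_mult_scaleR
        flip: scaleR_matrix_vector_assoc)
  moreover have "(christoffel_matrix gb c m v0 - christoffel_matrix g c m v0) *v v0 =
      christoffel_matrix gb c m v0 *v v0 + - (christoffel_matrix g c m v0 *v v0)"
    by (simp add: matrix_vector_mult_diff_rdistrib)
  ultimately have "(christoffel_matrix gb c m v0 - christoffel_matrix g c m v0) *v v0 = q *\<^sub>R ?w"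
    unfolding e by simp
  also have "\<dots> = (q / ?p) *\<^sub>R v0" using \<phi>nz[OF zT] unfolding v0w by simp
  finally show ?thesis by blast
qed simp

text \<open>Weyl's relation. The difference is symmetric because both connections are torsion-free,
  so its values on the diagonal determine it; as a matrix acting on v, the summand \<phi>(v) w is
  \<open>outer w \<phi>\<close>.\<close>

lemma levi_civita_relation:
  assumes c: "c \<in> A" and m: "m \<in> chart_dom c"
  obtains \<phi> where "\<And>w. christoffel_matrix gb c m w = christoffel_matrix g c m w + (\<phi> \<bullet> w) *\<^sub>R mat 1 + outer w \<phi>"
proof -
  obtain D where D: "(local_metric g c has_derivative D) (at (coord c m))"
    using g.local_metric_derivative[OF c m] .
  obtain Db where Db: "(local_metric gb c has_derivative Db) (at (coord c m))"
    using gb.local_metric_derivative[OF c m] .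
  let ?T = "\<lambda>w v. (christoffel_matrix gb c m w - christoffel_matrix g c m w) *v v"
  obtain \<phi> where \<phi>: "\<And>w v. ?T w v = (\<phi> \<bullet> w) *\<^sub>R v + (\<phi> \<bullet> v) *\<^sub>R w"
  proof (rule parallel_symmetric_bilinear[of ?T])
    show "?T v w = ?T w v" for v w
      using g.christoffel_matrix_commute[OF c m D, of v w] gb.christoffel_matrix_commute[OF c m Db, of v w]
      by (simp add: matrix_vector_mult_diff_rdistrib)
  qed (use christoffel_difference_parallel[OF c m] in auto)
  show thesis
  proof (rule that)
    fix w
    show "christoffel_matrix gb c m w = christoffel_matrix g c m w + (\<phi> \<bullet> w) *\<^sub>R mat 1 + outer w \<phi>"
      unfolding matrix_eq
    proof
      fix v
      show "christoffel_matrix gb c m w *v v =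
        (christoffel_matrix g c m w + (\<phi> \<bullet> w) *\<^sub>R mat 1 + outer w \<phi>) *v v"
        using \<phi>[of w v]
        by (simp add: matrix_vector_mult_diff_rdistrib matrix_vector_mult_add_rdistrib outer_mult_vector
            algebra_simps flip: scaleR_matrix_vector_assoc)
    qed
  qed
qed

end

section \<open>The bracket of two resolvent functions at one point\<close>

section \<open>Brackets of the resolvent functions\<close>

text \<open>The Poisson bracket as a function of two differentials: \<open>K (0, axis i 1)\<close>
  is the derivative in the i-th momentum, so the first summand is the sum of the products of
  position derivatives of F and momentum derivatives of K.\<close>

definition bracket_of_differentials ::
  "((real ^ 'n) \<times> (real ^ 'n) \<Rightarrow> real) \<Rightarrow> ((real ^ 'n) \<times> (real ^ 'n) \<Rightarrow> real) \<Rightarrow> real" where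
  "bracket_of_differentials F K = F (\<chi> i. K (0, axis i 1), 0) - K (\<chi> i. F (0, axis i 1), 0)"

lemma resolvent_commute:
  fixes L :: "real ^ 'n ^ 'n"
  assumes "invertible (mat 1 - s *\<^sub>R L)"
  shows "matrix_inv (mat 1 - s *\<^sub>R L) ** L = L ** matrix_inv (mat 1 - s *\<^sub>R L)"
proof -
  let ?N = "mat 1 - s *\<^sub>R L"
  have "?N ** L = L ** ?N" by (simp add: matrix_algebra)
  then have "matrix_inv ?N ** (?N ** L) ** matrix_inv ?N = matrix_inv ?N ** (L ** ?N) ** matrix_inv ?N" by simp
  then show ?thesis using assms by (simp add: matrix_mul_assoc matrix_inv_left matrix_inv_cancel)
qed

lemma inverse_conjugate_pencil:
  fixes N M :: "real ^ 'n ^ 'n"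
  assumes "invertible N" "invertible M"
  shows "matrix_inv N ** (s *\<^sub>R M - t *\<^sub>R N) ** matrix_inv M = s *\<^sub>R matrix_inv N - t *\<^sub>R matrix_inv M"
  using assms by (simp add: matrix_algebra(3-6) matrix_inv_cancel matrix_inv_left)

lemma inverse_conjugate_commutator:
  fixes N G :: "real ^ 'n ^ 'n"
  assumes "invertible N"
  shows "matrix_inv N ** ((mat 1 - N) ** G - G ** (mat 1 - N)) ** matrix_inv N =
    matrix_inv N ** G - G ** matrix_inv N"
  using assms by (simp add: matrix_algebra(3,4) matrix_mul_assoc matrix_inv_cancel matrix_inv_left)

text \<open>In the combination of the two pencils with coefficients s and -t the terms in L cancel
  and (s - t) times the identity remains; multiplying by the inverses from both sides gives the
  first claim.\<close>

lemma resolvent_identity: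
  fixes L :: "real ^ 'n ^ 'n"
  assumes s: "invertible (mat 1 - s *\<^sub>R L)" and t: "invertible (mat 1 - t *\<^sub>R L)"
  defines "R \<equiv> matrix_inv (mat 1 - s *\<^sub>R L)" and "S \<equiv> matrix_inv (mat 1 - t *\<^sub>R L)"
  shows "s *\<^sub>R R - t *\<^sub>R S = (s - t) *\<^sub>R (R ** S)" and "R ** S = S ** R"
proof -
  have "R ** (s *\<^sub>R (mat 1 - t *\<^sub>R L) - t *\<^sub>R (mat 1 - s *\<^sub>R L)) ** S = s *\<^sub>R R - t *\<^sub>R S"
    unfolding R_def S_def
    by (rule inverse_conjugate_pencil[OF s t])
  moreover have "s *\<^sub>R (mat 1 - t *\<^sub>R L) - t *\<^sub>R (mat 1 - s *\<^sub>R L) = (s - t) *\<^sub>R mat 1"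
    by (simp add: algebra_simps)
  ultimately show "s *\<^sub>R R - t *\<^sub>R S = (s - t) *\<^sub>R (R ** S)"
    by (simp add: matrix_algebra)
  have "(mat 1 - s *\<^sub>R L) ** (mat 1 - t *\<^sub>R L) = (mat 1 - t *\<^sub>R L) ** (mat 1 - s *\<^sub>R L)"
    by (simp add: matrix_algebra algebra_simps)
  then have "matrix_inv ((mat 1 - s *\<^sub>R L) ** (mat 1 - t *\<^sub>R L)) =
    matrix_inv ((mat 1 - t *\<^sub>R L) ** (mat 1 - s *\<^sub>R L))" by simp
  then show "R ** S = S ** R"
    unfolding R_def S_def by (simp add: matrix_inv_mult s t)
qed

text \<open>The determinant turns the resolvent into the adjugate of
  \<open>mat 1 - s *\<^sub>R L x\<close>, a polynomial in s, so that coefficients in s can be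
  compared later.\<close>

definition resolvent_function ::
  "(real ^ 'n \<Rightarrow> real ^ 'n ^ 'n) \<Rightarrow> (real ^ 'n \<Rightarrow> real ^ 'n ^ 'n) \<Rightarrow> real \<Rightarrow> (real ^ 'n) \<times> (real ^ 'n) \<Rightarrow> real" where
  "resolvent_function g L s = (\<lambda>(x, p). det (mat 1 - s *\<^sub>R L x) *
     (p \<bullet> ((matrix_inv (mat 1 - s *\<^sub>R L x) ** matrix_inv (g x)) *v p)))"

text \<open>The first-order data at a point on which the bracket depends. The assumptions on the
  derivatives say that g is parallel and that the covariant derivative of L along w is
  \<open>(outer \<kappa> w + outer w \<kappa>) ** g x0\<close>. Taking traces identifies \<kappa> as
  half the g-gradient of trace L.\<close>

locale benenti_point =
  fixes g L :: "real ^ 'n \<Rightarrow> real ^ 'n ^ 'n" and x0 :: "real ^ 'n"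
    and \<Gamma> :: "real ^ 'n \<Rightarrow> real ^ 'n ^ 'n" and \<kappa> :: "real ^ 'n"
  assumes g_inv: "invertible (g x0)" and g_sym: "transpose (g x0) = g x0"
    and L_sym: "transpose (L x0) ** g x0 = g x0 ** L x0"
    and \<Gamma>_sym: "\<And>v w. \<Gamma> v *v w = \<Gamma> w *v v"
    and dg: "(g has_derivative (\<lambda>w. g x0 ** \<Gamma> w + transpose (\<Gamma> w) ** g x0)) (at x0)"
    and dL: "(L has_derivative (\<lambda>w. L x0 ** \<Gamma> w - \<Gamma> w ** L x0 + (outer \<kappa> w + outer w \<kappa>) ** g x0)) (at x0)"
begin

abbreviation "N s \<equiv> mat 1 - s *\<^sub>R L x0"
abbreviation "R s \<equiv> matrix_inv (N s)"
abbreviation "Q \<equiv> matrix_inv (g x0)"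

lemma g_inner: "a \<bullet> (g x0 *v b) = (g x0 *v a) \<bullet> b"
  by (metis g_sym inner_transpose_left)

lemma Q_sym: "transpose Q = Q"
  using matrix_inv_transpose[OF g_inv] g_sym by simp

context
  fixes s assumes s: "invertible (N s)"
begin

lemma R_self_adjoint: "transpose (R s) ** g x0 = g x0 ** R s"
proof -
  have t: "transpose (N s) = mat 1 - s *\<^sub>R transpose (L x0)"
    by (simp add: transpose_def mat_def vec_eq_iff eq_commute)
  have "transpose (N s) ** g x0 = g x0 ** N s"
    unfolding t by (simp add: matrix_algebra L_sym)
  then have "transpose (R s) ** (transpose (N s) ** g x0) ** R s = transpose (R s) ** (g x0 ** N s) ** R s"
    by simp
  moreover have "transpose (R s) ** transpose (N s) = mat 1"
    by (simp add: matrix_inv_right s transpose_mat flip: matrix_transpose_mul)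
  ultimately show ?thesis by (simp add: matrix_mul_assoc matrix_inv_cancel s)
qed

lemma RQ_transpose: "transpose (R s) = g x0 ** R s ** Q" "R s ** Q = Q ** transpose (R s)"
proof -
  show 1: "transpose (R s) = g x0 ** R s ** Q"
    unfolding R_self_adjoint[symmetric] by (simp add: matrix_inv_cancel g_inv)
  show "R s ** Q = Q ** transpose (R s)"
    unfolding 1 by (simp add: matrix_mul_assoc matrix_inv_left g_inv)
qed

lemma RQ_sym: "transpose (R s ** Q) = R s ** Q"
  by (simp add: matrix_transpose_mul Q_sym RQ_transpose(2))

text \<open>The two \<Gamma> terms are those of a tensor with two upper indices. The covariant part
  is s R (dL) R Q with dL the covariant derivative of L, where g R Q = R^T moves a resolvent onto
  the second factor of each outer product.\<close>

lemma RQ_derivative: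
  "((\<lambda>x. matrix_inv (mat 1 - s *\<^sub>R L x) ** matrix_inv (g x)) has_derivative
    (\<lambda>w. s *\<^sub>R (outer (R s *v \<kappa>) (R s *v w) + outer (R s *v w) (R s *v \<kappa>)) -
      \<Gamma> w ** (R s ** Q) - R s ** Q ** transpose (\<Gamma> w))) (at x0)"
proof -
  let ?dL = "\<lambda>w. L x0 ** \<Gamma> w - \<Gamma> w ** L x0 + (outer \<kappa> w + outer w \<kappa>) ** g x0"
  let ?dg = "\<lambda>w. g x0 ** \<Gamma> w + transpose (\<Gamma> w) ** g x0"
  have "((\<lambda>x. mat 1 - s *\<^sub>R L x) has_derivative (\<lambda>w. 0 - s *\<^sub>R ?dL w)) (at x0)"
    by (intro has_derivative_diff has_derivative_const has_derivative_scaleR_right dL)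
  from matrix_mult_FDERIV[OF has_derivative_matrix_inv[OF this s] has_derivative_matrix_inv[OF dg g_inv]]
  have d: "((\<lambda>x. matrix_inv (mat 1 - s *\<^sub>R L x) ** matrix_inv (g x)) has_derivative
    (\<lambda>w. R s ** - (Q ** ?dg w ** Q) + - (R s ** (0 - s *\<^sub>R ?dL w) ** R s) ** Q)) (at x0)" .
  have "R s ** - (Q ** ?dg w ** Q) + - (R s ** (0 - s *\<^sub>R ?dL w) ** R s) ** Q =
    s *\<^sub>R (outer (R s *v \<kappa>) (R s *v w) + outer (R s *v w) (R s *v \<kappa>)) -
      \<Gamma> w ** (R s ** Q) - R s ** Q ** transpose (\<Gamma> w)" for w
  proof -
    have 1: "Q ** ?dg w ** Q = \<Gamma> w ** Q + Q ** transpose (\<Gamma> w)"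
      by (simp add: matrix_algebra matrix_mul_assoc matrix_inv_left matrix_inv_cancel g_inv)
    \<comment> \<open>Writing s L as the identity minus the pencil avoids a division by s, so that s
      = 0 is covered.\<close>
    have sL: "s *\<^sub>R L x0 = mat 1 - N s" by (simp only: diff_diff_eq2 add_diff_cancel_left')
    have 2: "s *\<^sub>R (R s ** (L x0 ** \<Gamma> w - \<Gamma> w ** L x0) ** R s) = R s ** \<Gamma> w - \<Gamma> w ** R s"
    proof -
      have "s *\<^sub>R (R s ** (L x0 ** \<Gamma> w - \<Gamma> w ** L x0) ** R s) =
        R s ** ((s *\<^sub>R L x0) ** \<Gamma> w - \<Gamma> w ** (s *\<^sub>R L x0)) ** R s"
        by (simp add: matrix_algebra scaleR_diff_right)
      also have "\<dots> = R s ** \<Gamma> w - \<Gamma> w ** R s"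
        using inverse_conjugate_commutator[OF s, of "\<Gamma> w"] by (simp only: sL[symmetric])
      finally show ?thesis .
    qed
    have 3: "R s ** ((outer \<kappa> w + outer w \<kappa>) ** g x0) ** R s ** Q =
      outer (R s *v \<kappa>) (R s *v w) + outer (R s *v w) (R s *v \<kappa>)"
    proof -
      have "R s ** ((outer \<kappa> w + outer w \<kappa>) ** g x0) ** R s ** Q =
        R s ** (outer \<kappa> w + outer w \<kappa>) ** (g x0 ** R s ** Q)"
        by (simp add: matrix_mul_assoc)
      also have "\<dots> = R s ** (outer \<kappa> w + outer w \<kappa>) ** transpose (R s)"
        by (simp add: RQ_transpose(1))
      finally show ?thesis
        by (simp add: matrix_algebra(1,2) matrix_mult_outer outer_mult_matrix)
    qed
    have "- (R s ** (0 - s *\<^sub>R ?dL w) ** R s) ** Q = (s *\<^sub>R (R s ** ?dL w ** R s)) ** Q"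
      by (simp add: matrix_algebra(3-8) matrix_mult_zero)
    also have "\<dots> = (s *\<^sub>R (R s ** (L x0 ** \<Gamma> w - \<Gamma> w ** L x0) ** R s)) ** Q +
        s *\<^sub>R (R s ** ((outer \<kappa> w + outer w \<kappa>) ** g x0) ** R s ** Q)"
      by (simp only: matrix_algebra(1,2,5,6) scaleR_add_right)
    also have "\<dots> = R s ** \<Gamma> w ** Q - \<Gamma> w ** (R s ** Q) +
        s *\<^sub>R (outer (R s *v \<kappa>) (R s *v w) + outer (R s *v w) (R s *v \<kappa>))"
      unfolding 2 3 by (simp add: matrix_algebra(3) matrix_mul_assoc)
    finally show ?thesis
      unfolding 1 by (simp add: matrix_algebra(1,4,7,8) matrix_mul_assoc)
  qed
  then show ?thesis using d by simp
qed

text \<open>In Jacobi's formula the commutator of L and \<Gamma>(w) has trace zero against R,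
  because R commutes with L; the two outer products contribute equally since R is self-adjoint,
  whence the factor 2.\<close>

lemma det_derivative:
  "((\<lambda>x. det (mat 1 - s *\<^sub>R L x)) has_derivative
    (\<lambda>w. - 2 * s * det (N s) * (w \<bullet> (g x0 *v (R s *v \<kappa>))))) (at x0)"
proof -
  let ?dL = "\<lambda>w. L x0 ** \<Gamma> w - \<Gamma> w ** L x0 + (outer \<kappa> w + outer w \<kappa>) ** g x0"
  have "((\<lambda>x. mat 1 - s *\<^sub>R L x) has_derivative (\<lambda>w. 0 - s *\<^sub>R ?dL w)) (at x0)"
    by (intro has_derivative_diff has_derivative_const has_derivative_scaleR_right dL)
  from has_derivative_det[OF this s]
  have d: "((\<lambda>x. det (mat 1 - s *\<^sub>R L x)) has_derivative
    (\<lambda>w. det (N s) * trace (R s ** (0 - s *\<^sub>R ?dL w)))) (at x0)" .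
  have "trace (R s ** (0 - s *\<^sub>R ?dL w)) = - 2 * s * (w \<bullet> (g x0 *v (R s *v \<kappa>)))" for w
  proof -
    have "trace (R s ** \<Gamma> w ** L x0) = trace (R s ** L x0 ** \<Gamma> w)"
      by (simp add: trace_mul_sym[of "R s ** \<Gamma> w"] resolvent_commute[OF s] matrix_mul_assoc)
    moreover have "trace (R s ** outer \<kappa> w ** g x0) = w \<bullet> (g x0 *v (R s *v \<kappa>))"
      by (simp add: matrix_mult_outer outer_mult_matrix trace_outer g_sym g_inner inner_commute)
    moreover have "trace (R s ** outer w \<kappa> ** g x0) = w \<bullet> (g x0 *v (R s *v \<kappa>))"
    proof -
      have "trace (R s ** outer w \<kappa> ** g x0) = (R s *v w) \<bullet> (g x0 *v \<kappa>)"
        by (simp add: matrix_mult_outer outer_mult_matrix trace_outer g_sym)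
      also have "\<dots> = w \<bullet> ((transpose (R s) ** g x0) *v \<kappa>)"
        by (simp only: inner_transpose_right flip: matrix_vector_mul_assoc)
      finally show ?thesis unfolding R_self_adjoint by (simp add: matrix_vector_mul_assoc)
    qed
    moreover have "trace (R s ** (0 - s *\<^sub>R ?dL w)) =
      - s * (trace (R s ** L x0 ** \<Gamma> w) - trace (R s ** \<Gamma> w ** L x0) +
        trace (R s ** outer \<kappa> w ** g x0) + trace (R s ** outer w \<kappa> ** g x0))"
    proof -
      have "R s ** (0 - s *\<^sub>R ?dL w) = (- s) *\<^sub>R (R s ** L x0 ** \<Gamma> w - R s ** \<Gamma> w ** L x0 +
        R s ** outer \<kappa> w ** g x0 + R s ** outer w \<kappa> ** g x0)"
        by (simp add: matrix_algebra matrix_mul_assoc matrix_mult_zero)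
      then show ?thesis
        by (simp only: linear_cmul[OF bounded_linear.linear[OF bounded_linear_trace]] trace_add trace_sub
            real_scaleR_def)
    qed
    ultimately show ?thesis by simp
  qed
  then show ?thesis using d by (simp add: mult_ac)
qed

text \<open>The summands come from the determinant, from the two \<Gamma> terms (equal by the
  symmetry of \<open>R s ** Q\<close>), from the two outer products (equal when paired with p0 on
  both sides), and from the variation q of the momentum.\<close>

lemma resolvent_function_derivative:
  "(resolvent_function g L s has_derivative (\<lambda>(w, q). det (N s) *
     (- 2 * s * (w \<bullet> (g x0 *v (R s *v \<kappa>))) * (p0 \<bullet> ((R s ** Q) *v p0))
      - 2 * (p0 \<bullet> (\<Gamma> w *v ((R s ** Q) *v p0)))
      + 2 * s * (p0 \<bullet> (R s *v \<kappa>)) * (p0 \<bullet> (R s *v w))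
      + 2 * (q \<bullet> ((R s ** Q) *v p0))))) (at (x0, p0))"
proof -
  let ?M = "\<lambda>x. matrix_inv (mat 1 - s *\<^sub>R L x) ** matrix_inv (g x)"
  let ?dM = "\<lambda>w. s *\<^sub>R (outer (R s *v \<kappa>) (R s *v w) + outer (R s *v w) (R s *v \<kappa>)) -
      \<Gamma> w ** (R s ** Q) - R s ** Q ** transpose (\<Gamma> w)"
  let ?f = "at (x0, p0)"
  have fst: "(fst has_derivative fst) ?f" and snd: "(snd has_derivative snd) ?f"
    by (auto intro: bounded_linear_imp_has_derivative bounded_linear_fst bounded_linear_snd)
  have dM: "((\<lambda>z. ?M (fst z)) has_derivative (\<lambda>h. ?dM (fst h))) ?f"
    using has_derivative_compose[OF fst, of ?M ?dM] RQ_derivative by simp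
  have dD: "((\<lambda>z. det (mat 1 - s *\<^sub>R L (fst z))) has_derivative
      (\<lambda>h. - 2 * s * det (N s) * (fst h \<bullet> (g x0 *v (R s *v \<kappa>))))) ?f"
    using has_derivative_compose[OF fst, of "\<lambda>x. det (mat 1 - s *\<^sub>R L x)"] det_derivative by simp
  have dMp: "((\<lambda>z. ?M (fst z) *v snd z) has_derivative (\<lambda>h. (R s ** Q) *v snd h + ?dM (fst h) *v p0)) ?f"
    using matrix_vector_FDERIV[OF dM snd] by simp
  have dq: "((\<lambda>z. snd z \<bullet> (?M (fst z) *v snd z)) has_derivative
      (\<lambda>h. p0 \<bullet> ((R s ** Q) *v snd h + ?dM (fst h) *v p0) + snd h \<bullet> ((R s ** Q) *v p0))) ?f"
    using has_derivative_inner[OF snd dMp] by simp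
  have d: "((\<lambda>z. det (mat 1 - s *\<^sub>R L (fst z)) * (snd z \<bullet> (?M (fst z) *v snd z))) has_derivative
      (\<lambda>h. det (N s) * (p0 \<bullet> ((R s ** Q) *v snd h + ?dM (fst h) *v p0) + snd h \<bullet> ((R s ** Q) *v p0)) +
        (- 2 * s * det (N s) * (fst h \<bullet> (g x0 *v (R s *v \<kappa>)))) * (p0 \<bullet> ((R s ** Q) *v p0)))) ?f"
    using has_derivative_mult[OF dD dq] by simp
  have RQ: "p0 \<bullet> ((R s ** Q) *v q) = q \<bullet> ((R s ** Q) *v p0)" for q
    by (metis RQ_sym inner_commute inner_transpose_left)
  have p1: "p0 \<bullet> (R s ** Q ** transpose (\<Gamma> w) *v p0) = p0 \<bullet> (\<Gamma> w *v ((R s ** Q) *v p0))" for w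
  proof -
    have "p0 \<bullet> (R s ** Q ** transpose (\<Gamma> w) *v p0) = p0 \<bullet> ((R s ** Q) *v (transpose (\<Gamma> w) *v p0))"
      by (simp only: matrix_vector_mul_assoc)
    also have "\<dots> = (transpose (\<Gamma> w) *v p0) \<bullet> ((R s ** Q) *v p0)" by (rule RQ)
    finally show ?thesis by (simp only: inner_transpose_left)
  qed
  have dM': "p0 \<bullet> (?dM w *v p0) = 2 * s * (p0 \<bullet> (R s *v \<kappa>)) * (p0 \<bullet> (R s *v w)) -
     2 * (p0 \<bullet> (\<Gamma> w *v ((R s ** Q) *v p0)))" for w
  proof -
    have "p0 \<bullet> (?dM w *v p0) = s * (p0 \<bullet> ((outer (R s *v \<kappa>) (R s *v w) + outer (R s *v w) (R s *v \<kappa>)) *v p0)) -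
       p0 \<bullet> ((\<Gamma> w ** (R s ** Q)) *v p0) - p0 \<bullet> (R s ** Q ** transpose (\<Gamma> w) *v p0)"
      by (simp only: matrix_vector_mult_diff_rdistrib inner_diff_right inner_scaleR_right
          flip: scaleR_matrix_vector_assoc)
    also have "p0 \<bullet> ((outer (R s *v \<kappa>) (R s *v w) + outer (R s *v w) (R s *v \<kappa>)) *v p0) =
       2 * (p0 \<bullet> (R s *v \<kappa>)) * (p0 \<bullet> (R s *v w))"
      by (simp add: matrix_vector_mult_add_rdistrib outer_mult_vector inner_add_right inner_commute)
    also have "p0 \<bullet> ((\<Gamma> w ** (R s ** Q)) *v p0) = p0 \<bullet> (\<Gamma> w *v ((R s ** Q) *v p0))"
      by (simp only: matrix_vector_mul_assoc)
    finally show ?thesis unfolding p1 by simp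
  qed
  have "resolvent_function g L s = (\<lambda>z. det (mat 1 - s *\<^sub>R L (fst z)) * (snd z \<bullet> (?M (fst z) *v snd z)))"
    by (simp add: resolvent_function_def case_prod_beta fun_eq_iff)
  moreover have "(\<lambda>h. det (N s) * (p0 \<bullet> ((R s ** Q) *v snd h + ?dM (fst h) *v p0) + snd h \<bullet> ((R s ** Q) *v p0)) +
        (- 2 * s * det (N s) * (fst h \<bullet> (g x0 *v (R s *v \<kappa>)))) * (p0 \<bullet> ((R s ** Q) *v p0))) =
     (\<lambda>(w, q). det (N s) *
     (- 2 * s * (w \<bullet> (g x0 *v (R s *v \<kappa>))) * (p0 \<bullet> ((R s ** Q) *v p0))
      - 2 * (p0 \<bullet> (\<Gamma> w *v ((R s ** Q) *v p0)))
      + 2 * s * (p0 \<bullet> (R s *v \<kappa>)) * (p0 \<bullet> (R s *v w))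
      + 2 * (q \<bullet> ((R s ** Q) *v p0))))" (is "?A = ?B")
  proof (rule ext)
    fix h :: "(real ^ 'n) \<times> (real ^ 'n)"
    obtain w q where h: "h = (w, q)" by fastforce
    show "?A h = ?B h"
      unfolding h fst_conv snd_conv prod.case inner_add_right dM' RQ[of q]
      by (simp only: algebra_simps)
  qed
  ultimately show ?thesis using d by metis
qed

end

text \<open>The \<Gamma> contribution to the two halves of the bracket is the same, by the symmetry
  of \<Gamma>, and drops out. The rest cancels after two uses of the resolvent identity, on \<kappa>
  and on \<open>Q *v p0\<close>.\<close>

theorem resolvent_functions_commute:
  assumes s: "invertible (N s)" and t: "invertible (N t)"
    and F: "(resolvent_function g L s has_derivative F) (at (x0, p0))"
    and K: "(resolvent_function g L t has_derivative K) (at (x0, p0))"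
  shows "bracket_of_differentials F K = 0"
proof -
  let ?F = "\<lambda>s (w, q). det (N s) *
     (- 2 * s * (w \<bullet> (g x0 *v (R s *v \<kappa>))) * (p0 \<bullet> ((R s ** Q) *v p0))
      - 2 * (p0 \<bullet> (\<Gamma> w *v ((R s ** Q) *v p0)))
      + 2 * s * (p0 \<bullet> (R s *v \<kappa>)) * (p0 \<bullet> (R s *v w))
      + 2 * (q \<bullet> ((R s ** Q) *v p0)))"
  have FK: "F = ?F s" "K = ?F t"
    by (rule has_derivative_unique[OF F resolvent_function_derivative[OF s]],
        rule has_derivative_unique[OF K resolvent_function_derivative[OF t]])
  define u where "u s = (R s ** Q) *v p0" for s
  \<comment> \<open>The symmetry of \<Gamma> transfers linearity from the second argument to the
    first.\<close>
  have \<Gamma>0: "\<Gamma> 0 *v v = 0" for v using \<Gamma>_sym[of 0 v] by simp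
  have pv: "(\<chi> i. ?F s (0, axis i 1)) = (2 * det (N s)) *\<^sub>R u s" for s
    by (simp add: vec_eq_iff u_def \<Gamma>0 inner_axis')
  have half: "?F s ((2 * det (N t)) *\<^sub>R u t, 0) = 4 * det (N s) * det (N t) *
     (- s * (p0 \<bullet> ((R t ** R s) *v \<kappa>)) * (p0 \<bullet> u s) - (p0 \<bullet> (\<Gamma> (u t) *v u s)) +
       s * (p0 \<bullet> (R s *v \<kappa>)) * (p0 \<bullet> ((R s ** R t) *v (Q *v p0))))"
    if st: "invertible (N s)" "invertible (N t)" for s t
  proof -
    have "u t \<bullet> (g x0 *v (R s *v \<kappa>)) = p0 \<bullet> ((R t ** R s) *v \<kappa>)"
    proof -
      have "u t \<bullet> (g x0 *v (R s *v \<kappa>)) = p0 \<bullet> (transpose (R t ** Q) *v (g x0 *v (R s *v \<kappa>)))"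
        by (simp only: u_def inner_transpose_right)
      also have "\<dots> = p0 \<bullet> ((R t ** Q ** g x0 ** R s) *v \<kappa>)"
        by (simp only: RQ_sym[OF st(2)] matrix_vector_mul_assoc matrix_mul_assoc)
      finally show ?thesis by (simp add: matrix_inv_cancel g_inv)
    qed
    moreover have "R s *v u t = (R s ** R t) *v (Q *v p0)"
      by (simp only: u_def matrix_vector_mul_assoc matrix_mul_assoc)
    moreover have "\<Gamma> (k *\<^sub>R u t) *v u s = k *\<^sub>R (\<Gamma> (u t) *v u s)" for k
      by (simp only: \<Gamma>_sym[of _ "u s"] matrix_vector_mult_scaleR)
    ultimately show ?thesis
      by (simp add: matrix_vector_mult_scaleR algebra_simps flip: u_def)
  qed
  define X where "X = p0 \<bullet> ((R s ** R t) *v \<kappa>)"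
  define c where "c = p0 \<bullet> ((R s ** R t) *v (Q *v p0))"
  define a where "a s = p0 \<bullet> u s" for s
  define b where "b s = p0 \<bullet> (R s *v \<kappa>)" for s
  have comm: "R t ** R s = R s ** R t" using resolvent_identity(2)[OF s t] by simp
  have res: "s * (p0 \<bullet> (R s *v v)) - t * (p0 \<bullet> (R t *v v)) = (s - t) * (p0 \<bullet> ((R s ** R t) *v v))" for v
  proof -
    have "s * (p0 \<bullet> (R s *v v)) - t * (p0 \<bullet> (R t *v v)) = p0 \<bullet> ((s *\<^sub>R R s - t *\<^sub>R R t) *v v)"
      by (simp add: matrix_vector_mult_diff_rdistrib inner_diff_right flip: scaleR_matrix_vector_assoc)
    then show ?thesis
      unfolding resolvent_identity(1)[OF s t] by (simp flip: scaleR_matrix_vector_assoc)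
  qed
  have ra: "s * a s - t * a t = (s - t) * c"
    using res[of "Q *v p0"] by (simp add: a_def c_def u_def matrix_vector_mul_assoc)
  have rb: "s * b s - t * b t = (s - t) * X" using res[of \<kappa>] by (simp add: b_def X_def)
  have "bracket_of_differentials F K = 4 * det (N s) * det (N t) *
     (- s * X * a s + s * b s * c + t * X * a t - t * b t * c)"
    unfolding bracket_of_differentials_def FK pv half[OF s t] half[OF t s] comm
    by (simp add: X_def a_def b_def c_def \<Gamma>_sym[of "u t" "u s"] algebra_simps)
  \<comment> \<open>Grouped this way, the resolvent identity replaces the two differences by (s - t)
    c and (s - t) X, and the products cancel.\<close>
  also have "- s * X * a s + s * b s * c + t * X * a t - t * b t * c =
      - X * (s * a s - t * a t) + c * (s * b s - t * b t)" by (simp add: algebra_simps)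
  also have "\<dots> = 0" unfolding ra rb by simp
  finally show ?thesis by simp
qed

end

section \<open>The tensor L of two equivalent metrics and the generating function of the tensors
  S_k\<close>

section \<open>The Benenti tensor\<close>

lemma (in riemannian_metric) det_metric_pos: "c \<in> A \<Longrightarrow> m \<in> chart_dom c \<Longrightarrow> det (g c m) > 0"
  by (rule positive_definite_det_pos) (rule metric_pos)

lemma char_partial_shift:
  "(\<Sum>i\<le>k. char_coeff M i *\<^sub>R matrix_pow M (k - i + 1)) = M ** char_partial M k"
  by (simp add: char_partial_def matrix_pow_simps bounded_bilinear.sum_right[OF bounded_bilinear_matrix_mult]
      bounded_bilinear.scaleR_right[OF bounded_bilinear_matrix_mult])

context equivalent_metrics
begin

text \<open>In terms of G this is (det G)^(1/(n+1)) G^-1, as a function of the coordinates in the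
  chart c so that it can be differentiated.\<close>

definition benenti_tensor :: "('m, 'n) chart \<Rightarrow> real ^ 'n \<Rightarrow> real ^ 'n ^ 'n" where
  "benenti_tensor c x = ((det (local_metric gb c x) / det (local_metric g c x)) powr (1 / real (CARD('n) + 1))) *\<^sub>R
     (matrix_inv (local_metric gb c x) ** local_metric g c x)"

context
  fixes c m
  assumes c: "c \<in> A" and m: "m \<in> chart_dom c"
begin

lemma benenti_factor_derivative:
  assumes \<phi>: "\<And>w. christoffel_matrix gb c m w = christoffel_matrix g c m w + (\<phi> \<bullet> w) *\<^sub>R mat 1 + outer w \<phi>"
  shows "((\<lambda>x. (det (local_metric gb c x) / det (local_metric g c x)) powr (1 / real (CARD('n) + 1))) has_derivative
    (\<lambda>w. (det (gb c m) / det (g c m)) powr (1 / real (CARD('n) + 1)) * (2 * (\<phi> \<bullet> w)))) (at (coord c m))"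
proof -
  obtain D where D: "(local_metric g c has_derivative D) (at (coord c m))"
    using g.local_metric_derivative[OF c m] .
  obtain Db where Db: "(local_metric gb c has_derivative Db) (at (coord c m))"
    using gb.local_metric_derivative[OF c m] .
  note lm = g.local_metric_coord[OF c m] gb.local_metric_coord[OF c m]
  let ?r = "\<lambda>x. det (local_metric gb c x) / det (local_metric g c x)"
  have inv: "invertible (g c m)" "invertible (gb c m)"
    using g.metric_invertible gb.metric_invertible c m by blast+
  have pos: "det (g c m) > 0" "det (gb c m) > 0"
    using g.det_metric_pos gb.det_metric_pos c m by blast+
  have dg: "((\<lambda>x. det (local_metric g c x)) has_derivative
      (\<lambda>w. det (g c m) * trace (matrix_inv (g c m) ** D w))) (at (coord c m))"
    using has_derivative_det[OF D] inv by (simp add: lm)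
  have dgb: "((\<lambda>x. det (local_metric gb c x)) has_derivative
      (\<lambda>w. det (gb c m) * trace (matrix_inv (gb c m) ** Db w))) (at (coord c m))"
    using has_derivative_det[OF Db] inv by (simp add: lm)
  have tr: "trace (matrix_inv M ** (M ** X + transpose X ** M)) = 2 * trace X"
    if "invertible M" for M X :: "real ^ 'n ^ 'n"
  proof -
    have "trace (matrix_inv M ** (transpose X ** M)) = trace (transpose X)"
      using that by (subst trace_mul_sym) (simp add: matrix_inv_right flip: matrix_mul_assoc)
    also have "\<dots> = trace X" by (simp add: trace_def transpose_def)
    finally show ?thesis
      using that by (simp add: matrix_add_ldistrib trace_add matrix_mul_assoc matrix_inv_left)
  qed
  \<comment> \<open>By metric compatibility the logarithm of det g has derivative 2 tr \<Gamma>(w).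
    In the trace of the difference of the connections, \<open>mat 1\<close> contributes n and
    \<open>outer w \<phi>\<close> contributes 1.\<close>
  have trd: "trace (matrix_inv (gb c m) ** Db w) - trace (matrix_inv (g c m) ** D w) =
      2 * (real (CARD('n) + 1) * (\<phi> \<bullet> w))" for w
    unfolding g.metric_derivative_christoffel[OF c m D] gb.metric_derivative_christoffel[OF c m Db]
      tr[OF inv(1)] tr[OF inv(2)] \<phi>[of w] trace_add trace_outer
    by (simp add: linear_cmul[OF bounded_linear.linear[OF bounded_linear_trace]] trace_I inner_commute algebra_simps)
  have "(?r has_derivative (\<lambda>w. (det (gb c m) / det (g c m)) * (2 * (real (CARD('n) + 1) * (\<phi> \<bullet> w))))) (at (coord c m))"
  proof -
    have "(?r has_derivative (\<lambda>w. (det (gb c m) * trace (matrix_inv (gb c m) ** Db w) * det (g c m) -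
        det (gb c m) * (det (g c m) * trace (matrix_inv (g c m) ** D w))) / (det (g c m) * det (g c m)))) (at (coord c m))"
      using has_derivative_divide'[OF dgb dg] pos by (simp add: lm)
    moreover have "(det (gb c m) * trace (matrix_inv (gb c m) ** Db w) * det (g c m) -
        det (gb c m) * (det (g c m) * trace (matrix_inv (g c m) ** D w))) / (det (g c m) * det (g c m)) =
       (det (gb c m) / det (g c m)) * (2 * (real (CARD('n) + 1) * (\<phi> \<bullet> w)))" for w
      unfolding trd[symmetric] using pos by (simp add: field_simps)
    ultimately show ?thesis by simp
  qed
  from has_derivative_powr[OF this has_derivative_const[of "1 / real (CARD('n) + 1)"]]
  have "((\<lambda>x. ?r x powr (1 / real (CARD('n) + 1))) has_derivative
    (\<lambda>w. (?r (coord c m) powr (1 / real (CARD('n) + 1))) * (0 * ln (?r (coord c m)) +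
      ((det (gb c m) / det (g c m)) * (2 * (real (CARD('n) + 1) * (\<phi> \<bullet> w)))) * (1 / real (CARD('n) + 1)) / ?r (coord c m))))
    (at (coord c m))"
    using pos by (simp add: lm)
  moreover have "0 * ln (?r (coord c m)) +
      ((det (gb c m) / det (g c m)) * (2 * (real (CARD('n) + 1) * (\<phi> \<bullet> w)))) * (1 / real (CARD('n) + 1)) / ?r (coord c m) =
      2 * (\<phi> \<bullet> w)" for w
  proof -
    have "real (CARD('n) + 1) \<noteq> 0" by simp
    moreover have "?r (coord c m) = det (gb c m) / det (g c m)" "det (gb c m) / det (g c m) \<noteq> 0"
      using pos by (simp_all add: lm)
    ultimately show ?thesis by (simp del: of_nat_add of_nat_Suc)
  qed
  ultimately show ?thesis by (simp only: lm)
qed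

text \<open>By compatibility of gb with its own connection \<Gamma>b, the derivative of gb^-1 is
  -(\<Gamma>b gb^-1 + gb^-1 \<Gamma>b^T). Weyl's relation turns \<Gamma>b into \<Gamma> plus a term
  -2 \<phi>(w) gb^-1, which the scalar factor cancels, plus rank-one terms.\<close>

lemma benenti_point_exists:
  obtains \<kappa> where "benenti_point (local_metric g c) (benenti_tensor c) (coord c m) (christoffel_matrix g c m) \<kappa>"
proof -
  obtain D where D: "(local_metric g c has_derivative D) (at (coord c m))"
    using g.local_metric_derivative[OF c m] .
  obtain Db where Db: "(local_metric gb c has_derivative Db) (at (coord c m))"
    using gb.local_metric_derivative[OF c m] .
  obtain \<phi> where \<phi>: "\<And>w. christoffel_matrix gb c m w = christoffel_matrix g c m w + (\<phi> \<bullet> w) *\<^sub>R mat 1 + outer w \<phi>"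
    by (rule levi_civita_relation[OF c m]) (rule that)
  note lm = g.local_metric_coord[OF c m] gb.local_metric_coord[OF c m]
  have inv: "invertible (g c m)" "invertible (gb c m)"
    using g.metric_invertible gb.metric_invertible c m by blast+
  define \<psi> where "\<psi> = (det (gb c m) / det (g c m)) powr (1 / real (CARD('n) + 1))"
  define B where "B = matrix_inv (gb c m)"
  \<comment> \<open>The rank-one terms are \<open>outer w (B *v \<phi>)\<close> and its transpose,
    with coefficient \<open>- \<psi>\<close>.\<close>
  define \<kappa> where "\<kappa> = - (\<psi> *\<^sub>R (B *v \<phi>))"
  let ?\<Gamma> = "christoffel_matrix g c m"
  have Bsym: "transpose B = B"
    unfolding B_def using matrix_inv_transpose[OF inv(2)] gb.metric_symmetric[OF c m] by simp
  have L: "benenti_tensor c (coord c m) = \<psi> *\<^sub>R (B ** g c m)"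
    by (simp add: benenti_tensor_def lm \<psi>_def B_def)
  have dB: "((\<lambda>x. matrix_inv (local_metric gb c x)) has_derivative (\<lambda>w. - (B ** Db w ** B))) (at (coord c m))"
    using has_derivative_matrix_inv[OF Db] inv by (simp add: lm B_def)
  have "((\<lambda>x. matrix_inv (local_metric gb c x) ** local_metric g c x) has_derivative
      (\<lambda>w. B ** D w + - (B ** Db w ** B) ** g c m)) (at (coord c m))"
    using matrix_mult_FDERIV[OF dB D] by (simp add: lm B_def)
  from has_derivative_scaleR[OF benenti_factor_derivative[OF \<phi>] this]
  have d: "(benenti_tensor c has_derivative
      (\<lambda>w. \<psi> *\<^sub>R (B ** D w + - (B ** Db w ** B) ** g c m) + (\<psi> * (2 * (\<phi> \<bullet> w))) *\<^sub>R (B ** g c m))) (at (coord c m))"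
    unfolding benenti_tensor_def[abs_def] by (simp add: lm \<psi>_def B_def)
  have e: "\<psi> *\<^sub>R (B ** D w + - (B ** Db w ** B) ** g c m) + (\<psi> * (2 * (\<phi> \<bullet> w))) *\<^sub>R (B ** g c m) =
     (\<psi> *\<^sub>R (B ** g c m)) ** ?\<Gamma> w - ?\<Gamma> w ** (\<psi> *\<^sub>R (B ** g c m)) + (outer \<kappa> w + outer w \<kappa>) ** g c m" for w
  proof -
    have two: "(2 * a) *\<^sub>R B = a *\<^sub>R B + a *\<^sub>R B" for a :: real
      by (simp flip: scaleR_left_distrib)
    have BD: "B ** D w = B ** g c m ** ?\<Gamma> w + B ** transpose (?\<Gamma> w) ** g c m"
      unfolding g.metric_derivative_christoffel[OF c m D] by (simp add: matrix_algebra matrix_mul_assoc)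
    have "B ** Db w ** B = christoffel_matrix gb c m w ** B + B ** transpose (christoffel_matrix gb c m w)"
      unfolding gb.metric_derivative_christoffel[OF c m Db] B_def
      by (simp add: matrix_algebra matrix_mul_assoc matrix_inv_left inv matrix_inv_cancel)
    also have "\<dots> = ?\<Gamma> w ** B + B ** transpose (?\<Gamma> w) + (2 * (\<phi> \<bullet> w)) *\<^sub>R B + outer w (B *v \<phi>) + outer (B *v \<phi>) w"
      unfolding \<phi>[of w] transpose_add transpose_scalar transpose_outer transpose_mat
      by (simp add: matrix_algebra matrix_mult_outer outer_mult_matrix Bsym two add_ac)
    finally have BDB: "B ** Db w ** B ** g c m = ?\<Gamma> w ** B ** g c m + B ** transpose (?\<Gamma> w) ** g c m +
        (2 * (\<phi> \<bullet> w)) *\<^sub>R (B ** g c m) + (outer w (B *v \<phi>) + outer (B *v \<phi>) w) ** g c m"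
      by (simp add: matrix_algebra matrix_mul_assoc)
    have k: "outer \<kappa> w + outer w \<kappa> = (- \<psi>) *\<^sub>R (outer w (B *v \<phi>) + outer (B *v \<phi>) w)"
      unfolding \<kappa>_def scaleR_minus_left[symmetric] outer_scaleR by (simp add: scaleR_add_right)
    show ?thesis
      unfolding k matrix_mult_minus BDB BD
      by (simp add: matrix_algebra matrix_mul_assoc scaleR_add_right scaleR_diff_right)
  qed
  show thesis
  proof (rule that, unfold_locales)
    show "transpose (benenti_tensor c (coord c m)) ** local_metric g c (coord c m) =
      local_metric g c (coord c m) ** benenti_tensor c (coord c m)"
      by (simp add: lm L transpose_scalar matrix_transpose_mul Bsym g.metric_symmetric[OF c m] matrix_algebra matrix_mul_assoc)
    show "(local_metric g c has_derivative (\<lambda>w. local_metric g c (coord c m) ** ?\<Gamma> w +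
      transpose (?\<Gamma> w) ** local_metric g c (coord c m))) (at (coord c m))"
      using D unfolding lm g.metric_derivative_christoffel[OF c m D, symmetric] .
    show "(benenti_tensor c has_derivative (\<lambda>w. benenti_tensor c (coord c m) ** ?\<Gamma> w -
      ?\<Gamma> w ** benenti_tensor c (coord c m) + (outer \<kappa> w + outer w \<kappa>) ** local_metric g c (coord c m))) (at (coord c m))"
      using d unfolding e L lm .
  qed (simp_all add: lm inv g.metric_symmetric[OF c m] g.christoffel_matrix_commute[OF c m D])
qed

text \<open>With f = (det g / det gb)^(1/(n+1)) one has L = (1/f) G^-1, hence G - s/f = G (1 - s L),
  and the sum is \<open>char_partial_sum\<close> for G at the value s/f. The factor det G that comes
  out is cancelled by f^(n+1) = 1 / det G.\<close>

lemma S_tensor_generating: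
  fixes s :: real
  assumes inv: "invertible (mat 1 - s *\<^sub>R benenti_tensor c (coord c m))"
  shows "(\<Sum>k<CARD('n). s ^ (CARD('n) - 1 - k) *\<^sub>R S_tensor c g gb k m) =
    - det (mat 1 - s *\<^sub>R benenti_tensor c (coord c m)) *\<^sub>R matrix_inv (mat 1 - s *\<^sub>R benenti_tensor c (coord c m))"
    and "S_tensor c g gb (CARD('n) - 1) m = - mat 1"
proof -
  note lm = g.local_metric_coord[OF c m] gb.local_metric_coord[OF c m]
  let ?n = "CARD('n)"
  have ginv: "invertible (g c m)" "invertible (gb c m)"
    using g.metric_invertible gb.metric_invertible c m by blast+
  have pos: "det (g c m) > 0" "det (gb c m) > 0"
    using g.det_metric_pos gb.det_metric_pos c m by blast+
  define r where "r = det (g c m) / det (gb c m)"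
  have r: "r > 0" using pos by (simp add: r_def)
  define f where "f = r powr (1 / real (?n + 1))"
  define \<psi> where "\<psi> = (det (gb c m) / det (g c m)) powr (1 / real (?n + 1))"
  have f: "f > 0" using r by (simp add: f_def)
  have f\<psi>: "f * \<psi> = 1"
  proof -
    have "f * \<psi> = (r * (det (gb c m) / det (g c m))) powr (1 / real (?n + 1))"
      unfolding f_def \<psi>_def using r pos by (subst powr_mult) auto
    also have "r * (det (gb c m) / det (g c m)) = 1" using pos by (simp add: r_def)
    finally show ?thesis by simp
  qed
  have fpow: "r powr (real j / real (?n + 1)) = f ^ j" for j
  proof -
    have "f ^ j = f powr real j" using f by (simp add: powr_realpow)
    also have "\<dots> = r powr (real j / real (?n + 1))" unfolding f_def powr_powr by simp
    finally show ?thesis ..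
  qed
  have fn: "f ^ (?n + 1) = r" using fpow[of "?n + 1"] r by simp
  define G where "G = G_tensor c g gb m"
  have G: "G = matrix_inv (g c m) ** gb c m" by (simp add: G_def G_tensor_def)
  have Ginv: "invertible G" unfolding G by (intro invertible_mult invertible_matrix_inv ginv)
  have detG: "det G = 1 / r"
  proof -
    have "det (matrix_inv (g c m)) * det (g c m) = 1"
      using ginv by (metis det_I det_mul matrix_inv_left)
    then have "det (matrix_inv (g c m)) = 1 / det (g c m)" using pos by (simp add: field_simps)
    then show ?thesis by (simp add: G det_mul r_def)
  qed
  have S: "S_tensor c g gb k m = f ^ (k + 2) *\<^sub>R (G ** char_partial G k)" for k
    unfolding S_tensor_def r_def[symmetric] fpow G_def[symmetric] char_partial_shift ..
  define L where "L = benenti_tensor c (coord c m)"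
  have "matrix_inv G = matrix_inv (gb c m) ** g c m"
  proof (rule matrix_inv_eqI)
    show "G ** (matrix_inv (gb c m) ** g c m) = mat 1"
      unfolding G using ginv by (simp add: matrix_mul_assoc matrix_inv_cancel matrix_inv_left)
  qed
  then have L: "L = \<psi> *\<^sub>R matrix_inv G"
    by (simp add: L_def benenti_tensor_def lm \<psi>_def)
  have GL: "G ** L = \<psi> *\<^sub>R mat 1" "L ** G = \<psi> *\<^sub>R mat 1"
    unfolding L using Ginv by (simp_all add: matrix_algebra matrix_inv_left matrix_inv_right)
  define Y where "Y = (\<Sum>k<?n. (s * \<psi>) ^ (?n - 1 - k) *\<^sub>R char_partial G k)"
  have matm: "mat (s * \<psi>) = s *\<^sub>R (\<psi> *\<^sub>R (mat 1 :: real ^ 'n ^ 'n))" by (simp add: vec_eq_iff mat_def)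
  have Gm: "G - mat (s * \<psi>) = G ** (mat 1 - s *\<^sub>R L)" "G ** (mat 1 - s *\<^sub>R L) = (mat 1 - s *\<^sub>R L) ** G"
    unfolding matm by (simp_all add: matrix_algebra GL)
  have "(mat 1 - s *\<^sub>R L) ** (G ** Y) = - (det G * det (mat 1 - s *\<^sub>R L)) *\<^sub>R mat 1"
    using char_partial_sum[of G "s * \<psi>"]
    by (simp only: Gm(1) Y_def[symmetric] det_mul matrix_mul_assoc Gm(2)[symmetric])
  then have "matrix_inv (mat 1 - s *\<^sub>R L) ** ((mat 1 - s *\<^sub>R L) ** (G ** Y)) =
      - (det G * det (mat 1 - s *\<^sub>R L)) *\<^sub>R matrix_inv (mat 1 - s *\<^sub>R L)"
    by (simp add: matrix_algebra)
  then have GY: "G ** Y = - (det G * det (mat 1 - s *\<^sub>R L)) *\<^sub>R matrix_inv (mat 1 - s *\<^sub>R L)"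
    using inv unfolding L_def[symmetric] by (simp only: matrix_mul_assoc matrix_inv_left matrix_mul_lid)
  have "(\<Sum>k<?n. s ^ (?n - 1 - k) *\<^sub>R S_tensor c g gb k m) = f ^ (?n + 1) *\<^sub>R (G ** Y)"
  proof -
    \<comment> \<open>f^(k+2) is f^(n+1) divided by f^(n-1-k), and since \<psi> = 1/f the division
      turns the power of s into one of s \<psi>.\<close>
    have ek: "s ^ (?n - 1 - k) * f ^ (k + 2) = f ^ (?n + 1) * (s * \<psi>) ^ (?n - 1 - k)" if "k < ?n" for k
    proof -
      have e: "f ^ (?n + 1) = f ^ (k + 2) * f ^ (?n - 1 - k)"
      proof -
        have "?n + 1 = (k + 2) + (?n - 1 - k)" using that by simp
        then show ?thesis by (metis power_add)
      qed
      have "f ^ (?n + 1) * (s * \<psi>) ^ (?n - 1 - k) = f ^ (k + 2) * s ^ (?n - 1 - k) * (f * \<psi>) ^ (?n - 1 - k)"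
        unfolding e by (simp only: power_mult_distrib mult_ac)
      also have "\<dots> = s ^ (?n - 1 - k) * f ^ (k + 2)" unfolding f\<psi> by (simp only: power_one mult_1_right mult.commute)
      finally show ?thesis ..
    qed
    show ?thesis
      unfolding S Y_def scaleR_sum_right bounded_bilinear.sum_right[OF bounded_bilinear_matrix_mult]
        matrix_algebra(6) scaleR_scaleR
      by (intro sum.cong refl) (simp only: ek lessThan_iff)
  qed
  also have "\<dots> = - det (mat 1 - s *\<^sub>R L) *\<^sub>R matrix_inv (mat 1 - s *\<^sub>R L)"
    unfolding GY fn detG using r by simp
  finally show "(\<Sum>k<?n. s ^ (?n - 1 - k) *\<^sub>R S_tensor c g gb k m) =
    - det (mat 1 - s *\<^sub>R benenti_tensor c (coord c m)) *\<^sub>R matrix_inv (mat 1 - s *\<^sub>R benenti_tensor c (coord c m))"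
    by (simp add: L_def)
  have n: "Suc (?n - 1) = ?n" by simp
  \<comment> \<open>The last step of the Horner recursion gives zero by Cayley-Hamilton, so the
    previous one times G is -c_n; and c_n is det G, the value of the characteristic polynomial at
    0.\<close>
  have "G ** char_partial G (?n - 1) = - char_coeff G ?n *\<^sub>R mat 1"
    using char_partial_Suc[of G "?n - 1"] cayley_hamilton[of G] unfolding n char_partial_def[symmetric]
    by (simp add: eq_neg_iff_add_eq_0)
  moreover have "char_coeff G ?n = det G"
  proof -
    have m0: "mat 0 = (0 :: real ^ 'n ^ 'n)" by (simp add: vec_eq_iff mat_def)
    have "det (G - mat 0) = (\<Sum>i\<le>?n. if i = ?n then char_coeff G i else 0)"
      unfolding det_eq_char_coeff_sum by (intro sum.cong) auto
    then show ?thesis by (simp add: m0)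
  qed
  moreover have "f ^ (?n - 1 + 2) = r" using fn by simp
  ultimately show "S_tensor c g gb (?n - 1) m = - mat 1"
    unfolding S using r by (simp add: detG)
qed

end

end

section \<open>Formulas on the cotangent bundle in an arbitrary chart\<close>

section \<open>Canonical coordinates\<close>

context smooth_manifold
begin

lemma cotangent_transform:
  assumes "p \<in> cotangent_space A m" "c \<in> A" "d \<in> A" "m \<in> chart_dom c" "m \<in> chart_dom d"
  shows "p c = transpose (J c d m) *v p d"
proof -
  have "p c = p d v* J c d m" using assms unfolding cotangent_space_def by blast
  then show ?thesis by (simp only: transpose_matrix_vector)
qed

text \<open>The components of a covector in one chart determine those in all others, and any values
  in one chart extend consistently by the chain rule for Jacobians. This makes the inverse inside
  \<open>in_coords\<close> a genuine inverse over the whole chart.\<close>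

lemma cotangent_coord_bij:
  assumes c: "c \<in> A"
  shows "bij_betw (cotangent_coord c) {z \<in> cotangent_bundle A. fst z \<in> chart_dom c} (chart_im c \<times> UNIV)"
proof (rule bij_betw_imageI)
  let ?S = "{z \<in> cotangent_bundle A. fst z \<in> chart_dom c}"
  show "inj_on (cotangent_coord c) ?S"
  proof (rule inj_onI, clarify)
    fix m p m' p'
    assume z: "(m, p) \<in> cotangent_bundle A" "(m', p') \<in> cotangent_bundle A"
      and dom: "fst (m, p) \<in> chart_dom c" "fst (m', p') \<in> chart_dom c"
      and eq: "cotangent_coord c (m, p) = cotangent_coord c (m', p')"
    have mm: "m = m'" using eq dom chart_inv_coord[OF c] by (auto simp: cotangent_coord_def) (metis)
    have pc: "p c = p' c" using eq by (simp add: cotangent_coord_def)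
    have p: "p \<in> cotangent_space A m" "p' \<in> cotangent_space A m"
      using z mm by (auto simp: cotangent_bundle_def)
    have "p d = p' d" for d
    proof (cases "d \<in> A \<and> m \<in> chart_dom d")
      case True
      then show ?thesis
        using cotangent_transform[OF p(1), of d c] cotangent_transform[OF p(2), of d c] c dom pc by simp
    next
      case False
      then have "p d = 0" "p' d = 0" using p unfolding cotangent_space_def by blast+
      then show ?thesis by simp
    qed
    then show "m = m' \<and> p = p'" using mm by auto
  qed
  show "cotangent_coord c ` ?S = chart_im c \<times> UNIV"
  proof (intro equalityI subsetI)
    show "z \<in> chart_im c \<times> UNIV" if "z \<in> cotangent_coord c ` ?S" for z
      using that coord_in[OF c] by (auto simp: cotangent_coord_def)
    fix z assume "z \<in> chart_im c \<times> (UNIV :: (real ^ 'n) set)"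
    then obtain x q where z: "z = (x, q)" "x \<in> chart_im c" by auto
    define m where "m = chart_inv c x"
    have m: "m \<in> chart_dom c" "coord c m = x" using z chart_inv_in[OF c] coord_chart_inv[OF c] by (auto simp: m_def)
    \<comment> \<open>The value 0 outside the charts around m is the convention that makes a
      covector unique.\<close>
    define p where "p d = (if d \<in> A \<and> m \<in> chart_dom d then transpose (J d c m) *v q else 0)" for d
    have "p \<in> cotangent_space A m"
      unfolding cotangent_space_def
    proof (intro CollectI conjI ballI impI allI)
      fix d e assume de: "d \<in> A" "e \<in> A" "m \<in> chart_dom d \<inter> chart_dom e"
      have "J d c m = J e c m ** J d e m" using de c m by (intro jacobian_chain) auto
      then have "transpose (J d c m) *v q = transpose (J d e m) *v (transpose (J e c m) *v q)"
        by (simp only: matrix_transpose_mul matrix_vector_mul_assoc)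
      moreover have "p d = transpose (J d c m) *v q" "p e = transpose (J e c m) *v q"
        using de by (simp_all only: p_def Int_iff simp_thms if_True)
      ultimately show "p d = p e v* J d e m" by (simp only: transpose_matrix_vector)
    qed (auto simp: p_def)
    moreover have "p c = q"
      by (simp only: p_def c m(1) jacobian_self[OF c m(1)] transpose_mat matrix_vector_mul_lid simp_thms if_True)
    ultimately have zS: "(m, p) \<in> ?S" "cotangent_coord c (m, p) = z"
      using m z by (auto simp: cotangent_bundle_def cotangent_coord_def)
    show "z \<in> cotangent_coord c ` ?S" unfolding zS(2)[symmetric] by (rule imageI[OF zS(1)])
  qed
qed

lemma in_coords_coord:
  assumes c: "c \<in> A" and z: "z \<in> cotangent_bundle A" "fst z \<in> chart_dom c"
  shows "in_coords A c F (cotangent_coord c z) = F z"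
  using inv_into_f_f[OF bij_betw_imp_inj_on[OF cotangent_coord_bij[OF c]], of z] z
  by (simp add: in_coords_def)

lemma cotangent_coord_surj:
  assumes "c \<in> A" "x \<in> chart_im c"
  obtains m p where "(m, p) \<in> cotangent_bundle A" "m \<in> chart_dom c" "x = coord c m" "q = p c"
proof -
  have "(x, q) \<in> cotangent_coord c ` {z \<in> cotangent_bundle A. fst z \<in> chart_dom c}"
    using cotangent_coord_bij[OF assms(1)] assms(2) by (simp add: bij_betw_def)
  then show thesis using that by (auto simp: cotangent_coord_def)
qed

end

context riemannian_metric
begin

lemma metric_inverse_transform:
  assumes cd: "c \<in> A" "d \<in> A" "m \<in> chart_dom c" "m \<in> chart_dom d"
  shows "matrix_inv (g c m) = matrix_inv (J c d m) ** matrix_inv (g d m) ** transpose (matrix_inv (J c d m))"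
proof -
  have J: "invertible (J c d m)" and g: "invertible (g d m)"
    using jacobian_inverse(2)[OF cd] metric_invertible cd by auto
  show ?thesis
    unfolding metric_transform[OF cd]
    by (simp add: matrix_inv_mult invertible_mult transpose_invertible J g matrix_inv_transpose matrix_mul_assoc)
qed

lemma geodesic_hamiltonian_chart:
  assumes c: "c \<in> A" and z: "(m, p) \<in> cotangent_bundle A" "m \<in> chart_dom c"
  shows "geodesic_hamiltonian A g (m, p) = (1/2) * (p c \<bullet> (matrix_inv (g c m) *v p c))"
proof -
  let ?d = "chart_at A m"
  note d = chart_at_in[of m]
  have p: "p \<in> cotangent_space A m" using z by (simp add: cotangent_bundle_def)
  have J: "invertible (J c ?d m)" using jacobian_inverse(2)[OF c d(1) z(2) d(2)] .
  have inv: "invertible (g ?d m)" by (rule metric_invertible[OF d])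
  have "p c \<bullet> (matrix_inv (g c m) *v p c) = p ?d \<bullet> (matrix_inv (g ?d m) *v p ?d)"
    unfolding cotangent_transform[OF p c d(1) z(2) d(2)] inner_transpose_left
      metric_inverse_transform[OF c d(1) z(2) d(2)] matrix_vector_mul_assoc matrix_mul_assoc
    by (simp add: matrix_inv_right J flip: matrix_mul_assoc matrix_transpose_mul)
  moreover have "geodesic_hamiltonian A g (m, p) = (1/2) * (p ?d \<bullet> (matrix_inv (g ?d m) *v p ?d))"
  proof -
    have "(matrix_inv (g ?d m) *v p ?d) \<bullet> (g ?d m *v (matrix_inv (g ?d m) *v p ?d)) =
        (matrix_inv (g ?d m) *v p ?d) \<bullet> p ?d"
      by (simp add: matrix_vector_mul_assoc matrix_inv_right inv)
    then show ?thesis by (simp add: geodesic_hamiltonian_def Let_def inner_commute)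
  qed
  ultimately show ?thesis by simp
qed

end

lemma matrix_pow_similar:
  fixes M J :: "real ^ 'n ^ 'n"
  assumes "invertible J"
  shows "matrix_pow (matrix_inv J ** M ** J) k = matrix_inv J ** matrix_pow M k ** J"
  using assms by (induction k) (simp_all add: matrix_pow_simps matrix_inv_left matrix_mul_assoc matrix_inv_cancel)

context equivalent_metrics
begin

text \<open>Both determinants acquire the square of the determinant of the Jacobian, so their ratio
  is invariant; G is conjugated, which conjugates its powers and preserves its characteristic
  coefficients.\<close>

lemma S_tensor_transform:
  assumes cd: "c \<in> A" "d \<in> A" "m \<in> chart_dom c" "m \<in> chart_dom d"
  defines "Jm \<equiv> jacobian (transition c d) (at (coord c m))"
  shows "S_tensor c g gb k m = matrix_inv Jm ** S_tensor d g gb k m ** Jm"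
proof -
  have J: "invertible Jm" unfolding Jm_def by (rule g.jacobian_inverse(2)[OF cd])
  then have nz: "det Jm \<noteq> 0" by (simp add: invertible_det_nz)
  have "det (g c m) / det (gb c m) = det (g d m) / det (gb d m)"
    unfolding g.metric_transform[OF cd] gb.metric_transform[OF cd] Jm_def[symmetric] det_mul det_transpose
    using nz by simp
  moreover have "G_tensor c g gb m = matrix_inv Jm ** G_tensor d g gb m ** Jm"
    unfolding G_tensor_def g.metric_inverse_transform[OF cd] gb.metric_transform[OF cd] Jm_def[symmetric]
  proof -
    have "transpose (matrix_inv Jm) ** transpose Jm = mat 1"
      by (simp add: J matrix_inv_right transpose_mat flip: matrix_transpose_mul)
    then have X: "X ** transpose (matrix_inv Jm) ** transpose Jm = X" for X :: "real ^ 'n ^ 'n"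
      by (simp flip: matrix_mul_assoc)
    show "matrix_inv Jm ** matrix_inv (g d m) ** transpose (matrix_inv Jm) **
        (transpose Jm ** gb d m ** Jm) = matrix_inv Jm ** (matrix_inv (g d m) ** gb d m) ** Jm"
      by (simp add: matrix_mul_assoc X)
  qed
  ultimately show ?thesis
    unfolding S_tensor_def
    by (simp add: char_coeff_similar[OF J] matrix_pow_similar[OF J] matrix_algebra
        bounded_bilinear.sum_left[OF bounded_bilinear_matrix_mult]
        bounded_bilinear.sum_right[OF bounded_bilinear_matrix_mult])
qed

text \<open>\<open>I_fun\<close> is evaluated in the chart \<open>chart_at A m\<close>, which may
  change from point to point. Derivatives require a formula in one fixed chart on its whole
  domain.\<close>

lemma I_fun_chart:
  assumes c: "c \<in> A" and z: "(m, p) \<in> cotangent_bundle A" "m \<in> chart_dom c"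
  shows "I_fun A g gb k (m, p) = p c \<bullet> ((S_tensor c g gb k m ** matrix_inv (g c m)) *v p c)"
proof -
  let ?d = "chart_at A m"
  note d = g.chart_at_in[of m]
  have p: "p \<in> cotangent_space A m" using z by (simp add: cotangent_bundle_def)
  have "I_fun A g gb k (m, p) = p ?d \<bullet> ((S_tensor ?d g gb k m ** matrix_inv (g ?d m)) *v p ?d)"
  proof -
    have "p ?d \<bullet> ((S_tensor ?d g gb k m ** matrix_inv (g ?d m)) *v p ?d) =
      (\<Sum>j\<in>UNIV. \<Sum>\<alpha>\<in>UNIV. \<Sum>i\<in>UNIV. matrix_inv (g ?d m) $ \<alpha> $ i * S_tensor ?d g gb k m $ j $ \<alpha> * p ?d $ i * p ?d $ j)"
      unfolding matrix_vector_mul_assoc[symmetric] unfolding inner_vec_def matrix_vector_mult_def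
      by (simp add: sum_distrib_left mult_ac)
    also have "\<dots> = (\<Sum>\<alpha>\<in>UNIV. \<Sum>j\<in>UNIV. \<Sum>i\<in>UNIV. matrix_inv (g ?d m) $ \<alpha> $ i * S_tensor ?d g gb k m $ j $ \<alpha> * p ?d $ i * p ?d $ j)"
      by (rule sum.swap)
    also have "\<dots> = (\<Sum>\<alpha>\<in>UNIV. \<Sum>i\<in>UNIV. \<Sum>j\<in>UNIV. matrix_inv (g ?d m) $ \<alpha> $ i * S_tensor ?d g gb k m $ j $ \<alpha> * p ?d $ i * p ?d $ j)"
      by (intro sum.cong refl sum.swap)
    finally show ?thesis by (simp add: I_fun_def Let_def)
  qed
  also have "\<dots> = p c \<bullet> ((S_tensor c g gb k m ** matrix_inv (g c m)) *v p c)"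
  proof -
    define Jm where "Jm = jacobian (transition c ?d) (at (coord c m))"
    have J: "invertible Jm" unfolding Jm_def using g.jacobian_inverse(2)[OF c d(1) z(2) d(2)] .
    have "transpose (matrix_inv Jm) ** transpose Jm = mat 1"
      by (simp add: J matrix_inv_right transpose_mat flip: matrix_transpose_mul)
    then have X: "X ** transpose (matrix_inv Jm) ** transpose Jm = X" for X :: "real ^ 'n ^ 'n"
      by (simp flip: matrix_mul_assoc)
    show ?thesis
      unfolding g.cotangent_transform[OF p c d(1) z(2) d(2)] inner_transpose_left
        g.metric_inverse_transform[OF c d(1) z(2) d(2)] S_tensor_transform[OF c d(1) z(2) d(2)]
        matrix_vector_mul_assoc matrix_mul_assoc Jm_def[symmetric]
      by (simp add: X matrix_inv_right matrix_inv_cancel J)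
  qed
  finally show ?thesis .
qed

definition S_local :: "('m, 'n) chart \<Rightarrow> nat \<Rightarrow> real ^ 'n \<Rightarrow> real ^ 'n ^ 'n" where
  "S_local c k x = S_tensor c g gb k (chart_inv c x) ** matrix_inv (local_metric g c x)"

lemma in_coords_I_fun:
  assumes c: "c \<in> A" and x: "x \<in> chart_im c"
  shows "in_coords A c (I_fun A g gb k) (x, q) = q \<bullet> (S_local c k x *v q)"
proof -
  obtain m p where mp: "(m, p) \<in> cotangent_bundle A" "m \<in> chart_dom c" "x = coord c m" "q = p c"
    by (rule g.cotangent_coord_surj[OF c x])
  then show ?thesis
    using g.in_coords_coord[OF c mp(1), of "I_fun A g gb k"] I_fun_chart[OF c mp(1,2), of k]
    by (simp add: cotangent_coord_def S_local_def g.chart_inv_coord[OF c] g.local_metric_coord[OF c])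
qed

lemma in_coords_hamiltonian:
  assumes c: "c \<in> A" and x: "x \<in> chart_im c"
  shows "in_coords A c (geodesic_hamiltonian A g) (x, q) =
    - (1/2) * in_coords A c (I_fun A g gb (CARD('n) - 1)) (x, q)"
proof -
  obtain m p where mp: "(m, p) \<in> cotangent_bundle A" "m \<in> chart_dom c" "x = coord c m" "q = p c"
    by (rule g.cotangent_coord_surj[OF c x])
  \<comment> \<open>The parameter 0 makes the pencil the identity and so meets the invertibility
    condition of the generating function.\<close>
  have "invertible (mat 1 - 0 *\<^sub>R benenti_tensor c (coord c m))" by (simp add: invertible_det_nz)
  then have S: "S_tensor c g gb (CARD('n) - 1) m = - mat 1"
    by (rule S_tensor_generating(2)[OF c mp(2)])
  have "I_fun A g gb (CARD('n) - 1) (m, p) = - (p c \<bullet> (matrix_inv (g c m) *v p c))"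
    unfolding I_fun_chart[OF c mp(1,2)] S
    by (simp add: matrix_mult_minus bounded_bilinear.minus_left[OF bounded_bilinear_matrix_vector_mult])
  then show ?thesis
    using g.in_coords_coord[OF c mp(1), of "I_fun A g gb (CARD('n) - 1)"]
      g.in_coords_coord[OF c mp(1), of "geodesic_hamiltonian A g"]
      g.geodesic_hamiltonian_chart[OF c mp(1,2)] mp by (simp add: cotangent_coord_def)
qed

lemma S_local_differentiable:
  assumes c: "c \<in> A" and m: "m \<in> chart_dom c"
  shows "S_local c k differentiable (at (coord c m))"
proof -
  let ?x = "coord c m"
  obtain D where "(local_metric g c has_derivative D) (at ?x)"
    using g.local_metric_derivative[OF c m] .
  then have g: "local_metric g c differentiable (at ?x)" by (auto simp: differentiable_def)
  obtain Db where "(local_metric gb c has_derivative Db) (at ?x)"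
    using gb.local_metric_derivative[OF c m] .
  then have gb: "local_metric gb c differentiable (at ?x)" by (auto simp: differentiable_def)
  note lm = g.local_metric_coord[OF c m] gb.local_metric_coord[OF c m]
  have inv: "invertible (local_metric g c ?x)"
    using g.metric_invertible c m by (simp add: lm)
  have pos: "det (local_metric g c ?x) > 0" "det (local_metric gb c ?x) > 0"
    using g.det_metric_pos gb.det_metric_pos c m by (simp_all add: lm)
  have Q: "(\<lambda>x. matrix_inv (local_metric g c x)) differentiable (at ?x)"
    by (rule matrix_inv_differentiable(1)[OF g inv])
  have G: "(\<lambda>x. G_tensor c g gb (chart_inv c x)) differentiable (at ?x)"
    using matrix_mult_differentiable[OF Q gb] by (simp add: G_tensor_def local_metric_def)
  have r: "(\<lambda>x. det (local_metric g c x) / det (local_metric gb c x)) differentiable (at ?x)"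
    using pos by (intro differentiable_divide det_differentiable[OF g] det_differentiable[OF gb]) auto
  then obtain r' where r': "((\<lambda>x. det (local_metric g c x) / det (local_metric gb c x)) has_derivative r') (at ?x)"
    by (auto simp: differentiable_def)
  have f: "(\<lambda>x. (det (local_metric g c x) / det (local_metric gb c x)) powr e) differentiable (at ?x)" for e
    using has_derivative_powr[OF r' has_derivative_const, of e] pos unfolding differentiable_def by auto
  have "(\<lambda>x. ((det (local_metric g c x) / det (local_metric gb c x)) powr (real (k + 2) / real (CARD('n) + 1))) *\<^sub>R
     (\<Sum>i\<le>k. char_coeff (G_tensor c g gb (chart_inv c x)) i *\<^sub>R matrix_pow (G_tensor c g gb (chart_inv c x)) (k - i + 1)))
     differentiable (at ?x)"
    by (intro differentiable_scaleR f differentiable_sum finite_atMost ballI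
        char_coeff_differentiable matrix_pow_differentiable G)
  then have "(\<lambda>x. S_tensor c g gb k (chart_inv c x)) differentiable (at ?x)"
    by (simp add: S_tensor_def local_metric_def)
  then show ?thesis
    unfolding S_local_def[abs_def] by (rule matrix_mult_differentiable[OF _ Q])
qed

lemma in_coords_I_fun_differentiable:
  assumes c: "c \<in> A" and m: "m \<in> chart_dom c"
  shows "in_coords A c (I_fun A g gb k) differentiable (at (coord c m, q))"
proof -
  let ?z = "(coord c m, q)"
  obtain D where D: "(S_local c k has_derivative D) (at (coord c m))"
    using S_local_differentiable[OF c m] by (auto simp: differentiable_def)
  have fst: "(fst has_derivative fst) (at ?z)" and snd: "(snd has_derivative snd) (at ?z)"
    by (auto intro: bounded_linear_imp_has_derivative bounded_linear_fst bounded_linear_snd)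
  have dM: "((\<lambda>z. S_local c k (fst z)) has_derivative (\<lambda>h. D (fst h))) (at ?z)"
    using has_derivative_compose[OF fst, of "S_local c k" D] D by simp
  from has_derivative_inner[OF snd matrix_vector_FDERIV[OF dM snd]]
  obtain D' where "((\<lambda>z. snd z \<bullet> (S_local c k (fst z) *v snd z)) has_derivative D') (at ?z)" by blast
  then have "(in_coords A c (I_fun A g gb k) has_derivative D') (at ?z)"
    by (rule has_derivative_transform_within_open[of _ _ _ UNIV "chart_im c \<times> UNIV"])
      (use g.open_chart_im[OF c] g.coord_in[OF c m] in \<open>auto simp: in_coords_I_fun[OF c] open_Times\<close>)
  then show ?thesis by (auto simp: differentiable_def)
qed

end

section \<open>From the generating function to the single brackets and to the geodesic flow\<close>

section \<open>Involution\<close>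

lemma linear_fst_expansion:
  fixes F :: "(real ^ 'n) \<times> (real ^ 'n) \<Rightarrow> real"
  assumes "linear F"
  shows "F (v, 0) = (\<Sum>i\<in>UNIV. v $ i * F (axis i 1, 0))"
    and "F (0, v) = (\<Sum>i\<in>UNIV. v $ i * F (0, axis i 1))"
proof -
  have l1: "linear (\<lambda>a. F (a, 0))" and l2: "linear (\<lambda>a. F (0, a))"
    using linear_compose[of "\<lambda>a. (a, 0)" F] linear_compose[of "\<lambda>a. (0, a)" F] assms
    by (simp_all add: o_def linear_iff)
  have v: "v = (\<Sum>i\<in>UNIV. v $ i *\<^sub>R axis i 1)"
    by (simp add: basis_expansion flip: scalar_mult_eq_scaleR)
  show "F (v, 0) = (\<Sum>i\<in>UNIV. v $ i * F (axis i 1, 0))"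
    by (subst v) (simp add: linear_sum[OF l1] linear_cmul[OF l1])
  show "F (0, v) = (\<Sum>i\<in>UNIV. v $ i * F (0, axis i 1))"
    by (subst v) (simp add: linear_sum[OF l2] linear_cmul[OF l2])
qed

text \<open>Serves twice: for the bracket defined through the symplectic form and for the derivative
  of a function along a Hamiltonian trajectory.\<close>

lemma differential_of_hamiltonian_field:
  assumes F: "linear F" and K: "(K has_derivative K') (at z)"
  shows "F (hamiltonian_field K z) = bracket_of_differentials F K'"
proof -
  have diff: "K differentiable (at z)" using K by (auto simp: differentiable_def)
  have lin: "linear K'" by (rule has_derivative_linear[OF K])
  have "F (hamiltonian_field K z) = F ((\<chi> i. K' (0, axis i 1)), (\<chi> i. - K' (axis i 1, 0)))"
    using hamiltonian_field_eq[OF diff] frechet_derivative_eqI[OF K] by simp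
  also have "\<dots> = F ((\<chi> i. K' (0, axis i 1)), 0) + F (0, (\<chi> i. - K' (axis i 1, 0)))"
    using linear_add[OF F, of "((\<chi> i. K' (0, axis i 1)), 0)" "(0, (\<chi> i. - K' (axis i 1, 0)))"] by simp
  also have "F (0, (\<chi> i. - K' (axis i 1, 0))) = - K' (\<chi> i. F (0, axis i 1), 0)"
    unfolding linear_fst_expansion[OF F, of "\<chi> i. - K' (axis i 1, 0)"] linear_fst_expansion[OF lin, of "\<chi> i. F (0, axis i 1)"]
    by (simp add: sum_negf mult.commute)
  finally show ?thesis by (simp add: bracket_of_differentials_def)
qed

lemma symplectic_form_hamiltonian_fields:
  assumes F: "(F has_derivative F') (at z)" and K: "(K has_derivative K') (at z)"
  shows "symplectic_form (hamiltonian_field F z) (hamiltonian_field K z) = bracket_of_differentials F' K'"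
proof -
  have diff: "F differentiable (at z)" using F by (auto simp: differentiable_def)
  have lin: "linear F'" by (rule has_derivative_linear[OF F])
  have "symplectic_form (hamiltonian_field F z) Y = F' Y" for Y
  proof -
    have "F' Y = F' (fst Y, 0) + F' (0, snd Y)"
      using linear_add[OF lin, of "(fst Y, 0)" "(0, snd Y)"] by simp
    then show ?thesis
      unfolding linear_fst_expansion(1)[OF lin, of "fst Y"] linear_fst_expansion(2)[OF lin, of "snd Y"]
        hamiltonian_field_eq[OF diff] frechet_derivative_eqI[OF F]
      by (simp add: symplectic_form_def inner_vec_def sum_negf mult.commute)
  qed
  then show ?thesis using differential_of_hamiltonian_field[OF lin K] by simp
qed

lemma bracket_antisymmetric: "bracket_of_differentials F K = - bracket_of_differentials K F"
  by (simp add: bracket_of_differentials_def)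

lemma bracket_sum_left:
  fixes F :: "nat \<Rightarrow> (real ^ 'n) \<times> (real ^ 'n) \<Rightarrow> real"
  assumes "linear K"
  shows "bracket_of_differentials (\<lambda>h. \<Sum>k\<in>S. a k * F k h) K =
    (\<Sum>k\<in>S. a k * bracket_of_differentials (F k) K)"
proof -
  have "K (\<chi> i. \<Sum>k\<in>S. a k * F k (0, axis i 1), 0) = (\<Sum>k\<in>S. a k * K (\<chi> i. F k (0, axis i 1), 0))"
  proof -
    have "((\<chi> i. \<Sum>k\<in>S. a k * F k (0, axis i 1)), 0 :: real ^ 'n) = (\<Sum>k\<in>S. a k *\<^sub>R ((\<chi> i. F k (0, axis i 1)), 0))"
      by (simp add: prod_eq_iff fst_sum snd_sum vec_eq_iff)
    then show ?thesis by (simp only: linear_sum[OF assms] linear_cmul[OF assms] real_scaleR_def)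
  qed
  then show ?thesis
    by (simp add: bracket_of_differentials_def right_diff_distrib sum_subtractf)
qed

text \<open>A polynomial that vanishes on an interval has infinitely many roots. The reversed
  exponents are those of the generating function.\<close>

lemma power_sum_zero:
  fixes b :: "nat \<Rightarrow> real"
  assumes "\<epsilon> > 0" and zero: "\<And>s. \<bar>s\<bar> < \<epsilon> \<Longrightarrow> (\<Sum>k<n. s ^ (n - 1 - k) * b k) = 0" and "k < n"
  shows "b k = 0"
proof -
  have eq: "(\<Sum>i\<le>n - 1. b (n - 1 - i) * s ^ i) = (\<Sum>k<n. s ^ (n - 1 - k) * b k)" for s
    using \<open>k < n\<close>
    by (intro sum.reindex_bij_witness[of _ "\<lambda>i. n - 1 - i" "\<lambda>i. n - 1 - i"]) auto
  have "{0<..<\<epsilon>} \<subseteq> {s. (\<Sum>i\<le>n - 1. b (n - 1 - i) * s ^ i) = 0}"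
    unfolding eq using zero by auto
  then have "infinite {s. (\<Sum>i\<le>n - 1. b (n - 1 - i) * s ^ i) = 0}"
    using \<open>\<epsilon> > 0\<close> infinite_Ioo finite_subset by blast
  then have "\<forall>i\<le>n - 1. b (n - 1 - i) = 0" using polyfun_finite_roots[of "\<lambda>i. b (n - 1 - i)" "n - 1"] by blast
  from this[rule_format, of "n - 1 - k"] show ?thesis using \<open>k < n\<close> by simp
qed

context equivalent_metrics
begin

lemma resolvent_function_in_coords:
  assumes c: "c \<in> A" and x: "x \<in> chart_im c" and inv: "invertible (mat 1 - s *\<^sub>R benenti_tensor c x)"
  shows "(\<Sum>k<CARD('n). - (s ^ (CARD('n) - 1 - k)) * in_coords A c (I_fun A g gb k) (x, q)) =
    resolvent_function (local_metric g c) (benenti_tensor c) s (x, q)"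
proof -
  define m where "m = chart_inv c x"
  have m: "m \<in> chart_dom c" "coord c m = x"
    using g.chart_inv_in[OF c x] g.coord_chart_inv[OF c x] by (simp_all add: m_def)
  let ?N = "mat 1 - s *\<^sub>R benenti_tensor c x" and ?Q = "matrix_inv (local_metric g c x)"
  have "(\<Sum>k<CARD('n). - (s ^ (CARD('n) - 1 - k)) * in_coords A c (I_fun A g gb k) (x, q)) =
    - (q \<bullet> (((\<Sum>k<CARD('n). s ^ (CARD('n) - 1 - k) *\<^sub>R S_tensor c g gb k m) ** ?Q) *v q))"
    by (simp add: in_coords_I_fun[OF c x] S_local_def m_def[symmetric] inner_sum_right sum_negf
        bounded_bilinear.sum_left[OF bounded_bilinear_matrix_mult]
        bounded_bilinear.sum_left[OF bounded_bilinear_matrix_vector_mult] matrix_algebra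
        flip: scaleR_matrix_vector_assoc)
  also have "(\<Sum>k<CARD('n). s ^ (CARD('n) - 1 - k) *\<^sub>R S_tensor c g gb k m) = - det ?N *\<^sub>R matrix_inv ?N"
    using S_tensor_generating(1)[OF c m(1), of s] inv unfolding m(2) by blast
  finally show ?thesis
    by (simp add: resolvent_function_def matrix_algebra
        bounded_bilinear.minus_left[OF bounded_bilinear_matrix_vector_mult] flip: scaleR_matrix_vector_assoc)
qed

theorem I_fun_brackets_vanish:
  assumes c: "c \<in> A" and m: "m \<in> chart_dom c" and kl: "k < CARD('n)" "l < CARD('n)"
    and D: "\<And>k. (in_coords A c (I_fun A g gb k) has_derivative D k) (at (coord c m, q))"
  shows "bracket_of_differentials (D k) (D l) = 0"
proof -
  let ?L = "benenti_tensor c" and ?x0 = "coord c m" and ?n = "CARD('n)"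
  obtain \<kappa> where "benenti_point (local_metric g c) ?L ?x0 (christoffel_matrix g c m) \<kappa>"
    by (rule benenti_point_exists[OF c m])
  then interpret benenti_point "local_metric g c" ?L ?x0 "christoffel_matrix g c m" \<kappa> .
  \<comment> \<open>At s = 0 the pencil is the identity, so it is invertible on an interval around
    0, which already contains enough parameters to compare coefficients.\<close>
  have "isCont (\<lambda>s. det (mat 1 - s *\<^sub>R ?L ?x0)) 0"
    by (rule isCont_o2[OF _ continuous_at_det]) (intro continuous_intros)
  then have "\<forall>\<^sub>F s in at 0. det (mat 1 - s *\<^sub>R ?L ?x0) \<noteq> 0"
    by (simp add: continuous_within tendsto_imp_eventually_ne)
  then obtain \<epsilon> where \<epsilon>: "\<epsilon> > 0" "\<And>s. s \<noteq> 0 \<Longrightarrow> \<bar>s\<bar> < \<epsilon> \<Longrightarrow> det (mat 1 - s *\<^sub>R ?L ?x0) \<noteq> 0"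
    unfolding eventually_at by auto
  have inv: "invertible (mat 1 - s *\<^sub>R ?L ?x0)" if "\<bar>s\<bar> < \<epsilon>" for s
    using \<epsilon>(2)[of s] that by (cases "s = 0") (auto simp: invertible_det_nz)
  define P where "P s = (\<lambda>h. \<Sum>k<?n. - (s ^ (?n - 1 - k)) * D k h)" for s
  have P: "(resolvent_function (local_metric g c) ?L s has_derivative P s) (at (?x0, q))" if s: "\<bar>s\<bar> < \<epsilon>" for s
  proof -
    have "((\<lambda>x. mat 1 - s *\<^sub>R ?L x) has_derivative
        (\<lambda>w. 0 - s *\<^sub>R (?L ?x0 ** christoffel_matrix g c m w - christoffel_matrix g c m w ** ?L ?x0 +
          (outer \<kappa> w + outer w \<kappa>) ** local_metric g c ?x0))) (at ?x0)"
      by (intro has_derivative_diff has_derivative_const has_derivative_scaleR_right dL)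
    then have "(\<lambda>x. mat 1 - s *\<^sub>R ?L x) differentiable (at ?x0)" by (auto simp: differentiable_def)
    from matrix_inv_differentiable(2)[OF this inv[OF s]]
    have "\<forall>\<^sub>F x in nhds ?x0. invertible (mat 1 - s *\<^sub>R ?L x)"
      using inv[OF s] by (simp add: eventually_nhds_conv_at)
    moreover have "\<forall>\<^sub>F x in nhds ?x0. x \<in> chart_im c"
      by (rule eventually_nhds_in_open[OF g.open_chart_im[OF c] g.coord_in[OF c m]])
    ultimately have "\<forall>\<^sub>F x in nhds ?x0. x \<in> chart_im c \<and> invertible (mat 1 - s *\<^sub>R ?L x)"
      by (simp add: eventually_conj_iff)
    \<comment> \<open>For fixed s the pencil has to be invertible at all points near x0: the
      derivative of the resolvent function is taken over from that of the sum, which requires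
      agreement on an open set.\<close>
    then obtain U where U: "open U" "?x0 \<in> U" "\<And>x. x \<in> U \<Longrightarrow> x \<in> chart_im c \<and> invertible (mat 1 - s *\<^sub>R ?L x)"
      unfolding eventually_nhds by blast
    have "((\<lambda>z. \<Sum>k<?n. - (s ^ (?n - 1 - k)) * in_coords A c (I_fun A g gb k) z) has_derivative P s) (at (?x0, q))"
      unfolding P_def by (intro has_derivative_sum has_derivative_mult_right D)
    then show ?thesis
    proof (rule has_derivative_transform_within_open[of _ _ _ UNIV "U \<times> UNIV"])
      show "open (U \<times> (UNIV :: (real ^ 'n) set))" using U(1) by (simp add: open_Times)
      show "(?x0, q) \<in> U \<times> UNIV" using U(2) by simp
      fix z assume "z \<in> U \<times> (UNIV :: (real ^ 'n) set)"
      then obtain x p where "z = (x, p)" "x \<in> U" by auto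
      then show "(\<Sum>k<?n. - (s ^ (?n - 1 - k)) * in_coords A c (I_fun A g gb k) z) =
          resolvent_function (local_metric g c) ?L s z"
        using resolvent_function_in_coords[OF c, of x s p] U(3)[of x] by simp
    qed
  qed
  have linD: "linear (D k)" for k by (rule has_derivative_linear[OF D])
  have linP: "linear (P s)" if "\<bar>s\<bar> < \<epsilon>" for s by (rule has_derivative_linear[OF P[OF that]])
  \<comment> \<open>Coefficients are compared in two stages, here in s with t fixed and afterwards
    in t. The minus sign matches the one inside \<open>P\<close>.\<close>
  have left: "bracket_of_differentials (D k) (P t) = 0" if t: "\<bar>t\<bar> < \<epsilon>" for t
  proof -
    have "- bracket_of_differentials (D k) (P t) = 0"
    proof (rule power_sum_zero[OF \<epsilon>(1) _ kl(1)])
      fix s assume s: "\<bar>s\<bar> < \<epsilon>"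
      have "bracket_of_differentials (P s) (P t) = 0"
        by (rule resolvent_functions_commute[OF inv[OF s] inv[OF t] P[OF s] P[OF t]])
      then show "(\<Sum>k<?n. s ^ (?n - 1 - k) * - bracket_of_differentials (D k) (P t)) = 0"
        unfolding P_def[of s] bracket_sum_left[OF linP[OF t]] by simp
    qed
    then show ?thesis by simp
  qed
  have "- bracket_of_differentials (D l) (D k) = 0"
  proof (rule power_sum_zero[OF \<epsilon>(1) _ kl(2)])
    fix t assume t: "\<bar>t\<bar> < \<epsilon>"
    have "bracket_of_differentials (P t) (D k) = 0"
      using left[OF t] bracket_antisymmetric[of "P t" "D k"] by simp
    then show "(\<Sum>l<?n. t ^ (?n - 1 - l) * - bracket_of_differentials (D l) (D k)) = 0"
      unfolding P_def[of t] bracket_sum_left[OF linD] by simp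
  qed
  then show ?thesis using bracket_antisymmetric[of "D k" "D l"] by simp
qed

lemma in_coords_I_fun_has_derivative:
  assumes "c \<in> A" "m \<in> chart_dom c"
  shows "(in_coords A c (I_fun A g gb k) has_derivative
    frechet_derivative (in_coords A c (I_fun A g gb k)) (at (coord c m, q))) (at (coord c m, q))"
  using in_coords_I_fun_differentiable[OF assms] by (simp add: frechet_derivative_works)

theorem I_fun_poisson_commute:
  assumes kl: "k < CARD('n)" "l < CARD('n)"
  shows "poisson_commute A (I_fun A g gb k) (I_fun A g gb l)"
  unfolding poisson_commute_def
proof (intro ballI impI conjI)
  fix z c assume z: "z \<in> cotangent_bundle A" and c: "c \<in> A" and m: "fst z \<in> chart_dom c"
  have zc: "cotangent_coord c z = (coord c (fst z), snd z c)" by (simp add: cotangent_coord_def case_prod_beta)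
  show "in_coords A c (I_fun A g gb k) differentiable (at (cotangent_coord c z))"
    "in_coords A c (I_fun A g gb l) differentiable (at (cotangent_coord c z))"
    unfolding zc by (rule in_coords_I_fun_differentiable[OF c m])+
  note D = in_coords_I_fun_has_derivative[OF c m, of _ "snd z c"]
  show "poisson_bracket A c (I_fun A g gb k) (I_fun A g gb l) z = 0"
    unfolding poisson_bracket_def zc symplectic_form_hamiltonian_fields[OF D D]
    by (rule I_fun_brackets_vanish[OF c m kl D])
qed

text \<open>A trajectory may leave any given chart, so the derivative is computed at each time in a
  chart around the current point. There it is a multiple of a bracket with the last integral; a
  function with zero derivative on an interval is constant.\<close>

theorem I_fun_integral:
  assumes k: "k < CARD('n)"
  shows "integral_of_hamiltonian_flow A (geodesic_hamiltonian A g) (I_fun A g gb k)"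
  unfolding integral_of_hamiltonian_flow_def
proof (intro allI impI ballI)
  fix T :: "real set" and z s t
  assume tr: "hamiltonian_trajectory A (geodesic_hamiltonian A g) T z" and st: "s \<in> T" "t \<in> T"
  have T: "open T" "convex T"
    using tr is_interval_convex by (auto simp: hamiltonian_trajectory_def open_interval_def)
  have zT: "\<And>u. u \<in> T \<Longrightarrow> z u \<in> cotangent_bundle A" and cont: "continuous_on T (\<lambda>u. fst (z u))"
    using tr by (auto simp: hamiltonian_trajectory_def o_def)
  have "((\<lambda>u. I_fun A g gb k (z u)) has_derivative (\<lambda>h. 0)) (at u within T)" if u: "u \<in> T" for u
  proof -
    obtain c where c: "c \<in> A" and m: "fst (z u) \<in> chart_dom c" using g.charts_cover .
    let ?m = "fst (z u)" and ?q = "snd (z u) c"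
    have zc: "cotangent_coord c (z u) = (coord c ?m, ?q)" by (simp add: cotangent_coord_def case_prod_beta)
    let ?H = "in_coords A c (geodesic_hamiltonian A g)"
    define D where "D k = frechet_derivative (in_coords A c (I_fun A g gb k)) (at (coord c ?m, ?q))" for k
    have D: "(in_coords A c (I_fun A g gb k) has_derivative D k) (at (coord c ?m, ?q))" for k
      unfolding D_def by (rule in_coords_I_fun_has_derivative[OF c m])
    let ?l = "CARD('n) - 1"
    have "((\<lambda>y. - (1/2) * in_coords A c (I_fun A g gb ?l) y) has_derivative (\<lambda>h. - (1/2) * D ?l h)) (at (coord c ?m, ?q))"
      by (rule has_derivative_mult_right[OF D])
    then have H: "(?H has_derivative (\<lambda>h. - (1/2) * D ?l h)) (at (coord c ?m, ?q))"
      by (rule has_derivative_transform_within_open[of _ _ _ UNIV "chart_im c \<times> UNIV"])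
        (use g.open_chart_im[OF c] g.coord_in[OF c m] in \<open>auto simp: in_coords_hamiltonian[OF c] open_Times\<close>)
    have lin: "linear (D k)" by (rule has_derivative_linear[OF D])
    have "D k (hamiltonian_field ?H (cotangent_coord c (z u))) = bracket_of_differentials (D k) (\<lambda>h. - (1/2) * D ?l h)"
      unfolding zc by (rule differential_of_hamiltonian_field[OF lin H])
    \<comment> \<open>The single term is written as a sum over one index to bring it into the shape
      of \<open>bracket_sum_left\<close>.\<close>
    also have "\<dots> = - bracket_of_differentials (\<lambda>h. \<Sum>j\<in>{?l}. - (1/2) * D j h) (D k)"
      using bracket_antisymmetric[of "D k" "\<lambda>h. - (1/2) * D ?l h"] by simp
    also have "\<dots> = (1/2) * bracket_of_differentials (D ?l) (D k)"
      unfolding bracket_sum_left[OF lin] by simp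
    also have "\<dots> = 0"
      using I_fun_brackets_vanish[OF c m _ k D, of ?l] by simp
    finally have zero: "D k (hamiltonian_field ?H (cotangent_coord c (z u))) = 0" .
    have "((\<lambda>s. cotangent_coord c (z s)) has_vector_derivative
        hamiltonian_field ?H (cotangent_coord c (z u))) (at u)"
      using tr c u m unfolding hamiltonian_trajectory_def by blast
    from has_derivative_compose[OF this[unfolded has_vector_derivative_def], of "in_coords A c (I_fun A g gb k)" "D k"] D
    have "((\<lambda>s. in_coords A c (I_fun A g gb k) (cotangent_coord c (z s))) has_derivative
        (\<lambda>h. D k (h *\<^sub>R hamiltonian_field ?H (cotangent_coord c (z u))))) (at u)"
      unfolding zc by blast
    then have d0: "((\<lambda>s. in_coords A c (I_fun A g gb k) (cotangent_coord c (z s))) has_derivative (\<lambda>h. 0)) (at u)"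
      by (simp add: linear_cmul[OF lin] zero)
    \<comment> \<open>On this open set of times the base point stays in the chart c, so the
      coordinate expression is \<open>I_fun\<close> itself near u.\<close>
    let ?U = "T \<inter> (\<lambda>u. fst (z u)) -` chart_dom c"
    have "open ?U"
      by (rule continuous_open_preimage[OF cont T(1) g.open_chart_dom[OF c]])
    with d0 have "((\<lambda>u. I_fun A g gb k (z u)) has_derivative (\<lambda>h. 0)) (at u)"
      by (rule has_derivative_transform_within_open) (use u m zT in \<open>auto simp: g.in_coords_coord[OF c]\<close>)
    then show ?thesis by (rule has_derivative_at_withinI)
  qed
  from has_derivative_zero_constant[OF T(2) this] st
  show "I_fun A g gb k (z s) = I_fun A g gb k (z t)" by force
qed

end

theorem theorem1:
  fixes A :: "('m::{t2_space,second_countable_topology}, 'n::finite) chart set"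
    and g gb :: "('m, 'n) tensor2"
  assumes "smooth_atlas A"
    and "C2_riemannian_metric A g"
    and "C2_riemannian_metric A gb"
    and "geodesically_equivalent A g gb"
  shows "(\<forall>k<CARD('n). \<forall>l<CARD('n). poisson_commute A (I_fun A g gb k) (I_fun A g gb l)) \<and>
         (\<forall>k<CARD('n). integral_of_hamiltonian_flow A (geodesic_hamiltonian A g) (I_fun A g gb k))"
proof -
  interpret equivalent_metrics A g gb by unfold_locales (fact assms)+
  show ?thesis using I_fun_poisson_commute I_fun_integral by blast
qed

end
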